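(* Let $P$ be a polygon with $n$ edges and let $\mathcal{D}P$ be the surface obtained by identifying two copies of $P$ along corresponding edges, with punctures at the vertices (an $n$-punctured sphere). A periodic trajectory on $P$ is stable if and only if its lift to $\mathcal{D}P$ is null-homologous, i.e. represents $0$ in $H_1(\mathcal{D}P,\mathbb{Z})$.
   Context: Edges of an $n$-gon are labeled $1,\dots,n$; closeness of $n$-gons is measured by the positions of their labeled vertices. A trajectory on $P$ is a function $f:\mathbb{R}\to P$ with constant derivative except when $f(t)$ lies on an edge, where the direction is changed by elastic reflection in that edge; $f(t)$ is never a vertex. It is periodic if $f(0)=f(a)$, $f'(0)=f'(a)$ for some $a\neq 0$, normalized to $a=1$; the period is taken so that the first and last copies of $P$ in the unfolding along one period differ by a translation (so an even number of edges is struck per period). The unfolding of $P$ along $f$: each time $f$ strikes an edge, reflect $P$ across that edge and let the trajectory continue in a straight line; the unfolding is the union of the resulting polygons. Transfer of a closed path $f$ on $P$ to another $n$-gon $Q$: let $U\subset\mathbb{C}$ be the unfolding of $P$ along $f$ with $f(0)=0$, and let $U'$ be obtained by replacing each copy of $P$ by a copy of $Q$ (reflecting successively in the same sequence of edges). If $f(1)=e(t)$ for an edge $e$ of $U$ parametrized by $[0,1]$, let $e'$ be the corresponding edge of $U'$; rotate and rescale $f$ so that it ends at $e'(t)$. If the copies of $Q$ containing the two endpoints differ by a translation and $Q$ is sufficiently close to $P$, then some translate $g$ of the result is contained in $U'$, and $U'$ is the unfolding of $Q$ along $g$; $g$ is the path on $Q$ obtained from $f$ (a periodic trajectory if $f$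 is one). A periodic trajectory $f$ on an $n$-gon $P$ is stable if for every $n$-gon $Q$ sufficiently near $P$ this transfer applied to $f$ gives a periodic trajectory on $Q$. The lift of a periodic trajectory to $\mathcal{D}P$ is the closed path which follows $f$ and passes to the other copy of $P$ each time $f$ strikes an edge. *)

theory Defs
  imports "HOL-Analysis.Analysis" "HOL-Homology.Homology"
begin

subsection \<open>Labeled polygons\<close>

text \<open>
  An \<open>n\<close>-gon is the list of its vertices; edge \<open>i\<close> (with \<open>i < n\<close>, so edges are numbered from \<open>0\<close>)
  joins vertex \<open>i\<close> to vertex \<open>i + 1\<close> modulo \<open>n\<close>.
\<close>

definition edge_point :: "complex list \<Rightarrow> nat \<Rightarrow> real \<Rightarrow> complex" where
  "edge_point P i = linepath (P ! i) (P ! (Suc i mod length P))"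

definition edge :: "complex list \<Rightarrow> nat \<Rightarrow> complex set" where
  "edge P i = path_image (edge_point P i)"

definition boundary :: "complex list \<Rightarrow> complex set" where
  "boundary P = (\<Union>i<length P. edge P i)"

text \<open>Simple closed polygons: two distinct edges meet only in common endpoints.\<close>

definition ngon :: "nat \<Rightarrow> complex list \<Rightarrow> bool" where
  "ngon n P \<longleftrightarrow> length P = n \<and> n \<ge> 3 \<and> distinct P \<and>
     (\<forall>i<n. \<forall>j<n. i \<noteq> j \<longrightarrow>
        edge P i \<inter> edge P j = {P ! i, P ! (Suc i mod n)} \<inter> {P ! j, P ! (Suc j mod n)})"

text \<open>The closed planar region bounded by the polygon.\<close>

definition region :: "complex list \<Rightarrow> complex set" where
  "region P = boundary P \<union> inside (boundary P)"


subsection \<open>Reflections and trajectories\<close>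

text \<open>
  Reflection in the line through \<open>a\<close> and \<open>b\<close> is \<open>z \<mapsto> a + (d / cnj d) * cnj (z - a)\<close> with \<open>d = b - a\<close>;
  \<open>reflect_dir\<close> is its linear part.
\<close>

definition reflect_dir :: "complex list \<Rightarrow> nat \<Rightarrow> complex \<Rightarrow> complex" where
  "reflect_dir P i u = (let d = P ! (Suc i mod length P) - P ! i in d / cnj d * cnj u)"

definition reflect :: "complex list \<Rightarrow> nat \<Rightarrow> complex \<Rightarrow> complex" where
  "reflect P i z = P ! i + reflect_dir P i (z - P ! i)"

text \<open>
  Near each time \<open>t\<close> the motion is affine on either side, with incoming velocity \<open>u\<close> and outgoing
  velocity \<open>w\<close>. These agree off the edges (so the derivative is constant between bounces) and are
  related by the reflection law on an edge. The speed is nonzero, so constant maps are excluded.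
\<close>

definition trajectory :: "complex list \<Rightarrow> (real \<Rightarrow> complex) \<Rightarrow> bool" where
  "trajectory P f \<longleftrightarrow>
     (\<forall>t. f t \<in> region P \<and> f t \<notin> set P \<and>
        (\<exists>u w. \<exists>\<epsilon>>0. u \<noteq> 0 \<and>
           (\<forall>h\<in>{0..\<epsilon>}. f (t - h) = f t - of_real h * u \<and> f (t + h) = f t + of_real h * w) \<and>
           (f t \<notin> boundary P \<longrightarrow> w = u) \<and>
           (\<forall>i<length P. f t \<in> edge P i \<longrightarrow> w = reflect_dir P i u)))"


subsection \<open>Unfolding\<close>

text \<open>
  Times in \<open>{0<..t}\<close> at which the path strikes an edge, in increasing order (this set is finite for
  a trajectory), and the edges struck. The edge is unique because the path avoids the vertices.
\<close>

definition strike_times :: "complex list \<Rightarrow> (real \<Rightarrow> complex) \<Rightarrow> real \<Rightarrow> real list" where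
  "strike_times P f t = sorted_list_of_set {s \<in> {0<..t}. f s \<in> boundary P}"

definition itinerary :: "complex list \<Rightarrow> (real \<Rightarrow> complex) \<Rightarrow> real \<Rightarrow> nat list" where
  "itinerary P f t = map (\<lambda>s. THE i. i < length P \<and> f s \<in> edge P i) (strike_times P f t)"

text \<open>
  \<open>develop P [e\<^sub>1, \<dots>, e\<^sub>k]\<close> is the isometry carrying \<open>P\<close> to its copy after reflecting successively in
  the edges \<open>e\<^sub>1, \<dots>, e\<^sub>k\<close>. If \<open>T\<close> carries \<open>P\<close> to the current copy, then the reflection in the edge
  \<open>e\<close> of that copy is \<open>T \<circ> reflect P e \<circ> inv T\<close>, so the next copy is given by \<open>T \<circ> reflect P e\<close>:
  new reflections are composed on the inside.
\<close>

primrec develop :: "complex list \<Rightarrow> nat list \<Rightarrow> complex \<Rightarrow> complex" where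
  "develop P [] = id"
| "develop P (e # es) = reflect P e \<circ> develop P es"

definition unfolding_region :: "complex list \<Rightarrow> nat list \<Rightarrow> complex set" where
  "unfolding_region P es = (\<Union>k\<le>length es. develop P (take k es) ` region P)"

text \<open>The straightened path inside the unfolding, for times \<open>t \<ge> 0\<close>.\<close>

definition unfolded_path :: "complex list \<Rightarrow> (real \<Rightarrow> complex) \<Rightarrow> real \<Rightarrow> complex" where
  "unfolded_path P f t = develop P (itinerary P f t) (f t)"

definition is_translation :: "(complex \<Rightarrow> complex) \<Rightarrow> bool" where
  "is_translation T \<longleftrightarrow> (\<exists>\<tau>. \<forall>z. T z = z + \<tau>)"

text \<open>
  The derivative is compared from the right, so that \<open>f 0\<close> is allowed to lie on an edge. The last
  condition says that the first and last copies of \<open>P\<close> (as labeled polygons) differ by a translation.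
\<close>

definition periodic_trajectory :: "complex list \<Rightarrow> (real \<Rightarrow> complex) \<Rightarrow> bool" where
  "periodic_trajectory P f \<longleftrightarrow> trajectory P f \<and> f 0 = f 1 \<and>
     (\<exists>u. (f has_vector_derivative u) (at_right 0) \<and> (f has_vector_derivative u) (at_right 1)) \<and>
     is_translation (develop P (itinerary P f 1))"


subsection \<open>Transfer and stability\<close>

text \<open>
  \<open>transfer_based P f Q g\<close>: \<open>g\<close> is a path on \<open>Q\<close> obtained from the closed path \<open>f\<close> starting (and
  ending) at the point with parameter \<open>r\<close> of edge \<open>i\<close>. The points \<open>a\<close> and \<open>b\<close> are the points with the
  same parameter on the corresponding edges of the first and last copies of \<open>Q\<close>. The unfolded path
  of \<open>f\<close> is rotated and rescaled by \<open>k\<close> so that its displacement becomes \<open>b - a\<close>, and a translate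
  \<open>\<lambda>t. c + k * \<dots>\<close> of the result lies in the unfolding built from \<open>Q\<close>; that this is the unfolding
  of \<open>Q\<close> along \<open>g\<close> is the equality of itineraries.
\<close>

definition transfer_based ::
  "complex list \<Rightarrow> (real \<Rightarrow> complex) \<Rightarrow> complex list \<Rightarrow> (real \<Rightarrow> complex) \<Rightarrow> bool" where
  "transfer_based P f Q g \<longleftrightarrow>
     (\<exists>i<length P. \<exists>r\<in>{0..1}. f 0 = edge_point P i r \<and>
       (let es = itinerary P f 1; F = unfolded_path P f;
            a = edge_point Q i r; b = develop Q es (edge_point Q i r)
        in is_translation (develop Q es) \<and>
           (\<exists>k c. k * (F 1 - F 0) = b - a \<and>
              (\<forall>t\<in>{0..1}. c + k * (F t - F 0) \<in> unfolding_region Q es) \<and>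
              itinerary Q g 1 = es \<and>
              (\<forall>t\<in>{0..1}. unfolded_path Q g t = c + k * (F t - F 0)))))"

text \<open>
  A closed path that does not start on an edge is first reparametrized to do so.
\<close>

definition transfer_to ::
  "complex list \<Rightarrow> (real \<Rightarrow> complex) \<Rightarrow> complex list \<Rightarrow> (real \<Rightarrow> complex) \<Rightarrow> bool" where
  "transfer_to P f Q g \<longleftrightarrow>
     (\<exists>s. f s \<in> boundary P \<and> transfer_based P (\<lambda>t. f (s + t)) Q g)"

definition stable_trajectory :: "complex list \<Rightarrow> (real \<Rightarrow> complex) \<Rightarrow> bool" where
  "stable_trajectory P f \<longleftrightarrow>
     (\<exists>\<epsilon>>0. \<forall>Q. ngon (length P) Q \<and> (\<forall>i<length P. dist (P ! i) (Q ! i) < \<epsilon>) \<longrightarrow>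
        (\<exists>g. transfer_to P f Q g \<and> periodic_trajectory Q g))"


subsection \<open>The doubled polygon\<close>

text \<open>The two copies of the region are distinguished by a \<open>bool\<close>; the vertices are removed.\<close>

definition two_sheets :: "complex list \<Rightarrow> (complex \<times> bool) set" where
  "two_sheets P = (region P - set P) \<times> UNIV"

definition glue :: "complex list \<Rightarrow> ((complex \<times> bool) \<times> (complex \<times> bool)) set" where
  "glue P = {(x, y). x \<in> two_sheets P \<and> y \<in> two_sheets P \<and> fst x = fst y \<and>
                     (snd x = snd y \<or> fst x \<in> boundary P)}"

definition glue_class :: "complex list \<Rightarrow> complex \<times> bool \<Rightarrow> (complex \<times> bool) set" where
  "glue_class P x = glue P `` {x}"

definition double :: "complex list \<Rightarrow> (complex \<times> bool) set topology" where
  "double P = topology (\<lambda>U. U \<subseteq> two_sheets P // glue P \<and>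
     openin (top_of_set (two_sheets P)) {x \<in> two_sheets P. glue_class P x \<in> U})"

lemma equiv_glue: "equiv (two_sheets P) (glue P)"
  by (rule equivI) (auto simp: glue_def refl_on_def sym_def trans_def)

lemma openin_double:
  "openin (double P) U \<longleftrightarrow> U \<subseteq> two_sheets P // glue P \<and>
     openin (top_of_set (two_sheets P)) {x \<in> two_sheets P. glue_class P x \<in> U}"
proof -
  let ?T = "top_of_set (two_sheets P)"
  let ?L = "\<lambda>U. U \<subseteq> two_sheets P // glue P \<and>
     openin ?T {x \<in> two_sheets P. glue_class P x \<in> U}"
  have "istopology ?L"
    unfolding istopology_def
  proof (intro conjI allI impI)
    fix S T assume "?L S" "?L T"
    then have "openin ?T ({x \<in> two_sheets P. glue_class P x \<in> S} \<inter>
                          {x \<in> two_sheets P. glue_class P x \<in> T})"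
      by blast
    moreover have "{x \<in> two_sheets P. glue_class P x \<in> S} \<inter>
                   {x \<in> two_sheets P. glue_class P x \<in> T} =
                   {x \<in> two_sheets P. glue_class P x \<in> S \<inter> T}"
      by blast
    ultimately show "openin ?T {x \<in> two_sheets P. glue_class P x \<in> S \<inter> T}"
      by simp
    show "S \<inter> T \<subseteq> two_sheets P // glue P"
      using \<open>?L S\<close> by blast
  next
    fix K assume K: "\<forall>S\<in>K. ?L S"
    have "openin ?T (\<Union>S\<in>K. {x \<in> two_sheets P. glue_class P x \<in> S})"
      using K by blast
    moreover have "(\<Union>S\<in>K. {x \<in> two_sheets P. glue_class P x \<in> S}) =
                   {x \<in> two_sheets P. glue_class P x \<in> \<Union>K}"
      by blast
    ultimately show "openin ?T {x \<in> two_sheets P. glue_class P x \<in> \<Union>K}"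
      by simp
    show "\<Union>K \<subseteq> two_sheets P // glue P"
      using K by blast
  qed
  then show ?thesis
    by (simp add: double_def)
qed

lemma topspace_double: "topspace (double P) = two_sheets P // glue P"
proof -
  have "{x \<in> two_sheets P. glue_class P x \<in> two_sheets P // glue P} = two_sheets P"
    by (auto simp: glue_class_def quotientI)
  then have "openin (double P) (two_sheets P // glue P)"
    by (simp add: openin_double)
  then show ?thesis
    by (meson openin_double openin_subset openin_topspace subset_antisym)
qed

lemma quotient_map_double:
  "quotient_map (top_of_set (two_sheets P)) (double P) (glue_class P)"
  unfolding quotient_map_def topspace_double topspace_euclidean_subtopology
  by (auto simp: openin_double glue_class_def quotient_def)

text \<open>The sheet changes at every strike; at a strike itself both sheets give the same point.\<close>

definition lift_path :: "complex list \<Rightarrow> (real \<Rightarrow> complex) \<Rightarrow> real \<Rightarrow> (complex \<times> bool) set" where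
  "lift_path P f t = glue_class P (f t, odd (length (itinerary P f t)))"


subsection \<open>Homology class of a closed path\<close>

text \<open>
  The closed path \<open>\<gamma>\<close> on \<open>[0,1]\<close> is turned into a singular \<open>1\<close>-simplex through the barycentric
  coordinate \<open>x 1\<close>, and its class is the corresponding element of \<open>homology_group 1 X\<close>.
\<close>

definition path_simplex :: "(real \<Rightarrow> 'a) \<Rightarrow> (nat \<Rightarrow> real) \<Rightarrow> 'a" where
  "path_simplex \<gamma> = restrict (\<lambda>x. \<gamma> (x 1)) (standard_simplex 1)"

definition path_homology_class :: "'a topology \<Rightarrow> (real \<Rightarrow> 'a) \<Rightarrow> 'a chain set" where
  "path_homology_class X \<gamma> = homologous_rel_set 1 X {} (frag_of (path_simplex \<gamma>))"

definition null_homologous :: "'a topology \<Rightarrow> (real \<Rightarrow> 'a) \<Rightarrow> bool" where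
  "null_homologous X \<gamma> \<longleftrightarrow> path_homology_class X \<gamma> = \<one>\<^bsub>homology_group 1 X\<^esub>"

end

theory Submission
  imports Defs "HOL-Complex_Analysis.Complex_Analysis"
begin

text \<open>
  Let \<open>c\<^sub>i\<close> be the number of times the trajectory strikes edge \<open>i\<close> during one period, counted with
  alternating signs. Both properties are equivalent to the vanishing of every \<open>c\<^sub>i\<close>.

  The last copy of \<open>Q\<close> in the unfolding is obtained from the first by a rotation through
  \<open>2 \<Sum> c\<^sub>i \<theta>\<^sub>i\<close>, where \<open>\<theta>\<^sub>i\<close> is the direction of edge \<open>i\<close> of \<open>Q\<close>, followed by a translation. If all
  \<open>c\<^sub>i\<close> vanish there is no rotation, and the straight line through the unfolding of \<open>P\<close>, which meets
  the edges transversally, persists for \<open>Q\<close> near \<open>P\<close>. Conversely, moving the vertex common to the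
  edges \<open>i\<close> and \<open>i + 1\<close> shows that \<open>c\<^sub>i \<noteq> 0\<close> forces the two edges to be parallel and \<open>c\<^sub>i\<^sub>+\<^sub>1\<close> to have
  the sign of \<open>c\<^sub>i\<close>; all \<open>c\<^sub>i\<close> would then have the same sign, but their sum is \<open>0\<close> because an even
  number of edges is struck.

  For the homology, a sheet (the region without the vertices) is contractible, so the lift is
  homologous to \<open>\<Sum> c\<^sub>i L\<^sub>i\<close>, where \<open>L\<^sub>i\<close> runs from a base point to edge \<open>i\<close> in one sheet and back in the
  other. Let \<open>h\<^sub>i\<close> be a continuous function that is \<open>1\<close> on edge \<open>i\<close> and \<open>0\<close> on the other edges. The
  functions \<open>exp (\<plusminus> \<pi> \<i> h\<^sub>i)\<close> on the two sheets agree on all edges, and the winding number of the image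
  of \<open>\<Sum> c\<^sub>j L\<^sub>j\<close> under the resulting map is \<open>c\<^sub>i\<close>.
\<close>

subsection \<open>Singular one-chains\<close>

text \<open>A trajectory is given by local conditions only, so neither its itinerary nor the
  continuity of its lift comes with a formula. Most facts about it are obtained by showing that a
  statement depending on time is locally constant on a connected set of times. This needs strikes to
  be isolated, which in turn rests on the impossibility of grazing an edge. The homology of the
  punctured sphere is never computed: it suffices that an alternating sum of the chains attached to
  the edges bounds only if all its coefficients vanish. These chains need not be loops. Each leads
  from the base point in one sheet to its copy in the other, and both these ends and the
  contribution of the base point to the winding number cancel because the number of strikes is even.
  In the converse for stability two displacements of one vertex suffice. Moving it along the second
  of its edges can turn only the first, which forces the two to be parallel; moving it at right
  angles to them then turns them in opposite senses, which compares the signs of their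
  counts.\<close>

definition seg :: "(real \<Rightarrow> 'a) \<Rightarrow> real \<Rightarrow> real \<Rightarrow> (nat \<Rightarrow> real) \<Rightarrow> 'a" where
  "seg \<gamma> a b = restrict (\<lambda>x. \<gamma> (a * x 0 + b * x 1)) (standard_simplex 1)"

lemma standard_simplex_Suc_0:
  "x \<in> standard_simplex (Suc 0) \<longleftrightarrow> 0 \<le> x 0 \<and> 0 \<le> x (Suc 0) \<and> x 0 + x (Suc 0) = 1 \<and> (\<forall>i>Suc 0. x i = 0)"
  (is "_ \<longleftrightarrow> ?R")
proof -
  have "0 \<le> x i \<and> x i \<le> 1" if ?R for i
  proof -
    consider "i = 0" | "i = Suc 0" | "i > Suc 0" by linarith
    then show ?thesis using that by cases (linarith | simp)+
  qed
  moreover have "(\<Sum>i\<le>Suc 0. x i) = x 0 + x (Suc 0)"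
    by simp
  ultimately show ?thesis
    unfolding standard_simplex_def mem_Collect_eq by metis
qed

lemma standard_simplex_2:
  "x \<in> standard_simplex 2 \<longleftrightarrow>
     0 \<le> x 0 \<and> 0 \<le> x (Suc 0) \<and> 0 \<le> x 2 \<and> x 0 + x (Suc 0) + x 2 = 1 \<and> (\<forall>i>2. x i = 0)"
  (is "_ \<longleftrightarrow> ?R")
proof -
  have "0 \<le> x i \<and> x i \<le> 1" if ?R for i
  proof -
    consider "i = 0" | "i = Suc 0" | "i = 2" | "i > 2" by linarith
    then show ?thesis using that by cases (linarith | simp)+
  qed
  moreover have "(\<Sum>i\<le>2. x i) = x 0 + x (Suc 0) + x 2"
    by (simp add: numeral_2_eq_2)
  ultimately show ?thesis
    unfolding standard_simplex_def mem_Collect_eq by metis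
qed

lemma path_simplex_eq_seg: "path_simplex \<gamma> = seg \<gamma> 0 1"
  by (simp add: path_simplex_def seg_def)

lemma convex_comb2_in:
  fixes a b u v :: real
  assumes "0 \<le> u" "0 \<le> v" "u + v = 1" "a \<le> b"
  shows "a * u + b * v \<in> {a..b}"
proof -
  have u: "u = 1 - v"
    using assms(3) by simp
  have "a * u + b * v = a + (b - a) * v" "a * u + b * v = b - (b - a) * u"
    by (simp_all add: u algebra_simps)
  moreover have "0 \<le> (b - a) * v" "0 \<le> (b - a) * u"
    using assms by auto
  ultimately show ?thesis
    by auto
qed

lemma convex_comb3_in:
  fixes a m b u v w :: real
  assumes "0 \<le> u" "0 \<le> v" "0 \<le> w" "u + v + w = 1" "a \<le> m" "m \<le> b"
  shows "a * u + m * v + b * w \<in> {a..b}"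
proof -
  have u: "u = 1 - v - w"
    using assms(4) by simp
  have "a * u + m * v + b * w = a + (m - a) * v + (b - a) * w"
    "a * u + m * v + b * w = b - (b - a) * u - (b - m) * v"
    by (simp_all add: u algebra_simps)
  moreover have "0 \<le> (m - a) * v" "0 \<le> (b - a) * w" "0 \<le> (b - a) * u" "0 \<le> (b - m) * v"
    using assms by auto
  ultimately show ?thesis
    by auto
qed

lemma continuous_map_simplex_comb:
  "continuous_map (subtopology (powertop_real UNIV) S) euclideanreal (\<lambda>x. a * x i + b * x j + c * x k)"
  by (intro continuous_map_add continuous_map_real_mult continuous_map_from_subtopology
       continuous_map_product_projection) auto

lemma singular_simplex_seg:
  assumes "continuous_map (top_of_set {a..b}) X \<gamma>" "a \<le> b"
  shows "singular_simplex 1 X (seg \<gamma> a b)"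
proof -
  have "continuous_map (subtopology (powertop_real UNIV) (standard_simplex 1)) (top_of_set {a..b})
          (\<lambda>x. a * x 0 + b * x 1)"
    unfolding continuous_map_in_subtopology
    using continuous_map_simplex_comb[of "standard_simplex 1" a 0 b 1 0 0] assms(2)
    by (auto simp: standard_simplex_Suc_0 intro!: convex_comb2_in)
  from continuous_map_compose[OF this assms(1)] show ?thesis
    by (auto simp: singular_simplex_def seg_def o_def)
qed

text \<open>The two-simplex is \<open>\<gamma>\<close> composed with the affine map sending the vertices to \<open>a\<close>, \<open>m\<close>, \<open>b\<close>.\<close>

lemma seg_join:
  assumes \<gamma>: "continuous_map (top_of_set {a..b}) X \<gamma>" and "a \<le> m" "m \<le> b"
  shows "homologous_rel 1 X {} (frag_of (seg \<gamma> a b)) (frag_of (seg \<gamma> a m) + frag_of (seg \<gamma> m b))"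
proof -
  define \<tau> where "\<tau> = restrict (\<lambda>x. \<gamma> (a * x 0 + m * x 1 + b * x 2)) (standard_simplex 2)"
  have "continuous_map (subtopology (powertop_real UNIV) (standard_simplex 2)) (top_of_set {a..b})
          (\<lambda>x. a * x 0 + m * x 1 + b * x 2)"
    unfolding continuous_map_in_subtopology
    using continuous_map_simplex_comb[of "standard_simplex 2" a 0 m 1 b 2] assms(2,3)
    by (auto simp: standard_simplex_2 intro!: convex_comb3_in)
  from continuous_map_compose[OF this \<gamma>]
  have "singular_simplex 2 X \<tau>"
    by (auto simp: singular_simplex_def \<tau>_def o_def)
  then have c: "singular_chain (Suc 1) X (frag_of \<tau>)"
    by (simp add: singular_chain_of numeral_2_eq_2)
  have in2: "simplical_face k x \<in> standard_simplex 2" if "k \<le> 2" "x \<in> standard_simplex 1" for k x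
    using simplical_face_in_standard_simplex[of 2 k x] that by simp
  have f0: "singular_face 2 0 \<tau> = seg \<gamma> m b" and f1: "singular_face 2 1 \<tau> = seg \<gamma> a b"
    and f2: "singular_face 2 2 \<tau> = seg \<gamma> a m"
    using in2[of 0] in2[of 1] in2[of 2]
    by (auto simp: singular_face_def seg_def \<tau>_def simplical_face_def restrict_def fun_eq_iff)
  have "chain_boundary 2 (frag_of \<tau>) =
     frag_of (seg \<gamma> m b) - frag_of (seg \<gamma> a b) + frag_of (seg \<gamma> a m)"
    by (simp add: chain_boundary_of numeral_2_eq_2 f0[unfolded numeral_2_eq_2]
       f1[unfolded numeral_2_eq_2 One_nat_def] f2[unfolded numeral_2_eq_2])
  then have "singular_relboundary 1 X {} (frag_of (seg \<gamma> m b) - frag_of (seg \<gamma> a b) + frag_of (seg \<gamma> a m))"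
    using c unfolding singular_boundary by (metis Suc_1)
  then have "singular_relboundary 1 X {} (- (frag_of (seg \<gamma> m b) - frag_of (seg \<gamma> a b) + frag_of (seg \<gamma> a m)))"
    using singular_relboundary_minus by blast
  then show ?thesis
    unfolding homologous_rel_def by (simp add: algebra_simps)
qed

definition point_simplex :: "'a \<Rightarrow> (nat \<Rightarrow> real) \<Rightarrow> 'a" where
  "point_simplex x = restrict (\<lambda>_. x) (standard_simplex 0)"

lemma chain_boundary_seg:
  "chain_boundary 1 (frag_of (seg \<gamma> a b)) = frag_of (point_simplex (\<gamma> b)) - frag_of (point_simplex (\<gamma> a))"
proof -
  have in1: "simplical_face k x \<in> standard_simplex 1" if "k \<le> 1" "x \<in> standard_simplex 0" for k x
    using simplical_face_in_standard_simplex[of 1 k x] that by simp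
  have "singular_face 1 0 (seg \<gamma> a b) = point_simplex (\<gamma> b)" "singular_face 1 1 (seg \<gamma> a b) = point_simplex (\<gamma> a)"
    using in1[of 0] in1[of 1]
    by (auto simp: singular_face_def seg_def point_simplex_def simplical_face_def restrict_def
      fun_eq_iff standard_simplex_0)
  then show ?thesis
    by (simp add: chain_boundary_of)
qed

lemma simplex_map_seg: "simplex_map 1 q (seg \<gamma> a b) = seg (\<lambda>t. q (\<gamma> t)) a b"
  by (auto simp: simplex_map_def seg_def restrict_def)

text \<open>A contraction makes the cycle homologous to its image under a constant map. That image
  is a cycle of a one-point space, where every cycle of degree 1 bounds.\<close>

lemma contractible_cycle_is_boundary:
  assumes "contractible_space X" "singular_relcycle 1 X {} c"
  shows "singular_relboundary 1 X {} c"
proof -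
  obtain a where h: "homotopic_with (\<lambda>x. True) X X id (\<lambda>x. a)"
    using assms(1) unfolding contractible_space_def by blast
  have "homologous_rel 1 X {} (chain_map 1 id c) (chain_map 1 (\<lambda>x. a) c)"
    using homotopic_imp_homologous_rel_chain_maps[of "{}" "{}" X X id "\<lambda>x. a" 1 c] h assms(2)
    by simp
  moreover have "chain_map 1 id c = c"
    using assms(2) unfolding singular_cycle using chain_map_ident by blast
  moreover have "singular_relboundary 1 X {} (chain_map 1 (\<lambda>x. a) c)"
  \<comment> \<open>An empty space has no point to contract to, but its only chain is 0.\<close>
  proof (cases "topspace X = {}")
    case True
    then show ?thesis
      using assms(2) by (simp add: singular_cycle singular_chain_empty)
  next
    case False
    then have a: "a \<in> topspace X"
      using homotopic_with_imp_continuous_maps[OF h] by auto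
    let ?Y = "subtopology X {a}"
    have cm: "continuous_map X ?Y (\<lambda>x. a)"
      using a by (simp add: continuous_map_in_subtopology)
    have "singular_relcycle 1 ?Y {} (chain_map 1 (\<lambda>x. a) c)"
      by (rule singular_relcycle_chain_map[OF assms(2) cm]) auto
    then have "singular_relboundary 1 ?Y {} (chain_map 1 (\<lambda>x. a) c)"
      using singular_boundary_eq_cycle_singleton[of ?Y a 1] a by simp
    then show ?thesis
      using singular_boundary_mono[of "{a}" "topspace X" 1 X] a by simp
  qed
  ultimately show ?thesis
    unfolding homologous_rel_def
    by (metis diff_add_cancel singular_relboundary_add)
qed

lemma null_homologous_iff:
  "null_homologous X \<gamma> \<longleftrightarrow> homologous_rel 1 X {} (frag_of (seg \<gamma> 0 1)) 0"
proof -
  have "one (homology_group 1 X) = homologous_rel_set 1 X {} 0"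
    using one_relative_homology_group[of 1 X "{}"] singular_relboundary_minus[of 1 X "{}"]
    by (simp add: homologous_rel_def)
  then show ?thesis
    unfolding null_homologous_def path_homology_class_def path_simplex_eq_seg
    by (simp only: homologous_rel_set_eq)
qed

section \<open>Winding numbers of one-chains\<close>

definition edge_coords :: "real \<Rightarrow> nat \<Rightarrow> real" where
  "edge_coords t = (\<lambda>i. if i = 0 then 1 - t else if i = 1 then t else 0)"

text \<open>For a path that is not closed, the winding number is the change of a logarithm divided
  by \<open>2 * pi * \<i>\<close>. Its additive extension \<open>chain_winding\<close> is the
  continuous analogue of integrating \<open>dz / z\<close>, and makes sense on chains that are not
  cycles.\<close>

definition simplex_winding :: "('a \<Rightarrow> complex) \<Rightarrow> ((nat \<Rightarrow> real) \<Rightarrow> 'a) \<Rightarrow> complex" where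
  "simplex_winding \<phi> \<sigma> = winding_number (\<lambda>t. \<phi> (\<sigma> (edge_coords t))) 0"

definition chain_winding :: "('a \<Rightarrow> complex) \<Rightarrow> 'a chain \<Rightarrow> complex" where
  "chain_winding \<phi> c = (\<Sum>\<sigma>\<in>Poly_Mapping.keys c. of_int (Poly_Mapping.lookup c \<sigma>) * simplex_winding \<phi> \<sigma>)"

lemma chain_winding_superset:
  assumes "finite A" "Poly_Mapping.keys c \<subseteq> A"
  shows "chain_winding \<phi> c = (\<Sum>\<sigma>\<in>A. of_int (Poly_Mapping.lookup c \<sigma>) * simplex_winding \<phi> \<sigma>)"
  unfolding chain_winding_def using assms
  by (intro sum.mono_neutral_left) (auto simp: in_keys_iff)

lemma chain_winding_add: "chain_winding \<phi> (a + b) = chain_winding \<phi> a + chain_winding \<phi> b"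
proof -
  let ?A = "Poly_Mapping.keys a \<union> Poly_Mapping.keys b"
  have "chain_winding \<phi> c = (\<Sum>\<sigma>\<in>?A. of_int (Poly_Mapping.lookup c \<sigma>) * simplex_winding \<phi> \<sigma>)"
    if "c \<in> {a, b, a + b}" for c
    using that keys_add[of a b] by (intro chain_winding_superset) auto
  then show ?thesis
    by (simp add: lookup_add distrib_right sum.distrib)
qed

lemma chain_winding_0 [simp]: "chain_winding \<phi> 0 = 0"
  by (simp add: chain_winding_def)

lemma chain_winding_minus: "chain_winding \<phi> (- a) = - chain_winding \<phi> a"
  using chain_winding_add[of \<phi> a "- a"] by (simp add: eq_neg_iff_add_eq_0 add.commute)

lemma chain_winding_diff: "chain_winding \<phi> (a - b) = chain_winding \<phi> a - chain_winding \<phi> b"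
  using chain_winding_add[of \<phi> a "- b"] by (simp add: chain_winding_minus)

lemma chain_winding_of [simp]: "chain_winding \<phi> (frag_of \<sigma>) = simplex_winding \<phi> \<sigma>"
  by (simp add: chain_winding_def)

lemma edge_coords_in: "0 \<le> t \<Longrightarrow> t \<le> 1 \<Longrightarrow> edge_coords t \<in> standard_simplex 1"
  by (simp add: standard_simplex_Suc_0 edge_coords_def)

lemma simplex_winding_exp:
  assumes "path q" "\<And>t. t \<in> {0..1} \<Longrightarrow> \<phi> (\<sigma> (edge_coords t)) = exp (q t)"
  shows "simplex_winding \<phi> \<sigma> = (q 1 - q 0) / (2 * of_real pi * \<i>)"
proof -
  \<comment> \<open>The two paths agree on \<open>{0..1}\<close> only; unfolding the definition
    shows that nothing else enters.\<close>
  have "winding_number (\<lambda>t. \<phi> (\<sigma> (edge_coords t))) 0 = winding_number (exp \<circ> q) 0"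
    unfolding winding_number_def winding_number_prop_def path_image_def pathstart_def pathfinish_def
    using assms(2) by (simp cong: image_cong)
  then show ?thesis
    using winding_number_compose_exp[OF assms(1)]
    by (simp add: simplex_winding_def pathfinish_def pathstart_def)
qed

text \<open>On a triangle the nonvanishing function \<open>\<phi> \<circ> \<tau>\<close> has a
  continuous logarithm. Each face contributes the difference of its values at two corners, and
  around the boundary these differences cancel.\<close>

lemma chain_winding_boundary_simplex:
  assumes \<phi>: "continuous_map X euclidean \<phi>" "\<And>x. x \<in> topspace X \<Longrightarrow> \<phi> x \<noteq> 0"
    and \<tau>: "singular_simplex 2 X \<tau>"
  shows "chain_winding \<phi> (chain_boundary 2 (frag_of \<tau>)) = 0"
proof -
  \<comment> \<open>A planar copy of the standard triangle: \<open>e\<close> sends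
    \<open>(0,0)\<close>, \<open>(1,0)\<close>, \<open>(0,1)\<close> to the vertices 0, 1, 2.
    Convexity of \<open>T\<close> in the plane is what provides the logarithm.\<close>
  define T where "T = {p :: real \<times> real. 0 \<le> fst p \<and> 0 \<le> snd p \<and> fst p + snd p \<le> 1}"
  define e where "e = (\<lambda>(p::real\<times>real) i. if i = 0 then 1 - fst p - snd p else if i = 1 then fst p
     else if i = (2::nat) then snd p else 0)"
  have "convex T"
  proof (rule convexI)
    fix p q and u v :: real
    assume pq: "p \<in> T" "q \<in> T" and uv: "0 \<le> u" "0 \<le> v" "u + v = 1"
    then have "u * (fst p + snd p) + v * (fst q + snd q) \<le> 1"
      by (intro convex_bound_le) (auto simp: T_def)
    then show "u *\<^sub>R p + v *\<^sub>R q \<in> T"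
      using pq uv(1,2) by (simp add: T_def algebra_simps)
  qed
  have eT: "e p \<in> standard_simplex 2" if "p \<in> T" for p
    using that by (auto simp: T_def e_def standard_simplex_2)
  have "continuous_map (top_of_set T) (powertop_real UNIV) e"
    unfolding continuous_map_componentwise
  proof (intro conjI ballI)
    fix k :: nat
    consider "k = 0" | "k = 1" | "k = 2" | "k > 2" by linarith
    then show "continuous_map (top_of_set T) euclideanreal (\<lambda>p. e p k)"
      by cases (auto simp: e_def intro!: continuous_intros)
  qed auto
  then have e: "continuous_map (top_of_set T) (subtopology (powertop_real UNIV) (standard_simplex 2)) e"
    using eT by (auto simp: continuous_map_in_subtopology)
  have \<tau>c: "continuous_map (subtopology (powertop_real UNIV) (standard_simplex 2)) X \<tau>"
    using \<tau> by (simp add: singular_simplex_def)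
  have cm: "continuous_map (top_of_set T) X (\<tau> \<circ> e)"
    by (rule continuous_map_compose[OF e \<tau>c])
  have "continuous_map (top_of_set T) euclidean (\<phi> \<circ> (\<tau> \<circ> e))"
    by (rule continuous_map_compose[OF cm \<phi>(1)])
  then have cont: "continuous_on T (\<lambda>p. \<phi> (\<tau> (e p)))"
    by (simp add: o_def)
  have "\<phi> (\<tau> (e p)) \<noteq> 0" if "p \<in> T" for p
    using \<phi>(2) continuous_map_image_subset_topspace[OF cm] that by auto
  then obtain g where g: "continuous_on T g" "\<And>p. p \<in> T \<Longrightarrow> \<phi> (\<tau> (e p)) = exp (g p)"
    using continuous_logarithm_on_contractible[OF cont convex_imp_contractible[OF \<open>convex T\<close>]] by blast
  have face: "simplex_winding \<phi> (singular_face 2 k \<tau>) = (g (r 1) - g (r 0)) / (2 * of_real pi * \<i>)"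
    if "k \<le> 2" "continuous_on {0..1} r" "r ` {0..1} \<subseteq> T"
      "\<And>t. t \<in> {0..1} \<Longrightarrow> simplical_face k (edge_coords t) = e (r t)" for k r
  proof (rule simplex_winding_exp)
    show "path (\<lambda>t. g (r t))"
      unfolding path_def using continuous_on_compose2[OF g(1) that(2,3)] .
    fix t :: real assume t: "t \<in> {0..1}"
    then show "\<phi> (singular_face 2 k \<tau> (edge_coords t)) = exp (g (r t))"
      using that t g(2)[of "r t"] edge_coords_in[of t]
      by (auto simp: singular_face_def image_subset_iff)
  qed
  have "simplex_winding \<phi> (singular_face 2 0 \<tau>) = (g (0,1) - g (1,0)) / (2 * of_real pi * \<i>)"
  proof -
    have "simplical_face 0 (edge_coords t) i = e (1 - t, t) i" for t :: real and i
    proof -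
      consider "i = 0" | "i = 1" | "i = 2" | "i > 2" by linarith
      then show ?thesis
        by cases (auto simp: e_def simplical_face_def edge_coords_def)
    qed
    then have "simplical_face 0 (edge_coords t) = e (1 - t, t)" for t :: real
      by blast
    moreover have "continuous_on {0..1::real} (\<lambda>t. (1 - t, t))" "(\<lambda>t. (1 - t, t)) ` {0..1::real} \<subseteq> T"
      by (auto simp: T_def intro!: continuous_intros)
    ultimately show ?thesis
      using face[of 0 "\<lambda>t. (1 - t, t)"] by simp
  qed
  moreover have "simplex_winding \<phi> (singular_face 2 1 \<tau>) = (g (0,1) - g (0,0)) / (2 * of_real pi * \<i>)"
  proof -
    have "simplical_face 1 (edge_coords t) i = e (0, t) i" for t :: real and i
    proof -
      consider "i = 0" | "i = 1" | "i = 2" | "i > 2" by linarith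
      then show ?thesis
        by cases (auto simp: e_def simplical_face_def edge_coords_def)
    qed
    then have "simplical_face 1 (edge_coords t) = e (0, t)" for t :: real
      by blast
    moreover have "continuous_on {0..1::real} (\<lambda>t. (0, t))" "(\<lambda>t. (0, t)) ` {0..1::real} \<subseteq> T"
      by (auto simp: T_def intro!: continuous_intros)
    ultimately show ?thesis
      using face[of 1 "\<lambda>t. (0, t)"] by simp
  qed
  moreover have "simplex_winding \<phi> (singular_face 2 2 \<tau>) = (g (1,0) - g (0,0)) / (2 * of_real pi * \<i>)"
  proof -
    have "simplical_face 2 (edge_coords t) i = e (t, 0) i" for t :: real and i
    proof -
      consider "i = 0" | "i = 1" | "i = 2" | "i > 2" by linarith
      then show ?thesis
        by cases (auto simp: e_def simplical_face_def edge_coords_def)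
    qed
    then have "simplical_face 2 (edge_coords t) = e (t, 0)" for t :: real
      by blast
    moreover have "continuous_on {0..1::real} (\<lambda>t. (t, 0))" "(\<lambda>t. (t, 0)) ` {0..1::real} \<subseteq> T"
      by (auto simp: T_def intro!: continuous_intros)
    ultimately show ?thesis
      using face[of 2 "\<lambda>t. (t, 0)"] by simp
  qed
  ultimately show ?thesis
    by (simp add: chain_boundary_of numeral_2_eq_2 chain_winding_add chain_winding_diff chain_winding_minus diff_divide_distrib)
qed

text \<open>Vanishing on the boundary of one triangle extends additively to all two-chains, so
  winding depends on the homology class alone.\<close>

lemma chain_winding_homologous:
  assumes \<phi>: "continuous_map X euclidean \<phi>" "\<And>x. x \<in> topspace X \<Longrightarrow> \<phi> x \<noteq> 0"
    and "homologous_rel 1 X {} a b"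
  shows "chain_winding \<phi> a = chain_winding \<phi> b"
proof -
  obtain d where d: "singular_chain 2 X d" "chain_boundary 2 d = a - b"
    using assms(3) unfolding homologous_rel_def singular_boundary by (auto simp: numeral_2_eq_2)
  have "chain_winding \<phi> (chain_boundary 2 d) = 0"
    using d(1) unfolding singular_chain_def
  proof (induction d rule: frag_induction)
    case (one x)
    then show ?case
      using chain_winding_boundary_simplex[OF \<phi>] by auto
  next
    case (diff a b)
    then show ?case
      by (simp add: chain_boundary_diff chain_winding_diff)
  qed auto
  then show ?thesis
    using d(2) by (simp add: chain_winding_diff)
qed

subsection \<open>Polygons as Jordan curves\<close>

definition edge_dir :: "complex list \<Rightarrow> nat \<Rightarrow> complex" where
  "edge_dir P i = P ! (Suc i mod length P) - P ! i"

text \<open>The signed distance of \<open>z\<close> from the line of edge \<open>i\<close>, positive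
  to the left of the edge, multiplied by the length of the edge.\<close>

definition side :: "complex list \<Rightarrow> nat \<Rightarrow> complex \<Rightarrow> real" where
  "side P i z = Im ((z - P ! i) * cnj (edge_dir P i))"

lemma edge_eq_segment: "edge P i = closed_segment (P ! i) (P ! (Suc i mod length P))"
  by (simp add: edge_def edge_point_def)

lemma edge_point_eq: "edge_point P i r = P ! i + of_real r * edge_dir P i"
  by (simp add: edge_point_def linepath_def edge_dir_def scaleR_conv_of_real algebra_simps)

lemma edge_image: "edge P i = edge_point P i ` {0..1}"
  by (simp add: edge_def path_image_def)

lemma edgeI: "r \<in> {0..1} \<Longrightarrow> edge_point P i r \<in> edge P i"
  by (simp add: edge_image)

lemma edgeE:
  assumes "z \<in> edge P i"
  obtains r where "0 \<le> r" "r \<le> 1" "z = edge_point P i r"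
  using assms by (auto simp: edge_image)

lemma compact_edge: "compact (edge P i)"
  by (simp add: edge_eq_segment)

lemma edge_ends: "P ! i \<in> edge P i" "P ! (Suc i mod length P) \<in> edge P i"
  by (auto simp: edge_eq_segment)

lemma compact_boundary: "compact (boundary P)"
  unfolding boundary_def by (intro compact_UN) (auto simp: compact_edge)

lemma closed_boundary: "closed (boundary P)"
  by (simp add: compact_boundary compact_imp_closed)

lemma edge_subset_boundary: "i < length P \<Longrightarrow> edge P i \<subseteq> boundary P"
  by (auto simp: boundary_def)

lemma side_edge_point: "side P i (edge_point P i r) = 0"
  by (simp add: side_def edge_point_eq mult.assoc complex_mult_cnj)

lemma side_edge: "z \<in> edge P i \<Longrightarrow> side P i z = 0"
  by (elim edgeE) (simp add: side_edge_point)

lemma side_add: "side P i (z + w) = side P i z + Im (w * cnj (edge_dir P i))"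
  by (simp add: side_def algebra_simps)

lemma side_affine:
  assumes "u + v = 1"
  shows "side P i (u *\<^sub>R x + v *\<^sub>R y) = u * side P i x + v * side P i y"
proof -
  have u: "u = 1 - v"
    using assms by simp
  have "u *\<^sub>R x + v *\<^sub>R y - P ! i = u *\<^sub>R (x - P ! i) + v *\<^sub>R (y - P ! i)"
    by (simp add: u scaleR_diff_left algebra_simps)
  then show ?thesis
    by (simp add: side_def distrib_right)
qed

lemma side_eq_0:
  assumes "side P i z = 0" "edge_dir P i \<noteq> 0"
  obtains r where "z = edge_point P i r"
proof -
  let ?d = "edge_dir P i"
  define r where "r = Re ((z - P ! i) / ?d)"
  have "Im ((z - P ! i) / ?d) = 0"
    using assms(1) by (simp add: complex_div_cnj[of _ ?d] side_def)
  then have "(z - P ! i) / ?d = of_real r"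
    by (simp add: complex_eq_iff r_def)
  then have "z = edge_point P i r"
    using assms(2) by (simp add: edge_point_eq field_simps)
  then show ?thesis
    using that by blast
qed

lemma not_inside_outside: "x \<in> inside S \<Longrightarrow> x \<notin> outside S"
  using inside_Int_outside by blast

lemma not_inside_self: "x \<in> inside S \<Longrightarrow> x \<notin> S"
  using inside_no_overlap by blast

lemma not_outside_self: "x \<in> outside S \<Longrightarrow> x \<notin> S"
  using outside_no_overlap by blast

context
  fixes n P
  assumes ngon: "ngon n P"
begin

lemma ngon_length: "length P = n" and ngon_ge_3: "3 \<le> n" and ngon_distinct: "distinct P"
  using ngon by (auto simp: ngon_def)

lemma Suc_mod_neq: "i < n \<Longrightarrow> Suc i mod n \<noteq> i"
  using ngon_ge_3 by (cases "Suc i = n") auto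

lemma nth_neq: "i < n \<Longrightarrow> j < n \<Longrightarrow> i \<noteq> j \<Longrightarrow> P ! i \<noteq> P ! j"
  using ngon_distinct ngon_length nth_eq_iff_index_eq by blast

lemma edge_dir_neq_0: "i < n \<Longrightarrow> edge_dir P i \<noteq> 0"
  using nth_neq[of "Suc i mod n" i] Suc_mod_neq[of i] ngon_ge_3 by (auto simp: edge_dir_def ngon_length)

lemma edge_inter:
  "i < n \<Longrightarrow> j < n \<Longrightarrow> i \<noteq> j \<Longrightarrow> edge P i \<inter> edge P j = {P ! i, P ! (Suc i mod n)} \<inter> {P ! j, P ! (Suc j mod n)}"
  using ngon by (auto simp: ngon_def)

lemma vertex_in_set: "P ! (i mod n) \<in> set P"
  using ngon_ge_3 ngon_length by (simp add: nth_mem)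

lemma edge_inter_vertices: "i < n \<Longrightarrow> j < n \<Longrightarrow> i \<noteq> j \<Longrightarrow> edge P i \<inter> edge P j \<subseteq> set P"
  using edge_inter[of i j] vertex_in_set[of i] vertex_in_set[of "Suc i"] by auto

lemma unique_edge: "z \<notin> set P \<Longrightarrow> z \<in> edge P i \<Longrightarrow> z \<in> edge P j \<Longrightarrow> i < n \<Longrightarrow> j < n \<Longrightarrow> i = j"
  using edge_inter_vertices by blast

text \<open>Two edges meet at every vertex, so one of them is not edge \<open>i\<close>: the edge
  starting there or, if that is edge \<open>i\<close>, the one ending there. Consequently a set that
  misses \<open>other_edges i\<close> contains no vertex at all.\<close>

lemma vertex_other_edge:
  assumes "i < n" "k < n"
  obtains j where "j < n" "j \<noteq> i" "P ! k \<in> edge P j"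
proof (cases "k = i")
  case False
  then show ?thesis
    using that[of k] assms edge_ends by auto
next
  case True
  define j where "j = (if k = 0 then n - 1 else k - 1)"
  have "j < n" "Suc j mod n = k" "j \<noteq> i"
    using assms ngon_ge_3 True by (auto simp: j_def)
  then show ?thesis
    using that[of j] edge_ends(2)[of P j] by (auto simp: ngon_length)
qed

lemma edge_vertices: "i < n \<Longrightarrow> edge P i \<inter> set P = {P ! i, P ! (Suc i mod n)}"
proof -
  assume i: "i < n"
  have "P ! k \<in> {P ! i, P ! (Suc i mod n)}" if "k < n" "P ! k \<in> edge P i" for k
  proof (cases "k = i")
    case False
    then show ?thesis
      using edge_inter[of k i] i that edge_ends(1)[of P k] by auto
  qed auto
  then have "edge P i \<inter> set P \<subseteq> {P ! i, P ! (Suc i mod n)}"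
    unfolding set_conv_nth ngon_length by blast
  moreover have "{P ! i, P ! (Suc i mod n)} \<subseteq> edge P i \<inter> set P"
    using edge_ends[of P i] vertex_in_set[of i] vertex_in_set[of "Suc i"] i by (auto simp: ngon_length)
  ultimately show ?thesis
    by blast
qed

lemma edge_minus_vertices: "i < n \<Longrightarrow> edge P i - set P = open_segment (P ! i) (P ! (Suc i mod n))"
  using edge_vertices[of i] by (auto simp: open_segment_def edge_eq_segment ngon_length)

definition other_edges :: "nat \<Rightarrow> complex set" where
  "other_edges i = (\<Union>j\<in>{..<n} - {i}. edge P j)"

lemma compact_other_edges: "compact (other_edges i)"
  unfolding other_edges_def by (intro compact_UN) (auto simp: compact_edge)

lemma other_edges_nonempty: "other_edges i \<noteq> {}"
proof -
  have "(if i = 0 then 1 else 0) \<in> {..<n} - {i}"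
    using ngon_ge_3 by auto
  then show ?thesis
    using edge_ends(1) by (auto simp: other_edges_def)
qed

lemma boundary_split: "i < n \<Longrightarrow> boundary P = edge P i \<union> other_edges i"
  by (auto simp: boundary_def other_edges_def ngon_length)

lemma not_other_edges: "i < n \<Longrightarrow> z \<in> edge P i \<Longrightarrow> z \<notin> set P \<Longrightarrow> z \<notin> other_edges i"
  using unique_edge by (auto simp: other_edges_def)

lemma set_subset_other_edges: "i < n \<Longrightarrow> set P \<subseteq> other_edges i"
proof
  fix v assume i: "i < n" and "v \<in> set P"
  then obtain k where "k < n" "v = P ! k"
    by (auto simp: in_set_conv_nth ngon_length)
  then obtain j where "j < n" "j \<noteq> i" "v \<in> edge P j"
    using vertex_other_edge[OF i] by blast
  then show "v \<in> other_edges i"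
    by (auto simp: other_edges_def)
qed

lemma set_subset_boundary: "set P \<subseteq> boundary P"
  using set_subset_other_edges[of 0] boundary_split[of 0] ngon_ge_3 by auto

text \<open>The clamped coefficient of the edge \<open>k\<close> grows from 0 to 1 while
  \<open>n * t\<close> runs through \<open>{k..k + 1}\<close> and is constant otherwise. A single
  formula for all pieces makes continuity immediate.\<close>

definition polygon_path :: "real \<Rightarrow> complex" where
  "polygon_path t = P ! 0 + (\<Sum>k<n. of_real (max 0 (min 1 (real n * t - real k))) * edge_dir P k)"

lemma polygon_path_eq:
  assumes j: "j < n" and t: "real n * t \<in> {real j..real (Suc j)}"
  shows "polygon_path t = edge_point P j (real n * t - real j)"
proof -
  let ?c = "\<lambda>k. of_real (max 0 (min 1 (real n * t - real k))) * edge_dir P k"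
  have "(\<Sum>k<n. ?c k) = (\<Sum>k<Suc j. ?c k)"
    using j t by (intro sum.mono_neutral_right) (auto simp: max_def min_def)
  also have "\<dots> = (\<Sum>k<j. edge_dir P k) + of_real (real n * t - real j) * edge_dir P j"
  proof -
    have "(\<Sum>k<j. ?c k) = (\<Sum>k<j. edge_dir P k)"
    proof (rule sum.cong)
      fix k assume "k \<in> {..<j}"
      then have "real k + 1 \<le> real n * t"
        using t by auto
      then show "?c k = edge_dir P k"
        by (simp add: min_def)
    qed simp
    moreover have "max 0 (min 1 (real n * t - real j)) = real n * t - real j"
      using t by auto
    ultimately show ?thesis
      by simp
  qed
  also have "(\<Sum>k<j. edge_dir P k) = (\<Sum>k<j. P ! Suc k - P ! k)"
    using j by (intro sum.cong) (auto simp: edge_dir_def ngon_length)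
  also have "\<dots> = P ! j - P ! 0"
    by (rule sum_lessThan_telescope)
  finally show ?thesis
    by (simp add: polygon_path_def edge_point_eq)
qed

lemma path_polygon_path: "path polygon_path"
  unfolding path_def polygon_path_def by (intro continuous_intros)

lemma unit_interval_piece:
  assumes "t \<in> {0..<1}"
  obtains j where "j < n" "real n * t \<in> {real j..<real (Suc j)}"
proof
  let ?j = "nat \<lfloor>real n * t\<rfloor>"
  have "0 \<le> real n * t" "real n * t < n"
    using assms ngon_ge_3 by auto
  then show "?j < n" "real n * t \<in> {real ?j..<real (Suc ?j)}"
    by (auto simp: nat_less_iff floor_less_iff) linarith+
qed

lemma polygon_path_ends: "polygon_path 0 = P ! 0" "polygon_path 1 = P ! 0"
  using polygon_path_eq[of 0 0] polygon_path_eq[of "n - 1" 1] ngon_ge_3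
  by (auto simp: edge_point_eq edge_dir_def ngon_length of_nat_diff)

lemma path_image_polygon_path: "path_image polygon_path = boundary P"
proof
  show "path_image polygon_path \<subseteq> boundary P"
  proof
    fix z assume "z \<in> path_image polygon_path"
    then obtain t where t: "t \<in> {0..1}" "z = polygon_path t"
      by (auto simp: path_image_def)
    show "z \<in> boundary P"
    proof (cases "t = 1")
      case True
      then show ?thesis
        using t polygon_path_ends edge_ends(1)[of P 0] ngon_ge_3 by (auto simp: boundary_def ngon_length)
    next
      case False
      then obtain j where j: "j < n" "real n * t \<in> {real j..<real (Suc j)}"
        using unit_interval_piece[of t] t by auto
      then have "z = edge_point P j (real n * t - real j)"
        using t polygon_path_eq[of j t] by auto
      then show ?thesis
        using j edgeI[of "real n * t - real j" P j] by (auto simp: boundary_def ngon_length)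
    qed
  qed
next
  show "boundary P \<subseteq> path_image polygon_path"
  proof
    fix z assume "z \<in> boundary P"
    then obtain j r where j: "j < n" and r: "0 \<le> r" "r \<le> 1" "z = edge_point P j r"
      by (auto simp: boundary_def ngon_length elim: edgeE)
    define t where "t = (j + r) / n"
    have nt: "real n * t = j + r"
      using ngon_ge_3 by (simp add: t_def)
    have "j + r \<le> n"
      using j r by linarith
    then have "t \<in> {0..1}"
      using r ngon_ge_3 by (auto simp: t_def divide_simps)
    moreover have "polygon_path t = z"
      using polygon_path_eq[of j t] j r by (simp add: nt)
    ultimately show "z \<in> path_image polygon_path"
      by (auto simp: path_image_def)
  qed
qed

lemma edge_point_inject:
  assumes "i < n" "j < n" "r \<in> {0..<1}" "r' \<in> {0..<1}" "edge_point P i r = edge_point P j r'"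
  shows "i = j \<and> r = r'"
proof -
  have "r = r'" if "i = j"
    using assms that edge_dir_neq_0[of j] by (auto simp: edge_point_eq)
  moreover have False if ij: "i \<noteq> j"
  proof -
    \<comment> \<open>A point common to two edges is an endpoint of both. Parameters below 1 leave
      only the initial endpoint, and different edges have different initial vertices.\<close>
    have start: "edge_point P k s = P ! k"
      if "k < n" "s \<in> {0..<1}" "edge_point P k s \<in> {P ! k, P ! (Suc k mod n)}" for k s
    proof -
      have "edge_point P k s \<noteq> P ! (Suc k mod n)"
      proof
        assume "edge_point P k s = P ! (Suc k mod n)"
        then have "of_real s * edge_dir P k = 1 * edge_dir P k"
          by (simp add: edge_point_eq edge_dir_def ngon_length algebra_simps)
        then have "s = 1"
          using edge_dir_neq_0[OF that(1)] by (simp only: mult_cancel_right) auto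
        then show False
          using that(2) by simp
      qed
      then show ?thesis
        using that(3) by blast
    qed
    have "edge_point P i r \<in> edge P i \<inter> edge P j"
      using assms edgeI[of r P i] edgeI[of r' P j] by auto
    then have "edge_point P i r \<in> {P ! i, P ! (Suc i mod n)} \<inter> {P ! j, P ! (Suc j mod n)}"
      using edge_inter[of i j] assms ij by simp
    then have "edge_point P i r = P ! i" "edge_point P j r' = P ! j"
      using start[of i r] start[of j r'] assms by auto
    then show False
      using nth_neq[of i j] assms ij by simp
  qed
  ultimately show ?thesis
    by blast
qed

lemma simple_path_polygon_path: "simple_path polygon_path"
proof -
  have inj: "s = t" if st: "s \<in> {0..<1}" "t \<in> {0..<1}" and eq: "polygon_path s = polygon_path t" for s t
  proof -
    obtain i j where i: "i < n" "real n * s \<in> {real i..<real (Suc i)}"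
      and j: "j < n" "real n * t \<in> {real j..<real (Suc j)}"
      using unit_interval_piece st by metis
    have "edge_point P i (real n * s - real i) = edge_point P j (real n * t - real j)"
      using polygon_path_eq[of i s] polygon_path_eq[of j t] i j eq by auto
    then have "i = j \<and> real n * s - real i = real n * t - real j"
      using edge_point_inject[of i j "real n * s - real i" "real n * t - real j"] i j by auto
    then show "s = t"
      using ngon_ge_3 by auto
  qed
  have 1: "t \<in> {0, 1}" if "t \<in> {0..1}" "polygon_path t = P ! 0" for t
    using inj[of t 0] that polygon_path_ends by (cases "t = 1") auto
  have "s = t \<or> s = 0 \<and> t = 1 \<or> s = 1 \<and> t = 0"
    if st: "s \<in> {0..1}" "t \<in> {0..1}" "polygon_path s = polygon_path t" for s t
  proof (cases "s = 1 \<or> t = 1")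
    case True
    then show ?thesis
      using 1[of s] 1[of t] st polygon_path_ends by auto
  next
    case False
    then show ?thesis
      using inj[of s t] st by auto
  qed
  then show ?thesis
    using path_polygon_path by (auto simp: simple_path_def loop_free_def)
qed

lemma loop_polygon_path: "pathfinish polygon_path = pathstart polygon_path"
  by (simp add: pathfinish_def pathstart_def polygon_path_ends)

lemma polygon_jordan:
  "inside (boundary P) \<noteq> {}" "open (inside (boundary P))" "connected (inside (boundary P))"
  "open (outside (boundary P))"
  "frontier (inside (boundary P)) = boundary P" "frontier (outside (boundary P)) = boundary P"
  using Jordan_inside_outside[OF simple_path_polygon_path loop_polygon_path]
  by (auto simp: path_image_polygon_path)

lemma contractible_inside: "contractible (inside (boundary P))"
  using contractible_eq_simply_connected_2d[OF polygon_jordan(2)]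
    simply_connected_inside_simple_path[OF simple_path_polygon_path]
  by (simp add: path_image_polygon_path)

lemma connected_inside:
  assumes "connected S" "S \<inter> boundary P = {}" "x \<in> S" "x \<in> inside (boundary P)"
  shows "S \<subseteq> inside (boundary P)"
proof (rule ccontr)
  assume "\<not> ?thesis"
  then have "S \<inter> frontier (inside (boundary P)) \<noteq> {}"
    using assms by (intro connected_Int_frontier) auto
  then show False
    using assms(2) by (simp add: polygon_jordan)
qed

lemma connected_outside:
  assumes "connected S" "S \<inter> boundary P = {}" "x \<in> S" "x \<in> outside (boundary P)"
  shows "S \<subseteq> outside (boundary P)"
proof (rule ccontr)
  assume "\<not> ?thesis"
  then have "S \<inter> frontier (outside (boundary P)) \<noteq> {}"
    using assms by (intro connected_Int_frontier) auto
  then show False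
    using assms(2) by (simp add: polygon_jordan)
qed

text \<open>The ball contains no vertex, since each vertex lies on one of the other edges. A point
  of the ball on the line of edge \<open>i\<close> is joined to \<open>p\<close> by a segment inside
  the ball, and this segment cannot pass an end of the edge.\<close>

lemma near_edge:
  assumes "i < n" "p \<in> edge P i" "ball p \<rho> \<inter> other_edges i = {}" "y \<in> ball p \<rho>"
  shows "y \<in> boundary P \<longleftrightarrow> side P i y = 0"
proof
  show "side P i y = 0" if "y \<in> boundary P"
    using that assms boundary_split[of i] side_edge by auto
next
  assume "side P i y = 0"
  then obtain s where s: "y = edge_point P i s"
    using side_eq_0 edge_dir_neq_0 assms by blast
  obtain r where r: "0 \<le> r" "r \<le> 1" "p = edge_point P i r"
    using assms(2) edgeE by blast
  have pb: "p \<in> ball p \<rho>"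
    using assms(4) by (metis centre_in_ball dist_not_less_zero mem_ball not_le order_le_less_trans zero_le_dist)
  have seg: "edge_point P i x \<in> ball p \<rho>" if "x \<in> {min r s..max r s}" for x
  proof -
    have "x \<in> closed_segment r s"
      using that by (auto simp: closed_segment_eq_real_ivl min_def max_def split: if_splits)
    then obtain u where u: "0 \<le> u" "u \<le> 1" "x = (1 - u) * r + u * s"
      by (auto simp: closed_segment_def)
    have "edge_point P i x = (1 - u) *\<^sub>R p + u *\<^sub>R y"
      unfolding r s u(3) edge_point_eq by (simp add: scaleR_conv_of_real algebra_simps)
    then show ?thesis
      using convexD_alt[OF convex_ball pb assms(4)] u by simp
  qed
  have no_vertex: "v \<notin> set P" if "v \<in> ball p \<rho>" for v
    using that assms set_subset_other_edges[of i] by blast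
  have v0: "edge_point P i 0 \<in> set P"
    using vertex_in_set[of i] assms(1) by (simp add: edge_point_eq)
  have v1: "edge_point P i 1 \<in> set P"
    using vertex_in_set[of "Suc i"] assms(1) by (simp add: edge_point_eq edge_dir_def ngon_length)
  have "0 \<notin> {min r s..max r s}"
    using seg[of 0] no_vertex v0 by blast
  then have "0 \<le> s"
    using r by auto
  moreover have "1 \<notin> {min r s..max r s}"
    using seg[of 1] no_vertex v1 by blast
  then have "s \<le> 1"
    using r by auto
  ultimately show "y \<in> boundary P"
    using edgeI[of s P i] s assms(1) edge_subset_boundary[of i P] ngon_length by auto
qed

lemma connected_half_ball:
  "connected {y \<in> ball p \<rho>. c * side P i y > 0}"
proof (rule convex_connected, rule convexI)
  fix x y and u v :: real
  assume x: "x \<in> {y \<in> ball p \<rho>. c * side P i y > 0}" and y: "y \<in> {y \<in> ball p \<rho>. c * side P i y > 0}"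
    and uv: "0 \<le> u" "0 \<le> v" "u + v = 1"
  have "0 < u * (c * side P i x) + v * (c * side P i y)"
    using x y uv by (smt (verit) mem_Collect_eq mult_nonneg_nonneg mult_pos_pos)
  moreover have "u *\<^sub>R x + v *\<^sub>R y \<in> ball p \<rho>"
    using x y uv convexD[OF convex_ball] by blast
  ultimately show "u *\<^sub>R x + v *\<^sub>R y \<in> {y \<in> ball p \<rho>. c * side P i y > 0}"
    using uv by (simp add: side_affine algebra_simps)
qed

text \<open>One of the two half discs at a point of an edge is inside the polygon, the other one outside.\<close>

definition good_sign :: "nat \<Rightarrow> complex \<Rightarrow> real \<Rightarrow> bool" where
  "good_sign i p s \<longleftrightarrow> (\<forall>\<rho>. ball p \<rho> \<inter> other_edges i = {} \<longrightarrow> (\<forall>y\<in>ball p \<rho>.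
     (s * side P i y > 0 \<longrightarrow> y \<in> inside (boundary P)) \<and> (s * side P i y < 0 \<longrightarrow> y \<in> outside (boundary P))))"

lemma free_ball:
  assumes "i < n" "p \<in> edge P i" "p \<notin> set P"
  obtains \<rho> where "\<rho> > 0" "ball p \<rho> \<inter> other_edges i = {}"
proof -
  have "open (- other_edges i)" "p \<in> - other_edges i"
    using compact_other_edges compact_imp_closed not_other_edges[of i p] assms by (auto simp: open_Compl)
  then obtain \<rho> where "\<rho> > 0" "ball p \<rho> \<subseteq> - other_edges i"
    by (meson open_contains_ball)
  then show ?thesis
    using that by blast
qed

text \<open>Each half disc is connected and misses the boundary, so it lies entirely inside or
  entirely outside. As \<open>p\<close> is in the frontier of both components, the ball contains
  points of both kinds, and the two halves must differ.\<close>

lemma good_sign_ball: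
  assumes i: "i < n" and p: "p \<in> edge P i" and \<rho>: "\<rho> > 0" "ball p \<rho> \<inter> other_edges i = {}"
  obtains s where "s \<in> {1, -1::real}" "\<And>y. y \<in> ball p \<rho> \<Longrightarrow> s * side P i y > 0 \<Longrightarrow> y \<in> inside (boundary P)"
    "\<And>y. y \<in> ball p \<rho> \<Longrightarrow> s * side P i y < 0 \<Longrightarrow> y \<in> outside (boundary P)"
proof -
  let ?H = "\<lambda>c. {y \<in> ball p \<rho>. c * side P i y > 0}"
  have pB: "p \<in> boundary P"
    using p i edge_subset_boundary[of i P] ngon_length by auto
  have disj: "?H c \<inter> boundary P = {}" if "c \<noteq> 0" for c
    using near_edge[OF i p \<rho>(2)] by auto
  have "p \<in> closure (inside (boundary P))" "p \<in> closure (outside (boundary P))"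
    using pB polygon_jordan(5,6) by (auto simp: frontier_def)
  then obtain x y where x: "x \<in> inside (boundary P)" "x \<in> ball p \<rho>"
    and y: "y \<in> outside (boundary P)" "y \<in> ball p \<rho>"
    using \<rho>(1) by (metis closure_approachable dist_commute mem_ball)
  have x0: "side P i x \<noteq> 0" and y0: "side P i y \<noteq> 0"
    using near_edge[OF i p \<rho>(2)] x y inside_no_overlap[of "boundary P"] outside_no_overlap[of "boundary P"] by blast+
  define s where "s = sgn (side P i x)"
  have s: "s \<in> {1, -1}" "s \<noteq> 0"
    using x0 by (auto simp: s_def sgn_if)
  have sx: "s * side P i x > 0"
    using x0 by (auto simp: s_def sgn_if)
  have ins: "?H s \<subseteq> inside (boundary P)"
    using connected_inside[OF connected_half_ball disj, of s x] s sx x by auto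
  have "\<not> s * side P i y > 0"
    using ins y not_inside_outside by blast
  then have sy: "(- s) * side P i y > 0"
    using y0 s by auto
  have "?H (- s) \<subseteq> outside (boundary P)"
    using connected_outside[OF connected_half_ball disj, of "- s" y] s sy y by auto
  then show ?thesis
    using that[of s] s ins by auto
qed

lemma good_sign_exists:
  assumes "i < n" "p \<in> edge P i" "p \<notin> set P"
  shows "\<exists>s\<in>{1,-1}. good_sign i p s"
proof -
  obtain \<rho> where \<rho>: "\<rho> > 0" "ball p \<rho> \<inter> other_edges i = {}"
    using free_ball assms by blast
  obtain s where s: "s \<in> {1, -1::real}" "\<And>y. y \<in> ball p \<rho> \<Longrightarrow> s * side P i y > 0 \<Longrightarrow> y \<in> inside (boundary P)"
    "\<And>y. y \<in> ball p \<rho> \<Longrightarrow> s * side P i y < 0 \<Longrightarrow> y \<in> outside (boundary P)"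
    using good_sign_ball[OF assms(1,2) \<rho>] by blast
  have "good_sign i p s"
    unfolding good_sign_def
  proof (intro allI impI)
    fix \<rho>' assume \<rho>': "ball p \<rho>' \<inter> other_edges i = {}"
    show "\<forall>y\<in>ball p \<rho>'. (s * side P i y > 0 \<longrightarrow> y \<in> inside (boundary P)) \<and>
        (s * side P i y < 0 \<longrightarrow> y \<in> outside (boundary P))"
    proof (cases "\<rho>' > 0")
      case True
      obtain s' where s': "s' \<in> {1, -1::real}" "\<And>y. y \<in> ball p \<rho>' \<Longrightarrow> s' * side P i y > 0 \<Longrightarrow> y \<in> inside (boundary P)"
        "\<And>y. y \<in> ball p \<rho>' \<Longrightarrow> s' * side P i y < 0 \<Longrightarrow> y \<in> outside (boundary P)"
        using good_sign_ball[OF assms(1,2) True \<rho>'] by blast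
      \<comment> \<open>A point off the line at half the smaller radius: it belongs to both balls,
        so its being inside or outside decides both signs.\<close>
      define y where "y = p + of_real (min \<rho> \<rho>' / 2 / norm (edge_dir P i)) * (\<i> * edge_dir P i)"
      have d: "edge_dir P i \<noteq> 0"
        using edge_dir_neq_0 assms by blast
      have "dist p y = min \<rho> \<rho>' / 2"
        using d \<rho>(1) True by (simp add: y_def dist_norm norm_mult norm_divide)
      then have y: "y \<in> ball p \<rho>" "y \<in> ball p \<rho>'"
        using \<rho>(1) True by auto
      have "side P i y = side P i p + min \<rho> \<rho>' / 2 / norm (edge_dir P i) * norm (edge_dir P i) ^ 2"
        unfolding y_def side_add
        by (simp add: mult.assoc complex_mult_cnj cmod_power2)
      then have "side P i y > 0"
        using side_edge assms d \<rho>(1) True by simp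
      then have "s = s'"
        using s(1) s'(1) s(2,3)[OF y(1)] s'(2,3)[OF y(2)] not_inside_outside[of y "boundary P"] by auto
      then show ?thesis
        using s' by auto
    next
      case False
      then have "ball p \<rho>' = {}"
        by simp
      then show ?thesis
        by blast
    qed
  qed
  then show ?thesis
    using s(1) by blast
qed

lemma good_sign_unique:
  assumes "i < n" "ball p \<rho> \<inter> other_edges i = {}" "y \<in> ball p \<rho>" "good_sign i p s"
    "ball p' \<rho>' \<inter> other_edges i = {}" "y \<in> ball p' \<rho>'" "good_sign i p' s'"
    "side P i y \<noteq> 0" "s \<in> {1,-1}" "s' \<in> {1,-1}"
  shows "s = s'"
proof -
  have "s * side P i y > 0 \<longrightarrow> y \<in> inside (boundary P)" "s * side P i y < 0 \<longrightarrow> y \<in> outside (boundary P)"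
    "s' * side P i y > 0 \<longrightarrow> y \<in> inside (boundary P)" "s' * side P i y < 0 \<longrightarrow> y \<in> outside (boundary P)"
    using assms unfolding good_sign_def by blast+
  then show ?thesis
    using assms(8-10) not_inside_outside[of y "boundary P"] by (auto simp: linorder_neq_iff)
qed

text \<open>Overlapping discs have equal signs, so the sign is locally constant along the edge
  without its ends, and an open segment is connected.\<close>

lemma edge_sign_exists:
  assumes i: "i < n"
  shows "\<exists>s\<in>{1,-1}. \<forall>p\<in>edge P i - set P. good_sign i p s"
proof -
  let ?E = "edge P i - set P"
  have d: "edge_dir P i \<noteq> 0"
    using edge_dir_neq_0 assms by blast
  obtain \<sigma> where \<sigma>: "\<And>p. p \<in> ?E \<Longrightarrow> \<sigma> p \<in> {1,-1} \<and> good_sign i p (\<sigma> p)"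
    using good_sign_exists[OF i] by (metis DiffE)
  have "\<sigma> constant_on ?E"
  proof (rule locally_constant_imp_constant)
    show "connected ?E"
      using edge_minus_vertices[OF i] by (simp add: convex_connected)
    fix p assume p: "p \<in> ?E"
    then obtain \<rho> where \<rho>: "\<rho> > 0" "ball p \<rho> \<inter> other_edges i = {}"
      using free_ball i by blast
    have "\<sigma> q = \<sigma> p" if q: "q \<in> ?E \<inter> ball p \<rho>" for q
    proof -
      obtain \<rho>' where \<rho>': "\<rho>' > 0" "ball q \<rho>' \<inter> other_edges i = {}"
        using free_ball i q by blast
      \<comment> \<open>With this choice a point at distance \<open>m / 2\<close> from
        \<open>q\<close> lies in the ball about \<open>q\<close> and, by the triangle inequality, in
        the ball about \<open>p\<close>.\<close>
      define m where "m = min \<rho>' (\<rho> - dist p q)"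
      have m: "m > 0"
        using q \<rho>' by (auto simp: m_def)
      define y where "y = q + of_real (m / 2 / norm (edge_dir P i)) * (\<i> * edge_dir P i)"
      have "dist q y = m / 2"
        using d m by (simp add: y_def dist_norm norm_mult norm_divide)
      then have y: "y \<in> ball q \<rho>'" "y \<in> ball p \<rho>"
        using m dist_triangle[of p y q] by (auto simp: m_def)
      have "side P i y = side P i q + m / 2 / norm (edge_dir P i) * norm (edge_dir P i) ^ 2"
        unfolding y_def side_add
        by (simp add: mult.assoc complex_mult_cnj cmod_power2)
      then have "side P i y \<noteq> 0"
        using side_edge q d m by simp
      then show ?thesis
        using good_sign_unique[OF i \<rho>'(2) y(1) _ \<rho>(2) y(2)] \<sigma>[of q] \<sigma>[of p] p q by blast
    qed
    moreover have "openin (top_of_set ?E) (?E \<inter> ball p \<rho>)" "p \<in> ?E \<inter> ball p \<rho>"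
      using p \<rho>(1) by (auto intro: openin_open_Int)
    ultimately show "\<exists>U. openin (top_of_set ?E) U \<and> p \<in> U \<and> (\<forall>x\<in>U. \<sigma> x = \<sigma> p)"
      by blast
  qed
  then obtain c where c: "\<And>p. p \<in> ?E \<Longrightarrow> \<sigma> p = c"
    by (auto simp: constant_on_def)
  have "?E \<noteq> {}"
    using edge_minus_vertices[OF i] nth_neq[of i "Suc i mod n"] Suc_mod_neq[OF i] i ngon_ge_3 by auto
  then obtain p where "p \<in> ?E"
    by blast
  then have "c \<in> {1,-1}"
    using \<sigma>[of p] c[of p] by simp
  then show ?thesis
    using \<sigma> c by metis
qed

end

text \<open>
  Pushing the points near each edge inwards deforms the region without its vertices into the open
  inside, which is simply connected.
\<close>

context
  fixes n P
  assumes ngon: "ngon n P"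
begin

definition inward_sign :: "nat \<Rightarrow> real" where
  "inward_sign i = (SOME s. s \<in> {1,-1} \<and> (\<forall>p\<in>edge P i - set P. good_sign n P i p s))"

lemma inward_sign:
  assumes "i < n"
  shows "inward_sign i \<in> {1,-1}" "\<And>p. p \<in> edge P i \<Longrightarrow> p \<notin> set P \<Longrightarrow> good_sign n P i p (inward_sign i)"
  using someI_ex[OF edge_sign_exists[OF ngon assms, unfolded Bex_def], folded inward_sign_def] by blast+

text \<open>Multiplication by \<i> turns the edge to the left, where \<open>side\<close> is
  positive; \<open>inward_sign\<close> corrects this to the unit normal pointing into the
  polygon.\<close>

definition inward :: "nat \<Rightarrow> complex" where
  "inward i = of_real (inward_sign i) * (\<i> * edge_dir P i) / of_real (norm (edge_dir P i))"

lemma norm_inward: "i < n \<Longrightarrow> norm (inward i) = 1"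
  using inward_sign(1)[of i] edge_dir_neq_0[OF ngon, of i] by (auto simp: inward_def norm_mult norm_divide)

lemma side_inward:
  assumes "i < n"
  shows "inward_sign i * side P i (z + of_real t * inward i) = inward_sign i * side P i z + t * norm (edge_dir P i)"
proof -
  have "edge_dir P i * cnj (edge_dir P i) = of_real (norm (edge_dir P i) ^ 2)"
    by (metis complex_norm_square)
  then have "inward i * cnj (edge_dir P i) =
     of_real (inward_sign i) * \<i> * (of_real (norm (edge_dir P i) ^ 2) / of_real (norm (edge_dir P i)))"
    by (simp add: inward_def mult.assoc)
  also have "\<dots> = of_real (inward_sign i * norm (edge_dir P i)) * \<i>"
    by (simp add: power2_eq_square)
  finally have "Im (of_real t * inward i * cnj (edge_dir P i)) = t * (inward_sign i * norm (edge_dir P i))"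
    by (simp add: mult.assoc)
  moreover have "inward_sign i * inward_sign i = 1"
    using inward_sign(1)[OF assms] by auto
  ultimately show ?thesis
    by (simp add: side_add distrib_left)
qed

text \<open>Positive only where \<open>z\<close> is more than twice as close to edge
  \<open>i\<close> as to the other edges. The factor 1/2 leaves room for the push: with
  \<open>p\<close> the nearest point of the edge, \<open>z\<close> moved by its depth stays in a
  ball about \<open>p\<close> that is free of other edges.\<close>

definition depth :: "nat \<Rightarrow> complex \<Rightarrow> real" where
  "depth i z = max 0 (infdist z (other_edges n P i) / 2 - infdist z (edge P i))"

text \<open>At most one summand is nonzero; the sum is used because it is continuous without any
  case distinction on the nearest edge.\<close>

definition push :: "complex \<Rightarrow> complex" where
  "push z = z + (\<Sum>i<n. of_real (depth i z) * inward i)"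

lemma continuous_on_push: "continuous_on S push"
  unfolding push_def depth_def by (intro continuous_intros) auto

lemma depth_unique:
  assumes "i < n" "j < n" "j \<noteq> i" "depth i z > 0"
  shows "depth j z = 0"
proof -
  have 1: "infdist z (edge P i) < infdist z (other_edges n P i) / 2"
    using assms(4) by (auto simp: depth_def)
  have sub: "edge P k \<subseteq> other_edges n P l" if "k \<noteq> l" "k < n" for k l
    using that by (auto simp: other_edges_def[OF ngon])
  have ne: "edge P k \<noteq> {}" for k
    using edge_ends by blast
  have "infdist z (other_edges n P i) \<le> infdist z (edge P j)"
    using infdist_mono[OF sub[of j i] ne] assms by auto
  moreover have "infdist z (other_edges n P j) \<le> infdist z (edge P i)"
    using infdist_mono[OF sub[of i j] ne] assms by auto
  moreover have "0 \<le> infdist z (edge P i)" "0 \<le> infdist z (edge P j)"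
    by (auto simp: infdist_nonneg)
  ultimately show ?thesis
    using 1 by (auto simp: depth_def)
qed

lemma push_single:
  assumes "i < n" "depth i z > 0"
  shows "push z = z + of_real (depth i z) * inward i"
proof -
  have "(\<Sum>j<n. of_real (depth j z) * inward j) = (\<Sum>j\<in>{i}. of_real (depth j z) * inward j)"
    using assms depth_unique[of i _ z] by (intro sum.mono_neutral_right) auto
  then show ?thesis
    by (simp add: push_def)
qed

lemma depth_pos_on_edge:
  assumes "i < n" "z \<in> edge P i" "z \<notin> set P"
  shows "depth i z > 0"
proof -
  have "z \<notin> other_edges n P i"
    using not_other_edges[OF ngon] assms by blast
  moreover have "closed (other_edges n P i)" "other_edges n P i \<noteq> {}"
    using compact_other_edges[OF ngon] other_edges_nonempty[OF ngon] compact_imp_closed by auto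
  ultimately have "infdist z (other_edges n P i) > 0"
    using infdist_pos_not_in_closed by blast
  then show ?thesis
    using assms(2) by (simp add: depth_def)
qed

text \<open>Where the depth of edge \<open>i\<close> is positive, \<open>z\<close> lies in a disc
  cut by that edge alone, on its closed inner half because \<open>z\<close> is not outside. The push
  strictly increases the signed distance and stays in the disc, hence ends inside. Elsewhere
  \<open>z\<close> is fixed and off the boundary already.\<close>

lemma push_segment:
  assumes z: "z \<in> region P - set P" and s: "s \<in> {0..1}"
  shows "z + of_real s * (push z - z) \<in> region P - set P"
    and "s > 0 \<Longrightarrow> z + of_real s * (push z - z) \<in> inside (boundary P)"
proof -
  have setB: "set P \<subseteq> boundary P"
    by (rule set_subset_boundary[OF ngon])
  have ins: "z + of_real s * (push z - z) \<in> inside (boundary P)" if s0: "s > 0"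
  proof (cases "\<exists>i<n. depth i z > 0")
    case False
    then have "\<forall>i<n. depth i z = 0"
      by (metis antisym_conv2 depth_def max.cobounded1)
    then have "push z = z"
      by (simp add: push_def)
    moreover have "z \<notin> boundary P"
      using False depth_pos_on_edge z by (auto simp: boundary_def ngon_length[OF ngon])
    ultimately show ?thesis
      using z by (auto simp: region_def)
  next
    case True
    then obtain i where i: "i < n" "depth i z > 0"
      by blast
    have "closed (edge P i)" "edge P i \<noteq> {}"
      using compact_edge compact_imp_closed edge_ends by blast+
    then obtain p where p: "p \<in> edge P i" "infdist z (edge P i) = dist z p"
      using infdist_attains_inf by metis
    let ?D = "infdist z (other_edges n P i)"
    \<comment> \<open>By the triangle inequality every point of another edge has at least this
      distance from \<open>p\<close>.\<close>
    define \<rho> where "\<rho> = ?D - dist z p"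
    have dep: "depth i z = ?D / 2 - dist z p"
      using i(2) p(2) by (auto simp: depth_def)
    have free: "ball p \<rho> \<inter> other_edges n P i = {}"
    proof -
      have "\<rho> \<le> dist p q" if "q \<in> other_edges n P i" for q
      proof -
        have "?D \<le> dist z q"
          using that infdist_le by blast
        then show ?thesis
          using dist_triangle[of z q p] by (simp add: \<rho>_def)
      qed
      then show ?thesis
        by force
    qed
    have \<rho>: "\<rho> > 0"
      unfolding \<rho>_def using dep i(2) zero_le_dist[of z p] by linarith
    have pv: "p \<notin> set P"
      using free \<rho> set_subset_other_edges[OF ngon i(1)] by (auto simp: disjoint_iff)
    define y where "y = z + of_real s * (push z - z)"
    have y: "y = z + of_real (s * depth i z) * inward i"
      using push_single[OF i] by (simp add: y_def)
    have "dist z y = s * depth i z"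
      using norm_inward[OF i(1)] i(2) s by (simp add: y dist_norm norm_mult)
    also have "\<dots> \<le> depth i z"
      using s i(2) by (simp add: mult_left_le_one_le)
    finally have "dist p y < \<rho>"
      using dist_triangle[of p y z] dep i(2) zero_le_dist[of z p] by (simp add: \<rho>_def dist_commute)
    then have yb: "y \<in> ball p \<rho>"
      by simp
    have zb: "z \<in> ball p \<rho>"
      unfolding mem_ball \<rho>_def dist_commute[of p z] using dep i(2) zero_le_dist[of z p] by linarith
    note g = inward_sign(2)[OF i(1) p(1) pv, unfolded good_sign_def[OF ngon], rule_format, OF free]
    have "z \<notin> outside (boundary P)"
      using z not_inside_outside[of z "boundary P"] not_outside_self[of z "boundary P"]
      by (auto simp: region_def)
    then have "0 \<le> inward_sign i * side P i z"
      using g[OF zb] by linarith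
    moreover have "s * depth i z * norm (edge_dir P i) > 0"
      using s0 i edge_dir_neq_0[OF ngon] by simp
    ultimately have "inward_sign i * side P i y > 0"
      unfolding y side_inward[OF i(1)] by linarith
    then show ?thesis
      using g[OF yb] by (simp add: y_def)
  qed
  then show "s > 0 \<Longrightarrow> z + of_real s * (push z - z) \<in> inside (boundary P)" .
  show "z + of_real s * (push z - z) \<in> region P - set P"
  proof (cases "s > 0")
    case True
    then show ?thesis
      using ins setB not_inside_self by (auto simp: region_def)
  next
    case False
    then show ?thesis
      using z s by simp
  qed
qed

lemma contractible_region: "contractible (region P - set P)"
proof -
  let ?R = "region P - set P" and ?I = "inside (boundary P)"
  have sub: "?I \<subseteq> ?R"
    using set_subset_boundary[OF ngon] not_inside_self by (auto simp: region_def)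
  have "homotopic_with_canon (\<lambda>x. True) ?R ?R (\<lambda>x. x) push"
  proof (rule homotopic_with_linear)
    fix z assume "z \<in> ?R"
    show "closed_segment z (push z) \<subseteq> ?R"
    proof (intro subsetI)
      fix x assume "x \<in> closed_segment z (push z)"
      then obtain u where u: "u \<in> {0..1}" "x = (1 - u) *\<^sub>R z + u *\<^sub>R push z"
        by (auto simp: closed_segment_def)
      have "x = z + of_real u * (push z - z)"
        by (simp add: u(2) scaleR_conv_of_real algebra_simps)
      then show "x \<in> ?R"
        using push_segment(1)[OF \<open>z \<in> ?R\<close> u(1)] by (simp only:)
    qed
  qed (auto intro: continuous_on_push)
  moreover have "push \<in> ?R \<rightarrow> ?I"
    using push_segment(2)[of _ 1] by auto
  then obtain c where "homotopic_with_canon (\<lambda>x. True) ?R ?I push (\<lambda>x. c)"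
    using nullhomotopic_into_contractible[OF continuous_on_push _ contractible_inside[OF ngon], of ?R] by blast
  then have "homotopic_with_canon (\<lambda>x. True) ?R ?R push (\<lambda>x. c)"
    using homotopic_with_subset_right sub by blast
  ultimately show ?thesis
    unfolding contractible_def id_def by (meson homotopic_with_trans)
qed

end

subsection \<open>Local structure of trajectories\<close>

text \<open>The two-sided local condition of \<open>trajectory\<close> is split into one-sided
  halves, so that incoming and outgoing velocities can be identified and propagated
  separately.\<close>

definition affine_right :: "(real \<Rightarrow> complex) \<Rightarrow> real \<Rightarrow> complex \<Rightarrow> bool" where
  "affine_right f t w \<longleftrightarrow> (\<exists>\<epsilon>>0. \<forall>h\<in>{0..\<epsilon>}. f (t + h) = f t + of_real h * w)"

definition affine_left :: "(real \<Rightarrow> complex) \<Rightarrow> real \<Rightarrow> complex \<Rightarrow> bool" where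
  "affine_left f t u \<longleftrightarrow> (\<exists>\<epsilon>>0. \<forall>h\<in>{0..\<epsilon>}. f (t - h) = f t - of_real h * u)"

lemma trajectory_iff:
  "trajectory P f \<longleftrightarrow>
     (\<forall>t. f t \<in> region P \<and> f t \<notin> set P \<and>
        (\<exists>u w. u \<noteq> 0 \<and> affine_left f t u \<and> affine_right f t w \<and> (f t \<notin> boundary P \<longrightarrow> w = u) \<and>
           (\<forall>i<length P. f t \<in> edge P i \<longrightarrow> w = reflect_dir P i u)))"
proof -
  have "affine_left f t u \<and> affine_right f t w \<longleftrightarrow>
     (\<exists>\<epsilon>>0. \<forall>h\<in>{0..\<epsilon>}. f (t - h) = f t - of_real h * u \<and> f (t + h) = f t + of_real h * w)" for t u w
  proof
    assume "affine_left f t u \<and> affine_right f t w"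
    then obtain e1 e2 where "e1 > 0" "e2 > 0" "\<forall>h\<in>{0..e1}. f (t - h) = f t - of_real h * u"
      "\<forall>h\<in>{0..e2}. f (t + h) = f t + of_real h * w"
      by (auto simp: affine_left_def affine_right_def)
    then show "\<exists>\<epsilon>>0. \<forall>h\<in>{0..\<epsilon>}. f (t - h) = f t - of_real h * u \<and> f (t + h) = f t + of_real h * w"
      by (intro exI[of _ "min e1 e2"]) auto
  qed (auto simp: affine_left_def affine_right_def)
  then show ?thesis
    unfolding trajectory_def
    by (intro all_cong1 conj_cong refl ex_cong1) blast
qed

lemma affine_right_unique: "affine_right f t w \<Longrightarrow> affine_right f t w' \<Longrightarrow> w = w'"
proof -
  assume "affine_right f t w" "affine_right f t w'"
  then obtain e1 e2 where e: "e1 > 0" "e2 > 0" "\<forall>h\<in>{0..e1}. f (t + h) = f t + of_real h * w"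
      "\<forall>h\<in>{0..e2}. f (t + h) = f t + of_real h * w'"
    by (auto simp: affine_right_def)
  then have "f t + of_real (min e1 e2) * w = f t + of_real (min e1 e2) * w'"
    by (metis atLeastAtMost_iff less_eq_real_def min.cobounded1 min.cobounded2 min_less_iff_conj)
  then show ?thesis
    using e(1,2) by (simp add: min_def split: if_splits)
qed

lemma affine_left_reflect: "affine_left f t u \<longleftrightarrow> affine_right (\<lambda>s. f (- s)) (- t) (- u)"
  by (simp add: affine_left_def affine_right_def)

lemma affine_left_unique: "affine_left f t w \<Longrightarrow> affine_left f t w' \<Longrightarrow> w = w'"
  using affine_right_unique unfolding affine_left_reflect by fastforce

lemma affine_right_nearby:
  assumes "affine_right f t w"
  obtains \<epsilon> where "\<epsilon> > 0" "\<And>s. t < s \<Longrightarrow> s < t + \<epsilon> \<Longrightarrow> affine_left f s w \<and> affine_right f s w"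
    "\<And>s. t \<le> s \<Longrightarrow> s < t + \<epsilon> \<Longrightarrow> f s = f t + of_real (s - t) * w"
proof -
  obtain e where e: "e > 0" "\<And>h. h \<in> {0..e} \<Longrightarrow> f (t + h) = f t + of_real h * w"
    using assms by (auto simp: affine_right_def)
  have eq: "f s = f t + of_real (s - t) * w" if "t \<le> s" "s < t + e" for s
    using e(2)[of "s - t"] that by simp
  moreover have "affine_left f s w \<and> affine_right f s w" if s: "t < s" "s < t + e" for s
  proof
    have "f (s - h) = f s - of_real h * w" if "h \<in> {0..s - t}" for h
    proof -
      have "f s = f t + of_real (s - t) * w" "f (s - h) = f t + of_real (s - h - t) * w"
        using eq[of s] eq[of "s - h"] that s by auto
      then show ?thesis
        by (simp only:) (simp add: algebra_simps)
    qed
    then show "affine_left f s w"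
      using s unfolding affine_left_def by (intro exI[of _ "s - t"]) auto
    have "f (s + h) = f s + of_real h * w" if "h \<in> {0..(t + e - s) / 2}" for h
    proof -
      have "f s = f t + of_real (s - t) * w" "f (s + h) = f t + of_real (s + h - t) * w"
        using eq[of s] eq[of "s + h"] that s by auto
      then show ?thesis
        by (simp only:) (simp add: algebra_simps)
    qed
    then show "affine_right f s w"
      using s unfolding affine_right_def by (intro exI[of _ "(t + e - s) / 2"]) auto
  qed
  ultimately show ?thesis
    using that e(1) by blast
qed

lemma affine_left_nearby:
  assumes "affine_left f t u"
  obtains \<epsilon> where "\<epsilon> > 0" "\<And>s. t - \<epsilon> < s \<Longrightarrow> s < t \<Longrightarrow> affine_left f s u \<and> affine_right f s u"
    "\<And>s. t - \<epsilon> < s \<Longrightarrow> s \<le> t \<Longrightarrow> f s = f t + of_real (s - t) * u"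
proof -
  obtain e where e: "e > 0"
    "\<And>s. - t < s \<Longrightarrow> s < - t + e \<Longrightarrow> affine_left (\<lambda>s. f (- s)) s (- u) \<and> affine_right (\<lambda>s. f (- s)) s (- u)"
    "\<And>s. - t \<le> s \<Longrightarrow> s < - t + e \<Longrightarrow> f (- s) = f (- (- t)) + of_real (s - (- t)) * (- u)"
    using affine_right_nearby[of "\<lambda>s. f (- s)" "- t" "- u"] assms unfolding affine_left_reflect by metis
  have 1: "affine_left f s u \<and> affine_right f s u" if "t - e < s" "s < t" for s
    using e(2)[of "- s"] that by (simp add: affine_left_def affine_right_def add.commute conj_commute)
  have 2: "f s = f t + of_real (s - t) * u" if "t - e < s" "s \<le> t" for s
    using e(3)[of "- s"] that by (simp add: algebra_simps)
  show ?thesis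
    using that[of e] e(1) 1 2 by blast
qed

lemma affine_continuous:
  assumes "affine_left f t u" "affine_right f t w"
  shows "isCont f t"
proof -
  obtain e1 where e1: "e1 > 0" "\<And>s. t - e1 < s \<Longrightarrow> s \<le> t \<Longrightarrow> f s = f t + of_real (s - t) * u"
    using affine_left_nearby[OF assms(1)] by metis
  obtain e2 where e2: "e2 > 0" "\<And>s. t \<le> s \<Longrightarrow> s < t + e2 \<Longrightarrow> f s = f t + of_real (s - t) * w"
    using affine_right_nearby[OF assms(2)] by metis
  have "((\<lambda>s. f t + of_real (s - t) * u) \<longlongrightarrow> f t + of_real (t - t) * u) (at_left t)"
    by (intro tendsto_intros)
  moreover have "\<forall>\<^sub>F s in at_left t. f t + of_real (s - t) * u = f s"
    unfolding eventually_at_left_field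
  proof (intro exI[of _ "t - e1"] conjI allI impI)
    fix s assume "t - e1 < s" "s < t"
    then show "f t + of_real (s - t) * u = f s"
      by (intro e1(2)[symmetric]) auto
  qed (use e1(1) in simp)
  ultimately have l: "(f \<longlongrightarrow> f t + of_real (t - t) * u) (at_left t)"
    by (rule Lim_transform_eventually)
  have "((\<lambda>s. f t + of_real (s - t) * w) \<longlongrightarrow> f t + of_real (t - t) * w) (at_right t)"
    by (intro tendsto_intros)
  moreover have "\<forall>\<^sub>F s in at_right t. f t + of_real (s - t) * w = f s"
    unfolding eventually_at_right_field
  proof (intro exI[of _ "t + e2"] conjI allI impI)
    fix s assume "t < s" "s < t + e2"
    then show "f t + of_real (s - t) * w = f s"
      by (intro e2(2)[symmetric]) auto
  qed (use e2(1) in simp)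
  ultimately have "(f \<longlongrightarrow> f t + of_real (t - t) * w) (at_right t)"
    by (rule Lim_transform_eventually)
  with l show ?thesis
    by (simp add: isCont_def filterlim_split_at)
qed

text \<open>Connectedness is used twice: the velocity is locally constant, hence some constant
  \<open>u\<close>, and then \<open>f t - of_real t * u\<close> is locally constant as well.\<close>

lemma straight_on_interval:
  fixes I :: "real set"
  assumes I: "connected I" "open I" and aff: "\<And>t. t \<in> I \<Longrightarrow> \<exists>u. affine_left f t u \<and> affine_right f t u"
  shows "\<exists>c u. \<forall>t\<in>I. f t = c + of_real t * u"
proof -
  obtain V where V: "\<And>t. t \<in> I \<Longrightarrow> affine_left f t (V t) \<and> affine_right f t (V t)"
    using aff by metis
  have near: "\<exists>e>0. \<forall>s\<in>I \<inter> ball t e. V s = V t \<and> f s = f t + of_real (s - t) * V t" if t: "t \<in> I" for t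
  proof -
    obtain e1 where e1: "e1 > 0" "\<And>s. t - e1 < s \<Longrightarrow> s < t \<Longrightarrow> affine_right f s (V t)"
      "\<And>s. t - e1 < s \<Longrightarrow> s \<le> t \<Longrightarrow> f s = f t + of_real (s - t) * V t"
      using affine_left_nearby[of f t "V t"] V[OF t] by metis
    obtain e2 where e2: "e2 > 0" "\<And>s. t < s \<Longrightarrow> s < t + e2 \<Longrightarrow> affine_right f s (V t)"
      "\<And>s. t \<le> s \<Longrightarrow> s < t + e2 \<Longrightarrow> f s = f t + of_real (s - t) * V t"
      using affine_right_nearby[of f t "V t"] V[OF t] by metis
    have "V s = V t \<and> f s = f t + of_real (s - t) * V t" if s: "s \<in> I \<inter> ball t (min e1 e2)" for s
    proof (cases s t rule: linorder_cases)
      case less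
      then show ?thesis
        using e1(2,3)[of s] s V[of s] affine_right_unique by (auto simp: dist_real_def)
    next
      case greater
      then show ?thesis
        using e2(2,3)[of s] s V[of s] affine_right_unique by (auto simp: dist_real_def)
    qed auto
    then show ?thesis
      using e1(1) e2(1) by (intro exI[of _ "min e1 e2"]) auto
  qed
  \<comment> \<open>Stated for a general \<open>g\<close> to serve both for the velocity and for the
    intercept.\<close>
  have loc: "g constant_on I" if g: "\<And>t e. t \<in> I \<Longrightarrow> e > 0 \<Longrightarrow> \<forall>s\<in>I \<inter> ball t e. V s = V t \<and> f s = f t + of_real (s - t) * V t
       \<Longrightarrow> \<forall>s\<in>I \<inter> ball t e. g s = g t" for g :: "real \<Rightarrow> complex"
  proof (rule locally_constant_imp_constant[OF I(1)])
    fix t assume t: "t \<in> I"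
    then obtain e where "e > 0" "\<forall>s\<in>I \<inter> ball t e. g s = g t"
      using near[OF t] g[OF t] by metis
    moreover have "openin (top_of_set I) (I \<inter> ball t e)" "t \<in> I \<inter> ball t e"
      using t \<open>e > 0\<close> by (simp_all add: openin_open_Int)
    ultimately show "\<exists>U. openin (top_of_set I) U \<and> t \<in> U \<and> (\<forall>x\<in>U. g x = g t)"
      by blast
  qed
  have "V constant_on I"
    by (rule loc) blast
  then obtain u where u: "\<And>t. t \<in> I \<Longrightarrow> V t = u"
    by (auto simp: constant_on_def)
  have "(\<lambda>t. f t - of_real t * u) constant_on I"
  proof (rule loc, intro ballI)
    fix t e s assume t: "t \<in> I" and h: "\<forall>s\<in>I \<inter> ball t e. V s = V t \<and> f s = f t + of_real (s - t) * V t"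
      and s: "s \<in> I \<inter> ball t e"
    have "f s = f t + of_real (s - t) * u"
      using h s u[OF t] by blast
    then show "f s - of_real s * u = f t - of_real t * u"
      by (simp only:) (simp add: algebra_simps)
  qed
  then obtain c where "\<And>t. t \<in> I \<Longrightarrow> f t - of_real t * u = c"
    by (auto simp: constant_on_def)
  then have "\<forall>t\<in>I. f t = c + of_real t * u"
    by (metis diff_add_cancel)
  then show ?thesis
    by blast
qed

section \<open>Reflections, unfolding maps and their linear parts\<close>

lemma reflect_dir_eq: "reflect_dir P i u = edge_dir P i / cnj (edge_dir P i) * cnj u"
  by (simp add: reflect_dir_def edge_dir_def Let_def)

lemma reflect_dir_add: "reflect_dir P i (u + v) = reflect_dir P i u + reflect_dir P i v"
  by (simp add: reflect_dir_eq distrib_left)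

lemma reflect_dir_of_real: "reflect_dir P i (of_real h * u) = of_real h * reflect_dir P i u"
  by (simp add: reflect_dir_eq)

lemma reflect_dir_involution: "edge_dir P i \<noteq> 0 \<Longrightarrow> reflect_dir P i (reflect_dir P i u) = u"
  by (simp add: reflect_dir_eq)

lemma reflect_dir_edge_dir: "edge_dir P i \<noteq> 0 \<Longrightarrow> reflect_dir P i (edge_dir P i) = edge_dir P i"
  by (simp add: reflect_dir_eq)

lemma reflect_dir_eq_0 [simp]: "edge_dir P i \<noteq> 0 \<Longrightarrow> reflect_dir P i u = 0 \<longleftrightarrow> u = 0"
  by (simp add: reflect_dir_eq)

lemma reflect_add: "reflect P i (z + u) = reflect P i z + reflect_dir P i u"
  by (simp add: reflect_def reflect_dir_add[symmetric] algebra_simps)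

lemma reflect_involution: "edge_dir P i \<noteq> 0 \<Longrightarrow> reflect P i (reflect P i z) = z"
  by (simp add: reflect_def reflect_dir_involution)

lemma reflect_edge_point:
  assumes "edge_dir P i \<noteq> 0"
  shows "reflect P i (edge_point P i r) = edge_point P i r"
  using assms by (simp add: reflect_def edge_point_eq reflect_dir_of_real reflect_dir_edge_dir)

lemma reflect_edge: "edge_dir P i \<noteq> 0 \<Longrightarrow> z \<in> edge P i \<Longrightarrow> reflect P i z = z"
  by (elim edgeE) (simp add: reflect_edge_point)

lemma parallel_real_multiple:
  assumes "Im (u * cnj d) = 0" "d \<noteq> 0"
  obtains c where "u = of_real c * d"
proof -
  have "Im (u / d) = 0"
    using assms(1) by (simp add: complex_div_cnj[of _ d])
  then have "u = of_real (Re (u / d)) * d"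
    using assms(2) by (simp add: complex_is_Real_iff[symmetric])
  then show ?thesis
    using that by blast
qed

lemma Im_reflect_dir:
  assumes "edge_dir P i \<noteq> 0"
  shows "Im (reflect_dir P i u * cnj (edge_dir P i)) = - Im (u * cnj (edge_dir P i))"
proof -
  have "reflect_dir P i u * cnj (edge_dir P i) = cnj (u * cnj (edge_dir P i))"
    using assms by (simp add: reflect_dir_eq)
  then show ?thesis
    by simp
qed

primrec develop_dir :: "complex list \<Rightarrow> nat list \<Rightarrow> complex \<Rightarrow> complex" where
  "develop_dir P [] = id"
| "develop_dir P (e # es) = reflect_dir P e \<circ> develop_dir P es"

lemma develop_append: "develop P (es @ es') = develop P es \<circ> develop P es'"
  by (induction es) auto

lemma develop_dir_append: "develop_dir P (es @ es') = develop_dir P es \<circ> develop_dir P es'"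
  by (induction es) auto

lemma develop_add: "develop P es (z + u) = develop P es z + develop_dir P es u"
  by (induction es) (auto simp: reflect_add)

lemma develop_dir_of_real: "develop_dir P es (of_real h * u) = of_real h * develop_dir P es u"
  by (induction es) (auto simp: reflect_dir_of_real)

lemma affine_rightI:
  assumes "\<epsilon> > 0" "\<And>s. t \<le> s \<Longrightarrow> s < t + \<epsilon> \<Longrightarrow> f s = f t + of_real (s - t) * w"
  shows "affine_right f t w"
  unfolding affine_right_def
proof (intro exI conjI ballI)
  show "0 < \<epsilon> / 2"
    using assms(1) by simp
  fix h assume "h \<in> {0..\<epsilon> / 2}"
  then show "f (t + h) = f t + of_real h * w"
    using assms(2)[of "t + h"] assms(1) by simp
qed

lemma affine_leftI:
  assumes "\<epsilon> > 0" "\<And>s. t - \<epsilon> < s \<Longrightarrow> s \<le> t \<Longrightarrow> f s = f t + of_real (s - t) * u"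
  shows "affine_left f t u"
  unfolding affine_left_def
proof (intro exI conjI ballI)
  show "0 < \<epsilon> / 2"
    using assms(1) by simp
  fix h assume "h \<in> {0..\<epsilon> / 2}"
  then show "f (t - h) = f t - of_real h * u"
    using assms(2)[of "t - h"] assms(1) by simp
qed

lemma affine_right_has_vector_derivative:
  assumes "affine_right f t w"
  shows "(f has_vector_derivative w) (at_right t)"
proof -
  obtain e where e: "e > 0" "\<And>s. t \<le> s \<Longrightarrow> s < t + e \<Longrightarrow> f s = f t + of_real (s - t) * w"
    using affine_right_nearby[OF assms] by metis
  have "((\<lambda>s. f t + (s - t) *\<^sub>R w) has_vector_derivative w) (at t within {t..})"
    by (auto intro!: derivative_eq_intros)
  then have "(f has_vector_derivative w) (at t within {t..})"
  proof (rule has_vector_derivative_transform_within[OF _ e(1)])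
    fix s assume "s \<in> {t..}" "dist s t < e"
    then have "f s = f t + of_real (s - t) * w"
      using e(2)[of s] by (auto simp: dist_real_def)
    then show "f t + (s - t) *\<^sub>R w = f s"
      by (simp add: scaleR_conv_of_real)
  qed simp
  then show ?thesis
    by (rule has_vector_derivative_within_subset) auto
qed

text \<open>The replacement for induction along time: a predicate that does not change in passing
  from a time to nearby times spreads from one time to a whole interval.\<close>

lemma locally_constant_real:
  fixes A :: "real \<Rightarrow> bool"
  assumes "connected S" "\<And>t. t \<in> S \<Longrightarrow> \<exists>e>0. \<forall>s\<in>S. \<bar>s - t\<bar> < e \<longrightarrow> A s = A t" "a \<in> S" "b \<in> S" "A a"
  shows "A b"
proof -
  have "A constant_on S"
  proof (rule locally_constant_imp_constant[OF assms(1)])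
    fix t assume t: "t \<in> S"
    then obtain e where e: "e > 0" "\<forall>s\<in>S. \<bar>s - t\<bar> < e \<longrightarrow> A s = A t"
      using assms(2) by blast
    have "openin (top_of_set S) (S \<inter> ball t e)" "t \<in> S \<inter> ball t e"
      using t e(1) by (simp_all add: openin_open_Int)
    moreover have "\<forall>s\<in>S \<inter> ball t e. A s = A t"
      using e(2) by (auto simp: dist_real_def abs_minus_commute)
    ultimately show "\<exists>U. openin (top_of_set S) U \<and> t \<in> U \<and> (\<forall>x\<in>U. A x = A t)"
      by blast
  qed
  then show ?thesis
    using assms(3-5) by (auto simp: constant_on_def)
qed

lemma parallel_reflect_dir:
  assumes "edge_dir P i \<noteq> 0" "Im (u * cnj (edge_dir P i)) = 0"
  shows "reflect_dir P i u = u"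
  using parallel_real_multiple[OF assms(2,1)] assms(1)
  by (metis reflect_dir_of_real reflect_dir_edge_dir)

lemma trajectory_shift: "trajectory P f \<Longrightarrow> trajectory P (\<lambda>t. f (s + t))"
  unfolding trajectory_def add.assoc[symmetric] add_diff_eq by blast

section \<open>Strikes, itineraries and the straightened path\<close>

context
  fixes n P f
  assumes ngon: "ngon n P" and traj: "trajectory P f"
begin

lemma avoid_vertices: "f t \<in> region P" "f t \<notin> set P"
  using traj by (auto simp: trajectory_iff)

lemma local_motion:
  obtains u w where "u \<noteq> 0" "affine_left f t u" "affine_right f t w" "f t \<notin> boundary P \<Longrightarrow> w = u"
    "\<And>i. i < n \<Longrightarrow> f t \<in> edge P i \<Longrightarrow> w = reflect_dir P i u"
  using traj unfolding trajectory_iff ngon_length[OF ngon] by metis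

lemma boundary_edge:
  assumes "z \<in> boundary P"
  obtains i where "i < n" "z \<in> edge P i"
  using assms by (auto simp: boundary_def ngon_length[OF ngon])

lemma isCont_trajectory: "isCont f t"
  using local_motion[of t] affine_continuous by metis

lemma continuous_on_trajectory: "continuous_on S f"
  by (simp add: continuous_at_imp_continuous_on isCont_trajectory)

lemma near_not_in_closed:
  assumes "closed K" "f t \<notin> K"
  obtains e where "e > 0" "\<And>s. \<bar>s - t\<bar> < e \<Longrightarrow> f s \<notin> K"
proof -
  have "open (f -` (- K))"
    using continuous_on_open_vimage[of UNIV f] continuous_on_trajectory[of UNIV] assms(1) by auto
  moreover have "t \<in> f -` (- K)"
    using assms(2) by simp
  ultimately obtain e where "e > 0" "ball t e \<subseteq> f -` (- K)"
    by (meson open_contains_ball)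
  then show ?thesis
    using that[of e] by (auto simp: subset_iff dist_real_def abs_minus_commute)
qed

lemma outgoing_neq_0: "affine_right f t w \<Longrightarrow> w \<noteq> 0"
proof -
  assume w: "affine_right f t w"
  obtain u w' where u: "u \<noteq> 0" "affine_right f t w'" "f t \<notin> boundary P \<Longrightarrow> w' = u"
    "\<And>i. i < n \<Longrightarrow> f t \<in> edge P i \<Longrightarrow> w' = reflect_dir P i u"
    using local_motion[of t] by metis
  have "w' \<noteq> 0"
    using u edge_dir_neq_0[OF ngon] boundary_edge by (metis reflect_dir_eq_0)
  then show ?thesis
    using affine_right_unique[OF w u(2)] by simp
qed

text \<open>A motion along an edge would continue along it forever at constant speed.\<close>

lemma no_grazing:
  assumes i: "i < n" and ft: "f t \<in> edge P i" and w: "affine_right f t w"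
  shows "Im (w * cnj (edge_dir P i)) \<noteq> 0"
proof
  assume par: "Im (w * cnj (edge_dir P i)) = 0"
  let ?d = "edge_dir P i"
  have d: "?d \<noteq> 0"
    using edge_dir_neq_0[OF ngon i] .
  \<comment> \<open>Lying on the edge and moving parallel to it. This is shown to be open and closed
    in time, so it would persist forever.\<close>
  define G where "G = (\<lambda>s. f s \<in> edge P i \<and> (\<exists>u. affine_left f s u \<and> affine_right f s u \<and> Im (u * cnj ?d) = 0))"
  have "G t"
  proof -
    obtain u w' where u: "affine_left f t u" "affine_right f t w'" "w' = reflect_dir P i u"
      using local_motion[of t] ft i by metis
    then have "w = reflect_dir P i u"
      using affine_right_unique w by blast
    then have "u = w"
      using parallel_reflect_dir[OF d par] reflect_dir_involution[OF d] by metis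
    then show ?thesis
      using u w par ft by (auto simp: G_def)
  qed
  have loc: "\<exists>e>0. \<forall>s'\<in>UNIV. \<bar>s' - s\<bar> < e \<longrightarrow> G s' = G s" for s
  proof (cases "f s \<in> edge P i")
    case False
    then obtain e where "e > 0" "\<And>s'. \<bar>s' - s\<bar> < e \<Longrightarrow> f s' \<notin> edge P i"
      using near_not_in_closed[OF compact_imp_closed[OF compact_edge]] by metis
    then show ?thesis
      using False unfolding G_def by blast
  next
    case True
    obtain u w where uw: "u \<noteq> 0" "affine_left f s u" "affine_right f s w" "w = reflect_dir P i u"
      using local_motion[of s] True i by metis
    obtain e1 where e1: "e1 > 0" "\<And>s'. s - e1 < s' \<Longrightarrow> s' < s \<Longrightarrow> affine_left f s' u \<and> affine_right f s' u"
      "\<And>s'. s - e1 < s' \<Longrightarrow> s' \<le> s \<Longrightarrow> f s' = f s + of_real (s' - s) * u"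
      using affine_left_nearby[OF uw(2)] by metis
    obtain e2 where e2: "e2 > 0" "\<And>s'. s < s' \<Longrightarrow> s' < s + e2 \<Longrightarrow> affine_left f s' w \<and> affine_right f s' w"
      "\<And>s'. s \<le> s' \<Longrightarrow> s' < s + e2 \<Longrightarrow> f s' = f s + of_real (s' - s) * w"
      using affine_right_nearby[OF uw(3)] by metis
    show ?thesis
    proof (cases "Im (u * cnj ?d) = 0")
      case False
      then have wd: "Im (w * cnj ?d) \<noteq> 0"
        using Im_reflect_dir[OF d, of u] uw(4) by simp
      have nG: "\<not> G s'" if "\<bar>s' - s\<bar> < min e1 e2" for s'
      proof
        assume "G s'"
        then obtain v where v: "affine_left f s' v" "affine_right f s' v" "Im (v * cnj ?d) = 0"
          by (auto simp: G_def)
        consider "s' < s" | "s' = s" | "s < s'" by linarith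
        then have "v = u \<or> v = w"
        proof cases
          case 1
          then show ?thesis
            using e1(2)[of s'] that v(1) affine_left_unique[of f s' u v] by auto
        next
          case 2
          then show ?thesis
            using v(1) uw(2) affine_left_unique by blast
        next
          case 3
          then show ?thesis
            using e2(2)[of s'] that v(1) affine_left_unique[of f s' w v] by auto
        qed
        then show False
          using v(3) False wd by auto
      qed
      have "min e1 e2 > 0"
        using e1(1) e2(1) by simp
      moreover have "\<not> G s"
        using nG[of s] \<open>min e1 e2 > 0\<close> by simp
      ultimately show ?thesis
        using nG by blast
    next
      case True
      then have wu: "w = u"
        using parallel_reflect_dir[OF d] uw(4) by simp
      obtain c where c: "u = of_real c * ?d"
        using parallel_real_multiple[OF True d] by blast
      obtain r where r: "0 \<le> r" "r \<le> 1" "f s = edge_point P i r"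
        using \<open>f s \<in> edge P i\<close> edgeE by blast
      have "edge_point P i 0 \<in> set P" "edge_point P i 1 \<in> set P"
        using vertex_in_set[OF ngon, of i] vertex_in_set[OF ngon, of "Suc i"] i
        by (auto simp: edge_point_eq edge_dir_def ngon_length[OF ngon])
      then have "r \<noteq> 0" "r \<noteq> 1"
        using avoid_vertices(2)[of s] r(3) by metis+
      then have r01: "0 < r" "r < 1"
        using r by auto
      \<comment> \<open>The edge parameter moves at rate \<open>c\<close>, so during time
        \<open>m\<close> it cannot leave \<open>{0..1}\<close>; the summand 1 keeps the denominator
        positive.\<close>
      define m where "m = min r (1 - r) / (\<bar>c\<bar> + 1)"
      have m: "m > 0"
        using r01 by (auto simp: m_def)
      have g: "G s'" if s': "\<bar>s' - s\<bar> < min (min e1 e2) m" for s'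
      proof -
        have fs': "f s' = f s + of_real (s' - s) * u"
        proof (cases "s' \<le> s")
          case True
          then show ?thesis
            using s' by (intro e1(3)) auto
        next
          case False
          then have "f s' = f s + of_real (s' - s) * w"
            using s' by (intro e2(3)) auto
          then show ?thesis
            by (simp only: wu)
        qed
        have af: "affine_left f s' u \<and> affine_right f s' u"
        proof (cases s' s rule: linorder_cases)
          case less
          then show ?thesis
            using s' by (intro e1(2)) auto
        next
          case equal
          then show ?thesis
            using uw(2,3) wu by simp
        next
          case greater
          then have "affine_left f s' w \<and> affine_right f s' w"
            using s' by (intro e2(2)) auto
          then show ?thesis
            by (simp only: wu)
        qed
        have "\<bar>(s' - s) * c\<bar> \<le> m * (\<bar>c\<bar> + 1)"
          unfolding abs_mult by (rule mult_mono) (use s' m in auto)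
        also have "\<dots> = min r (1 - r)"
          by (simp add: m_def)
        finally have "r + (s' - s) * c \<in> {0..1}"
          by auto
        moreover have "f s' = edge_point P i (r + (s' - s) * c)"
          unfolding fs' r(3) c edge_point_eq by (simp add: algebra_simps)
        ultimately show ?thesis
          using edgeI af True by (auto simp: G_def)
      qed
      have "min (min e1 e2) m > 0"
        using e1(1) e2(1) m by simp
      moreover have "G s"
        using g[of s] \<open>min (min e1 e2) m > 0\<close> by simp
      ultimately show ?thesis
        using g by blast
    qed
  qed
  have all: "G s" for s
    using locally_constant_real[OF connected_UNIV loc UNIV_I UNIV_I \<open>G t\<close>] .
  have "\<exists>u. affine_left f s u \<and> affine_right f s u" for s
    using all[of s] by (auto simp: G_def)
  from straight_on_interval[OF connected_UNIV open_UNIV this]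
  obtain c u where cu: "\<And>s. f s = c + of_real s * u"
    by auto
  have "affine_right f 0 u"
    unfolding affine_right_def using cu by (intro exI[of _ 1]) (simp add: algebra_simps)
  then have u: "u \<noteq> 0"
    using outgoing_neq_0 by blast
  obtain B where B: "\<And>z. z \<in> edge P i \<Longrightarrow> norm z \<le> B"
    using compact_imp_bounded[OF compact_edge] by (meson bounded_iff)
  \<comment> \<open>By this time the straight motion has covered more than \<open>norm c\<close>
    plus the bound \<open>B\<close>, so it has left the bounded edge.\<close>
  define s where "s = (norm c + \<bar>B\<bar> + 1) / norm u"
  have "norm (f s) \<le> B"
    using all[of s] B by (auto simp: G_def)
  moreover have "norm (f s) \<ge> norm (of_real s * u) - norm c"
    unfolding cu using norm_diff_ineq[of "of_real s * u" c] by (simp add: add.commute)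
  moreover have "norm (of_real s * u) = norm c + \<bar>B\<bar> + 1"
  proof -
    have "0 \<le> s" "s * norm u = norm c + \<bar>B\<bar> + 1"
      using u by (auto simp: s_def)
    then show ?thesis
      by (simp only: norm_mult norm_of_real abs_of_nonneg)
  qed
  ultimately show False
    by linarith
qed

text \<open>Immediately before and after a strike, \<open>side\<close> is a linear function of time
  whose slope is nonzero because grazing is excluded; the other edges are at positive
  distance.\<close>

lemma isolated_strikes:
  obtains e where "e > 0" "\<And>s. s \<noteq> t \<Longrightarrow> \<bar>s - t\<bar> < e \<Longrightarrow> f s \<notin> boundary P"
proof (cases "f t \<in> boundary P")
  case False
  then show ?thesis
    using near_not_in_closed[OF closed_boundary] that by metis
next
  case True
  then obtain i where i: "i < n" "f t \<in> edge P i"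
    using boundary_edge by blast
  have d: "edge_dir P i \<noteq> 0"
    using edge_dir_neq_0[OF ngon i(1)] .
  obtain u w where uw: "affine_left f t u" "affine_right f t w" "w = reflect_dir P i u"
    using local_motion[of t] i by metis
  have wd: "Im (w * cnj (edge_dir P i)) \<noteq> 0"
    using no_grazing[OF i uw(2)] .
  then have ud: "Im (u * cnj (edge_dir P i)) \<noteq> 0"
    using Im_reflect_dir[OF d, of u] uw(3) by simp
  obtain e1 where e1: "e1 > 0" "\<And>s. t - e1 < s \<Longrightarrow> s \<le> t \<Longrightarrow> f s = f t + of_real (s - t) * u"
    using affine_left_nearby[OF uw(1)] by metis
  obtain e2 where e2: "e2 > 0" "\<And>s. t \<le> s \<Longrightarrow> s < t + e2 \<Longrightarrow> f s = f t + of_real (s - t) * w"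
    using affine_right_nearby[OF uw(2)] by metis
  have "f t \<notin> other_edges n P i"
    using not_other_edges[OF ngon i(1) i(2)] avoid_vertices by blast
  then obtain e3 where e3: "e3 > 0" "\<And>s. \<bar>s - t\<bar> < e3 \<Longrightarrow> f s \<notin> other_edges n P i"
    using near_not_in_closed[OF compact_imp_closed[OF compact_other_edges[OF ngon]]] by metis
  have "f s \<notin> boundary P" if s: "s \<noteq> t" "\<bar>s - t\<bar> < min (min e1 e2) e3" for s
  proof -
    have "f s = f t + of_real (s - t) * u \<or> f s = f t + of_real (s - t) * w"
      using e1(2)[of s] e2(2)[of s] s by (cases "s \<le> t") auto
    then have "side P i (f s) = (s - t) * Im (u * cnj (edge_dir P i)) \<or> side P i (f s) = (s - t) * Im (w * cnj (edge_dir P i))"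
      using side_edge[OF i(2)] by (auto simp: side_add mult.assoc)
    then have "side P i (f s) \<noteq> 0"
      using s(1) wd ud by auto
    then have "f s \<notin> edge P i"
      using side_edge by blast
    then show ?thesis
      using e3(2)[of s] s boundary_split[OF ngon i(1)] by auto
  qed
  then show ?thesis
    using that[of "min (min e1 e2) e3"] e1(1) e2(1) e3(1) by simp
qed

text \<open>Infinitely many strikes in a compact interval would accumulate somewhere, against
  isolation at the limit time.\<close>

lemma finite_strikes: "finite {s \<in> {a..b}. f s \<in> boundary P}" (is "finite ?S")
proof (rule ccontr)
  assume "infinite ?S"
  moreover have "?S \<subseteq> {a..b}"
    by auto
  ultimately obtain x where "x islimpt ?S"
    using compact_Icc[of a b] unfolding compact_eq_Bolzano_Weierstrass by meson
  moreover obtain e where "e > 0" "\<And>s. s \<noteq> x \<Longrightarrow> \<bar>s - x\<bar> < e \<Longrightarrow> f s \<notin> boundary P"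
    using isolated_strikes by metis
  ultimately show False
    unfolding islimpt_approachable by (auto simp: dist_real_def)
qed

lemma finite_strikes_Ioc: "finite {s \<in> {a<..b}. f s \<in> boundary P}"
  by (rule finite_subset[OF _ finite_strikes[of a b]]) auto

lemma struck_edge:
  assumes "i < n" "f s \<in> edge P i"
  shows "(THE i. i < length P \<and> f s \<in> edge P i) = i"
  using assms unique_edge[OF ngon avoid_vertices(2)] by (intro the_equality) (auto simp: ngon_length[OF ngon])

lemma set_itinerary: "set (itinerary P f t) \<subseteq> {..<n}"
proof
  fix j assume "j \<in> set (itinerary P f t)"
  then obtain s where s: "s \<in> set (strike_times P f t)" "j = (THE i. i < length P \<and> f s \<in> edge P i)"
    by (auto simp: itinerary_def)
  then have "f s \<in> boundary P"
    using finite_strikes_Ioc[of 0 t] by (simp add: strike_times_def)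
  then obtain i where "i < n" "f s \<in> edge P i"
    using boundary_edge by blast
  then show "j \<in> {..<n}"
    using s(2) struck_edge by simp
qed

lemma itinerary_0: "itinerary P f 0 = []"
  by (simp add: itinerary_def strike_times_def)

lemma strike_times_const:
  assumes "a \<le> b" "\<And>s. a < s \<Longrightarrow> s \<le> b \<Longrightarrow> f s \<notin> boundary P"
  shows "strike_times P f b = strike_times P f a"
proof -
  have "{s \<in> {0<..b}. f s \<in> boundary P} = {s \<in> {0<..a}. f s \<in> boundary P}"
    using assms by (auto simp: not_le[symmetric])
  then show ?thesis
    by (simp add: strike_times_def)
qed

lemma itinerary_const:
  assumes "a \<le> b" "\<And>s. a < s \<Longrightarrow> s \<le> b \<Longrightarrow> f s \<notin> boundary P"
  shows "itinerary P f b = itinerary P f a"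
  using strike_times_const[OF assms] by (simp add: itinerary_def)

lemma strike_times_snoc:
  assumes "0 \<le> a" "a < b" "\<And>s. a < s \<Longrightarrow> s < b \<Longrightarrow> f s \<notin> boundary P" "f b \<in> boundary P"
  shows "strike_times P f b = strike_times P f a @ [b]"
proof -
  define A where "A = {s \<in> {0<..a}. f s \<in> boundary P}"
  define B where "B = {s \<in> {0<..b}. f s \<in> boundary P}"
  have fin: "finite A" "finite B"
    unfolding A_def B_def by (rule finite_strikes_Ioc)+
  have B: "B = insert b A"
  proof (intro equalityI subsetI)
    fix x assume x: "x \<in> B"
    then show "x \<in> insert b A"
      using assms(3)[of x] by (cases "x = b"; cases "x \<le> a") (auto simp: A_def B_def)
  next
    fix x assume "x \<in> insert b A"
    then show "x \<in> B"
      using assms(1,2,4) by (auto simp: A_def B_def)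
  qed
  have "\<forall>x\<in>A. x < b"
    using assms(2) by (auto simp: A_def)
  then have "sorted (sorted_list_of_set A @ [b])" "distinct (sorted_list_of_set A @ [b])"
    using fin(1) by (auto simp: sorted_append)
  moreover have "set (sorted_list_of_set B) = set (sorted_list_of_set A @ [b])"
    unfolding set_append set_sorted_list_of_set[OF fin(1)] set_sorted_list_of_set[OF fin(2)]
    using B by auto
  ultimately have "sorted_list_of_set B = sorted_list_of_set A @ [b]"
    using sorted_distinct_set_unique[of "sorted_list_of_set B"]
      sorted_sorted_list_of_set[of B] distinct_sorted_list_of_set[of B] by blast
  then show ?thesis
    by (simp add: strike_times_def A_def B_def)
qed

lemma itinerary_snoc:
  assumes "0 \<le> a" "a < b" "\<And>s. a < s \<Longrightarrow> s < b \<Longrightarrow> f s \<notin> boundary P" "i < n" "f b \<in> edge P i"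
  shows "itinerary P f b = itinerary P f a @ [i]"
proof -
  have "f b \<in> boundary P"
    using assms(4,5) edge_subset_boundary[of i P] ngon_length[OF ngon] by auto
  then show ?thesis
    using strike_times_snoc[OF assms(1-3)] struck_edge[OF assms(4,5)] by (simp add: itinerary_def)
qed

text \<open>Strikes are collected on \<open>{0<..t}\<close>, so the one at \<open>t\<close> is
  already counted: the itinerary is continuous from the right and jumps only from the left.\<close>

lemma itinerary_right:
  obtains e where "e > 0" "\<And>s. t \<le> s \<Longrightarrow> s < t + e \<Longrightarrow> itinerary P f s = itinerary P f t"
proof -
  obtain e where e: "e > 0" "\<And>s. s \<noteq> t \<Longrightarrow> \<bar>s - t\<bar> < e \<Longrightarrow> f s \<notin> boundary P"
    using isolated_strikes by metis
  have "itinerary P f s = itinerary P f t" if "t \<le> s" "s < t + e" for s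
    using that by (intro itinerary_const e(2)) auto
  then show ?thesis
    using that e(1) by blast
qed

lemma itinerary_left:
  assumes "t > 0"
  obtains e es where "e > 0" "e \<le> t" "\<And>s. t - e < s \<Longrightarrow> s < t \<Longrightarrow> itinerary P f s = es"
    "f t \<notin> boundary P \<Longrightarrow> itinerary P f t = es"
    "\<And>i. i < n \<Longrightarrow> f t \<in> edge P i \<Longrightarrow> itinerary P f t = es @ [i]"
proof -
  obtain e where e: "e > 0" "\<And>s. s \<noteq> t \<Longrightarrow> \<bar>s - t\<bar> < e \<Longrightarrow> f s \<notin> boundary P"
    using isolated_strikes by metis
  define m where "m = min e t"
  have m: "m > 0" "m \<le> t" "m \<le> e"
    using assms e(1) by (auto simp: m_def)
  define es where "es = itinerary P f (t - m / 2)"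
  have es: "itinerary P f s = es" if "t - m < s" "s < t" for s
  proof (cases "s \<le> t - m / 2")
    case True
    then show ?thesis
      unfolding es_def using that m by (intro itinerary_const[symmetric] e(2)) auto
  next
    case False
    then show ?thesis
      unfolding es_def using that m by (intro itinerary_const e(2)) auto
  qed
  have 1: "itinerary P f t = es" if "f t \<notin> boundary P"
    unfolding es_def
  proof (rule itinerary_const)
    fix s assume "t - m / 2 < s" "s \<le> t"
    then show "f s \<notin> boundary P"
      using that e(2)[of s] m by (cases "s = t") auto
  qed (use m in simp)
  have 2: "itinerary P f t = es @ [i]" if "i < n" "f t \<in> edge P i" for i
    unfolding es_def using that m by (intro itinerary_snoc e(2)) auto
  show ?thesis
    using that[OF m(1,2) es 1 2] by blast
qed

lemma unfolded_affine_right: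
  assumes "affine_right f t w"
  shows "affine_right (unfolded_path P f) t (develop_dir P (itinerary P f t) w)"
proof -
  obtain e1 where e1: "e1 > 0" "\<And>s. t \<le> s \<Longrightarrow> s < t + e1 \<Longrightarrow> itinerary P f s = itinerary P f t"
    using itinerary_right by metis
  obtain e2 where e2: "e2 > 0" "\<And>s. t \<le> s \<Longrightarrow> s < t + e2 \<Longrightarrow> f s = f t + of_real (s - t) * w"
    using affine_right_nearby[OF assms] by metis
  show ?thesis
  proof (rule affine_rightI[of "min e1 e2"])
    fix s assume s: "t \<le> s" "s < t + min e1 e2"
    have "itinerary P f s = itinerary P f t" "f s = f t + of_real (s - t) * w"
      using e1(2)[of s] e2(2)[of s] s by auto
    then show "unfolded_path P f s = unfolded_path P f t + of_real (s - t) * develop_dir P (itinerary P f t) w"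
      unfolding unfolded_path_def by (simp only: develop_add develop_dir_of_real)
  qed (use e1(1) e2(1) in simp)
qed

text \<open>At a strike the itinerary gains one letter. The added reflection fixes the point struck
  and turns the outgoing velocity back into the incoming one, so the unfolded path has neither a
  jump nor a corner.\<close>

lemma unfolded_affine_left:
  assumes t: "t > 0" and w: "affine_right f t w"
  shows "affine_left (unfolded_path P f) t (develop_dir P (itinerary P f t) w)"
proof -
  obtain u w' where uw: "affine_left f t u" "affine_right f t w'" "f t \<notin> boundary P \<Longrightarrow> w' = u"
    "\<And>i. i < n \<Longrightarrow> f t \<in> edge P i \<Longrightarrow> w' = reflect_dir P i u"
    using local_motion[of t] by metis
  then have w': "w' = w"
    using w affine_right_unique by blast
  obtain e1 es where e1: "e1 > 0" "e1 \<le> t" "\<And>s. t - e1 < s \<Longrightarrow> s < t \<Longrightarrow> itinerary P f s = es"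
    "f t \<notin> boundary P \<Longrightarrow> itinerary P f t = es"
    "\<And>i. i < n \<Longrightarrow> f t \<in> edge P i \<Longrightarrow> itinerary P f t = es @ [i]"
    using itinerary_left[OF t] by metis
  obtain e2 where e2: "e2 > 0" "\<And>s. t - e2 < s \<Longrightarrow> s \<le> t \<Longrightarrow> f s = f t + of_real (s - t) * u"
    using affine_left_nearby[OF uw(1)] by metis
  have Ft: "unfolded_path P f t = develop P es (f t) \<and> develop_dir P (itinerary P f t) w = develop_dir P es u"
  proof (cases "f t \<in> boundary P")
    case False
    then show ?thesis
      using e1(4) uw(3) w' by (simp add: unfolded_path_def)
  next
    case True
    then obtain i where i: "i < n" "f t \<in> edge P i"
      using boundary_edge by blast
    have d: "edge_dir P i \<noteq> 0"
      using edge_dir_neq_0[OF ngon i(1)] .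
    show ?thesis
      using e1(5)[OF i] uw(4)[OF i] w' reflect_edge[OF d i(2)]
      by (simp add: unfolded_path_def develop_append develop_dir_append reflect_dir_involution[OF d])
  qed
  show ?thesis
  proof (rule affine_leftI[of "min e1 e2"])
    fix s assume s: "t - min e1 e2 < s" "s \<le> t"
    show "unfolded_path P f s = unfolded_path P f t + of_real (s - t) * develop_dir P (itinerary P f t) w"
    proof (cases "s = t")
      case False
      then have "itinerary P f s = es" "f s = f t + of_real (s - t) * u"
        using e1(3)[of s] e2(2)[of s] s by auto
      then have "unfolded_path P f s = develop P es (f t) + of_real (s - t) * develop_dir P es u"
        unfolding unfolded_path_def by (simp only: develop_add develop_dir_of_real)
      then show ?thesis
        using Ft by simp
    qed simp
  qed (use e1(1) e2(1) in simp)
qed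

lemma unfolded_straight:
  assumes w: "affine_right f 0 w" and "0 \<le> t"
  shows "unfolded_path P f t = f 0 + of_real t * w"
proof -
  let ?F = "unfolded_path P f"
  have "\<exists>u. affine_left ?F t u \<and> affine_right ?F t u" if "t \<in> {0<..}" for t
  proof -
    obtain v where "affine_right f t v"
      using local_motion[of t] by metis
    then show ?thesis
      using that unfolded_affine_left[of t v] unfolded_affine_right[of t v] by auto
  qed
  from straight_on_interval[of "{0<..}" ?F, OF connected_Ioi open_greaterThan this]
  obtain c u where cu: "\<And>t. t \<in> {0<..} \<Longrightarrow> ?F t = c + of_real t * u"
    by auto
  have F0: "?F 0 = f 0"
    by (simp add: unfolded_path_def itinerary_0)
  have "affine_right ?F 0 w"
    using unfolded_affine_right[OF w] by (simp add: itinerary_0)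
  then obtain e where e: "e > 0" "\<And>s. 0 \<le> s \<Longrightarrow> s < 0 + e \<Longrightarrow> ?F s = ?F 0 + of_real (s - 0) * w"
    using affine_right_nearby[of ?F 0 w] by metis
  \<comment> \<open>The open half line excludes time 0. Comparing the two affine formulas at the two
    times \<open>e / 2\<close> and \<open>e / 4\<close> identifies both coefficients.\<close>
  have 1: "c + of_real (e / 2) * u = f 0 + of_real (e / 2) * w"
    using cu[of "e / 2"] e(2)[of "e / 2"] e(1) F0 by simp
  have 2: "c + of_real (e / 4) * u = f 0 + of_real (e / 4) * w"
    using cu[of "e / 4"] e(2)[of "e / 4"] e(1) F0 by simp
  have "of_real (e / 4) * (u - w) = (c + of_real (e / 2) * u - (f 0 + of_real (e / 2) * w)) -
      (c + of_real (e / 4) * u - (f 0 + of_real (e / 4) * w))"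
    by (simp add: field_simps)
  also have "\<dots> = 0"
    by (simp only: 1 2) simp
  finally have "u = w"
    using e(1) by simp
  then have "c = f 0"
    using 1 by simp
  then show ?thesis
    using cu[of t] F0 \<open>u = w\<close> assms(2) by (cases "t = 0") auto
qed

end

text \<open>Agreement of position and outgoing velocity is a locally constant property of time, in
  both directions of time.\<close>

lemma trajectory_deterministic:
  assumes ngon: "ngon n P" and f: "trajectory P f" and g: "trajectory P g"
    and "f a = g a" "affine_right f a w" "affine_right g a w"
  shows "f t = g t"
proof -
  define A where "A = (\<lambda>t. f t = g t \<and> (\<exists>w. affine_right f t w \<and> affine_right g t w))"
  have loc: "\<exists>e>0. \<forall>s\<in>UNIV. \<bar>s - t\<bar> < e \<longrightarrow> A s = A t" for t
  proof (cases "f t = g t")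
    case False
    have "isCont (\<lambda>s. f s - g s) t"
      by (intro continuous_intros isCont_trajectory[OF ngon f] isCont_trajectory[OF ngon g])
    then have "\<forall>\<^sub>F s in nhds t. f s - g s \<noteq> 0"
      using False by (intro tendsto_imp_eventually_ne[of _ "f t - g t"]) (auto simp: isCont_def tendsto_nhds_iff)
    then obtain e where "e > 0" "\<forall>s. dist s t < e \<longrightarrow> f s - g s \<noteq> 0"
      unfolding eventually_nhds_metric by blast
    then show ?thesis
      using False by (intro exI[of _ e]) (auto simp: A_def dist_real_def)
  next
    case True
    obtain u w where uw: "affine_left f t u" "affine_right f t w" "f t \<notin> boundary P \<Longrightarrow> w = u"
      "\<And>i. i < n \<Longrightarrow> f t \<in> edge P i \<Longrightarrow> w = reflect_dir P i u"
      using local_motion[OF ngon f, of t] by metis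
    obtain u' w' where uw': "affine_left g t u'" "affine_right g t w'" "g t \<notin> boundary P \<Longrightarrow> w' = u'"
      "\<And>i. i < n \<Longrightarrow> g t \<in> edge P i \<Longrightarrow> w' = reflect_dir P i u'"
      using local_motion[OF ngon g, of t] by metis
    \<comment> \<open>Reflection is invertible, so agreement after a strike is equivalent to
      agreement before it; this is what allows propagation backwards.\<close>
    have uw_eq: "u = u' \<longleftrightarrow> w = w'"
    proof (cases "f t \<in> boundary P")
      case False
      then show ?thesis
        using uw(3) uw'(3) True by simp
    next
      case b: True
      then obtain i where i: "i < n" "f t \<in> edge P i"
        using boundary_edge[OF ngon f] by blast
      have d: "edge_dir P i \<noteq> 0"
        using edge_dir_neq_0[OF ngon i(1)] .
      show ?thesis
        using uw(4)[OF i] uw'(4)[of i] i True reflect_dir_involution[OF d] by metis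
    qed
    obtain e1 where e1: "e1 > 0" "\<And>s. t - e1 < s \<Longrightarrow> s < t \<Longrightarrow> affine_left f s u \<and> affine_right f s u"
      "\<And>s. t - e1 < s \<Longrightarrow> s \<le> t \<Longrightarrow> f s = f t + of_real (s - t) * u"
      using affine_left_nearby[OF uw(1)] by metis
    obtain e2 where e2: "e2 > 0" "\<And>s. t < s \<Longrightarrow> s < t + e2 \<Longrightarrow> affine_left f s w \<and> affine_right f s w"
      "\<And>s. t \<le> s \<Longrightarrow> s < t + e2 \<Longrightarrow> f s = f t + of_real (s - t) * w"
      using affine_right_nearby[OF uw(2)] by metis
    obtain e3 where e3: "e3 > 0" "\<And>s. t - e3 < s \<Longrightarrow> s < t \<Longrightarrow> affine_left g s u' \<and> affine_right g s u'"
      "\<And>s. t - e3 < s \<Longrightarrow> s \<le> t \<Longrightarrow> g s = g t + of_real (s - t) * u'"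
      using affine_left_nearby[OF uw'(1)] by metis
    obtain e4 where e4: "e4 > 0" "\<And>s. t < s \<Longrightarrow> s < t + e4 \<Longrightarrow> affine_left g s w' \<and> affine_right g s w'"
      "\<And>s. t \<le> s \<Longrightarrow> s < t + e4 \<Longrightarrow> g s = g t + of_real (s - t) * w'"
      using affine_right_nearby[OF uw'(2)] by metis
    have At: "A t \<longleftrightarrow> w = w'"
      unfolding A_def using True uw(2) uw'(2) affine_right_unique[of f t _ w] affine_right_unique[of g t _ w']
      by blast
    have "A s \<longleftrightarrow> w = w'" if s: "\<bar>s - t\<bar> < min (min e1 e2) (min e3 e4)" for s
    proof (cases s t rule: linorder_cases)
      case less
      have "affine_right f s u" "affine_right g s u'" "f s = f t + of_real (s - t) * u" "g s = f t + of_real (s - t) * u'"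
        using e1(2,3)[of s] e3(2,3)[of s] s less True by auto
      then show ?thesis
        using uw_eq less by (auto simp: A_def)
    next
      case equal
      then show ?thesis
        using At by simp
    next
      case greater
      have "affine_right f s w" "affine_right g s w'" "f s = f t + of_real (s - t) * w" "g s = f t + of_real (s - t) * w'"
        using e2(2,3)[of s] e4(2,3)[of s] s greater True by auto
      then show ?thesis
        using greater by (auto simp: A_def)
    qed
    then show ?thesis
      using At e1(1) e2(1) e3(1) e4(1) by (intro exI[of _ "min (min e1 e2) (min e3 e4)"]) auto
  qed
  have "A a"
    using assms(4-6) by (auto simp: A_def)
  then have "A t"
    using locally_constant_real[OF connected_UNIV loc UNIV_I UNIV_I] by blast
  then show ?thesis
    by (simp add: A_def)
qed

text \<open>The trajectory and its shift by 1 start at the same point with the same right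
  derivative, so determinism identifies them for all times.\<close>

lemma periodic_trajectory_period:
  assumes ngon: "ngon n P" and f: "periodic_trajectory P f"
  shows "f (t + 1) = f t"
proof -
  have tr: "trajectory P f" "f 0 = f 1"
    using f by (auto simp: periodic_trajectory_def)
  obtain v where v: "(f has_vector_derivative v) (at_right 0)" "(f has_vector_derivative v) (at_right 1)"
    using f by (auto simp: periodic_trajectory_def)
  have eq: "w = v" if "affine_right f s w" "(f has_vector_derivative v) (at_right s)" for s w
    using vector_derivative_unique_within[OF _ affine_right_has_vector_derivative[OF that(1)] that(2)]
    by (simp add: trivial_limit_at_right_real)
  have a0: "affine_right f 0 v"
    using eq[OF _ v(1)] local_motion[OF ngon tr(1), of 0] by metis
  have "affine_right f 1 v"
    using eq[OF _ v(2)] local_motion[OF ngon tr(1), of 1] by metis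
  then have a1: "affine_right (\<lambda>t. f (1 + t)) 0 v"
    by (simp add: affine_right_def)
  show ?thesis
    using trajectory_deterministic[OF ngon tr(1) trajectory_shift[OF tr(1), of 1] _ a0 a1, of t] tr(2)
    by (simp add: add.commute)
qed

subsection \<open>The class of the lift\<close>

text \<open>Strikes leading from the first sheet to the second count positively, those leading back
  negatively. The same signs govern rotation angles, since every reflection reverses the effect of
  the ones composed after it.\<close>

primrec alternating_sum :: "(nat \<Rightarrow> 'a::ab_group_add) \<Rightarrow> nat list \<Rightarrow> 'a" where
  "alternating_sum g [] = 0"
| "alternating_sum g (e # es) = g e - alternating_sum g es"

lemma alternating_sum_append:
  "alternating_sum g (es @ es') =
     alternating_sum g es + (if even (length es) then alternating_sum g es' else - alternating_sum g es')"
  by (induction es) auto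

definition signed_count :: "nat \<Rightarrow> nat list \<Rightarrow> int" where
  "signed_count i = alternating_sum (\<lambda>e. if e = i then 1 else 0)"

lemma signed_count_simps [simp]:
  "signed_count i [] = 0" "signed_count i (e # es) = (if e = i then 1 else 0) - signed_count i es"
  by (simp_all add: signed_count_def)

text \<open>The scaling is a parameter so that the lemma applies both to reals and to chains.\<close>

lemma alternating_sum_expand:
  fixes scale :: "int \<Rightarrow> 'a::ab_group_add \<Rightarrow> 'a"
  assumes "\<And>x. scale 1 x = x" "\<And>a b x. scale (a - b) x = scale a x - scale b x" "set es \<subseteq> {..<n}"
  shows "alternating_sum g es = (\<Sum>i<n. scale (signed_count i es) (g i))"
  using assms(3)
proof (induction es)
  case Nil
  have "scale 0 x = 0" for x
    using assms(2)[of 0 0 x] by simp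
  then show ?case
    by simp
next
  case (Cons e es)
  have 0: "scale 0 x = 0" for x
    using assms(2)[of 0 0 x] by simp
  have "(\<Sum>i<n. scale (signed_count i (e # es)) (g i)) =
      (\<Sum>i<n. scale (if e = i then 1 else 0) (g i)) - (\<Sum>i<n. scale (signed_count i es) (g i))"
    by (simp only: signed_count_simps assms(2) sum_subtractf)
  also have "(\<Sum>i<n. scale (if e = i then 1 else 0) (g i)) = (\<Sum>i<n. if e = i then g i else 0)"
    by (intro sum.cong) (simp_all add: assms(1) 0)
  also have "\<dots> = g e"
    using Cons.prems by simp
  finally show ?case
    using Cons by simp
qed

section \<open>Sheets of the doubled polygon and maps to the circle\<close>

definition sheet_map :: "complex list \<Rightarrow> bool \<Rightarrow> complex \<Rightarrow> (complex \<times> bool) set" where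
  "sheet_map P s z = glue_class P (z, s)"

lemma continuous_map_sheet:
  "continuous_map (top_of_set (region P - set P)) (double P) (sheet_map P s)"
proof -
  have "continuous_map (top_of_set (region P - set P)) (top_of_set (two_sheets P)) (\<lambda>z. (z, s))"
    by (auto simp: two_sheets_def intro!: continuous_intros)
  then have "continuous_map (top_of_set (region P - set P)) (double P) (glue_class P \<circ> (\<lambda>z. (z, s)))"
    using continuous_map_compose quotient_imp_continuous_map[OF quotient_map_double] by blast
  then show ?thesis
    by (simp add: sheet_map_def[abs_def] o_def)
qed

lemma sheet_map_boundary:
  "z \<in> boundary P \<Longrightarrow> sheet_map P s z = sheet_map P s' z"
  by (auto simp: sheet_map_def glue_class_def glue_def two_sheets_def)

lemma seg_cong:
  assumes "\<And>t. t \<in> {a..b} \<Longrightarrow> \<gamma> t = \<gamma>' t" "a \<le> b"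
  shows "seg \<gamma> a b = seg \<gamma>' a b"
proof
  fix x
  show "seg \<gamma> a b x = seg \<gamma>' a b x"
  proof (cases "x \<in> standard_simplex 1")
    case True
    then have "a * x 0 + b * x 1 \<in> {a..b}"
      using assms(2) by (intro convex_comb2_in) (auto simp: standard_simplex_Suc_0)
    then show ?thesis
      using True assms(1) by (simp add: seg_def)
  qed (simp add: seg_def)
qed

lemma continuous_map_paste_Icc:
  fixes a b c :: real
  assumes "continuous_map (top_of_set {a..b}) X \<gamma>" "continuous_map (top_of_set {b..c}) X \<gamma>" "a \<le> b" "b \<le> c"
  shows "continuous_map (top_of_set {a..c}) X \<gamma>"
proof (rule pasting_lemma_closed[where I = UNIV and T = "\<lambda>s. if s then {a..b} else {b..c}" and f = "\<lambda>_. \<gamma>"])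
  fix s :: bool
  show "closedin (top_of_set {a..c}) (if s then {a..b} else {b..c})"
    using assms(3,4) by (auto intro!: closed_subset)
  have "{a..c} \<inter> {a..b} = {a..b}" "{a..c} \<inter> {b..c} = {b..c}"
    using assms(3,4) by auto
  then show "continuous_map (subtopology (top_of_set {a..c}) (if s then {a..b} else {b..c})) X \<gamma>"
    using assms(1,2) by (cases s) (simp_all only: if_True if_False subtopology_subtopology)
next
  fix x :: real assume "x \<in> topspace (top_of_set {a..c})"
  then show "\<exists>s. s \<in> UNIV \<and> x \<in> (if s then {a..b} else {b..c}) \<and> \<gamma> x = \<gamma> x"
    by (intro exI[of _ "x \<le> b"]) auto
qed auto

text \<open>The Urysohn function separating edge \<open>i\<close> from the other edges. The two
  closed sets share vertices, but away from the vertices the denominator is positive.\<close>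

definition bump :: "nat \<Rightarrow> complex list \<Rightarrow> nat \<Rightarrow> complex \<Rightarrow> real" where
  "bump n P i z = infdist z (other_edges n P i) / (infdist z (other_edges n P i) + infdist z (edge P i))"

text \<open>The value on a gluing class is read off from an arbitrary representative; that the
  choice does not matter is the content of \<open>circle_map_glue_class\<close>.\<close>

definition circle_map :: "nat \<Rightarrow> complex list \<Rightarrow> nat \<Rightarrow> (complex \<times> bool) set \<Rightarrow> complex" where
  "circle_map n P i C = (let x = (SOME x. x \<in> C) in
     exp (\<i> * of_real ((if snd x then - pi else pi) * bump n P i (fst x))))"

context
  fixes n P
  assumes ngon: "ngon n P"
begin

lemma bump_denominator:
  assumes "i < n" "z \<notin> set P"
  shows "infdist z (other_edges n P i) + infdist z (edge P i) > 0"
proof -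
  have cl: "closed (other_edges n P i)" "closed (edge P i)" "other_edges n P i \<noteq> {}" "edge P i \<noteq> {}"
    using compact_other_edges[OF ngon] compact_edge compact_imp_closed other_edges_nonempty[OF ngon] edge_ends
    by blast+
  have "z \<notin> other_edges n P i \<or> z \<notin> edge P i"
    using not_other_edges[OF ngon] assms by blast
  then have "infdist z (other_edges n P i) > 0 \<or> infdist z (edge P i) > 0"
    using cl infdist_pos_not_in_closed by blast
  then show ?thesis
    using infdist_nonneg[of z "other_edges n P i"] infdist_nonneg[of z "edge P i"] by linarith
qed

lemma bump_edge:
  assumes "i < n" "j < n" "z \<in> edge P j" "z \<notin> set P"
  shows "bump n P i z = (if j = i then 1 else 0)"
proof (cases "j = i")
  case True
  then show ?thesis
    using assms bump_denominator[of i z] by (simp add: bump_def)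
next
  case False
  then have "z \<in> other_edges n P i"
    using assms by (auto simp: other_edges_def[OF ngon])
  then show ?thesis
    using False by (simp add: bump_def)
qed

lemma continuous_on_bump: "i < n \<Longrightarrow> continuous_on (region P - set P) (bump n P i)"
  unfolding bump_def using bump_denominator by (intro continuous_intros) (auto simp: less_imp_neq[symmetric])

lemma circle_map_glue_class:
  assumes i: "i < n" and z: "z \<in> region P - set P"
  shows "circle_map n P i (glue_class P (z, s)) = exp (\<i> * of_real ((if s then - pi else pi) * bump n P i z))"
proof -
  let ?C = "glue_class P (z, s)"
  have "(z, s) \<in> ?C"
    using z by (auto simp: glue_class_def glue_def two_sheets_def)
  then have "(SOME x. x \<in> ?C) \<in> ?C"
    by (rule someI)
  moreover have "\<forall>y\<in>?C. fst y = z \<and> (snd y = s \<or> z \<in> boundary P)"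
    by (auto simp: glue_class_def glue_def)
  ultimately obtain s' where s': "(SOME x. x \<in> ?C) = (z, s')" "s' = s \<or> z \<in> boundary P"
    by (metis prod.collapse)
  \<comment> \<open>A representative in the other sheet occurs only over the boundary, where
    \<open>bump\<close> is 0 or 1, and rotations by pi and by -pi coincide.\<close>
  have "exp (\<i> * of_real ((if s' then - pi else pi) * bump n P i z)) =
      exp (\<i> * of_real ((if s then - pi else pi) * bump n P i z))"
  proof (cases "s' = s")
    case False
    then obtain j where j: "j < n" "z \<in> edge P j"
      using s'(2) by (auto simp: boundary_def ngon_length[OF ngon])
    have "bump n P i z = (if j = i then 1 else 0)"
      using bump_edge[OF i j] z by blast
    moreover have "exp (- (\<i> * of_real pi)) = (- 1 :: complex)"
      by (simp add: exp_minus)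
    ultimately show ?thesis
      by simp
  qed simp
  then show ?thesis
    by (simp add: circle_map_def s'(1))
qed

lemma continuous_map_circle:
  assumes i: "i < n"
  shows "continuous_map (double P) euclidean (circle_map n P i)"
proof (rule continuous_compose_quotient_map[OF quotient_map_double])
  have sgn: "continuous_on (two_sheets P) (\<lambda>x. if snd x then - pi else pi)"
    using continuous_on_compose2[OF Topological_Spaces.continuous_on_discrete[of UNIV "\<lambda>s. if s then - pi else pi"]
        continuous_on_snd[OF continuous_on_id[of "two_sheets P"]]] by auto
  have bump: "continuous_on (two_sheets P) (\<lambda>x. bump n P i (fst x))"
    by (rule continuous_on_compose2[OF continuous_on_bump[OF i] continuous_on_fst[OF continuous_on_id]])
      (auto simp: two_sheets_def)
  have "continuous_on (two_sheets P)
      (\<lambda>x. exp (\<i> * of_real ((if snd x then - pi else pi) * bump n P i (fst x))))"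
    by (intro continuous_intros sgn bump)
  moreover have "(circle_map n P i \<circ> glue_class P) x =
      exp (\<i> * of_real ((if snd x then - pi else pi) * bump n P i (fst x)))" if "x \<in> two_sheets P" for x
    using circle_map_glue_class[OF i, of "fst x" "snd x"] that by (auto simp: two_sheets_def)
  ultimately show "continuous_map (top_of_set (two_sheets P)) euclidean (circle_map n P i \<circ> glue_class P)"
    by (simp cong: continuous_on_cong)
qed

lemma circle_map_nonzero: "circle_map n P i C \<noteq> 0"
  by (simp add: circle_map_def Let_def)

lemma edge_in_region: "i < n \<Longrightarrow> edge P i - set P \<subseteq> region P - set P"
  using edge_subset_boundary[of i P] ngon_length[OF ngon] by (auto simp: region_def)

lemma basepoint_paths:
  assumes "p \<in> region P - set P"
  obtains A where "\<And>z. z \<in> region P - set P \<Longrightarrow> path (A z)"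
    "\<And>z. z \<in> region P - set P \<Longrightarrow> path_image (A z) \<subseteq> region P - set P"
    "\<And>z. z \<in> region P - set P \<Longrightarrow> A z 0 = p" "\<And>z. z \<in> region P - set P \<Longrightarrow> A z 1 = z"
proof -
  have "path_connected (region P - set P)"
    using contractible_imp_path_connected[OF contractible_region[OF ngon]] .
  then have "\<forall>z\<in>region P - set P. \<exists>g. path g \<and> path_image g \<subseteq> region P - set P \<and> g 0 = p \<and> g 1 = z"
    using assms unfolding path_connected_def pathstart_def pathfinish_def by blast
  then show ?thesis
    using that by metis
qed

end

section \<open>Reduction of the lift to one chain for each edge\<close>

locale base_paths =
  fixes n P p A
  assumes ngon: "ngon n P" and p: "p \<in> region P - set P"
    and A: "\<And>z. z \<in> region P - set P \<Longrightarrow> path (A z)"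
    "\<And>z. z \<in> region P - set P \<Longrightarrow> path_image (A z) \<subseteq> region P - set P"
    "\<And>z. z \<in> region P - set P \<Longrightarrow> A z 0 = p" "\<And>z. z \<in> region P - set P \<Longrightarrow> A z 1 = z"
begin

abbreviation homologous :: "(complex \<times> bool) set chain \<Rightarrow> (complex \<times> bool) set chain \<Rightarrow> bool" where
  "homologous \<equiv> homologous_rel 1 (double P) {}"

definition base_chain :: "bool \<Rightarrow> complex \<Rightarrow> (complex \<times> bool) set chain" where
  "base_chain s z = frag_of (seg (\<lambda>t. sheet_map P s (A z t)) 0 1)"

text \<open>In the region, the path together with the chosen paths from \<open>p\<close> to its ends
  forms a cycle, which bounds by contractibility; \<open>sheet_map\<close> carries this relation
  into the double.\<close>

lemma path_in_sheet:
  assumes \<gamma>: "continuous_on {a..b} \<gamma>" "\<gamma> ` {a..b} \<subseteq> region P - set P" and "a \<le> b"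
  shows "homologous (frag_of (seg (\<lambda>t. sheet_map P s (\<gamma> t)) a b)) (base_chain s (\<gamma> b) - base_chain s (\<gamma> a))"
proof -
  let ?R = "top_of_set (region P - set P)"
  have ab: "\<gamma> a \<in> region P - set P" "\<gamma> b \<in> region P - set P"
    using \<gamma>(2) assms(3) unfolding image_subset_iff by simp_all
  define c where "c = frag_of (seg \<gamma> a b) - (frag_of (seg (A (\<gamma> b)) 0 1) - frag_of (seg (A (\<gamma> a)) 0 1))"
  have s1: "singular_simplex 1 ?R (seg \<gamma> a b)"
    using \<gamma> assms(3) by (intro singular_simplex_seg) auto
  have s2: "singular_simplex 1 ?R (seg (A z) 0 1)" if "z \<in> region P - set P" for z
    using A(1,2)[OF that] by (intro singular_simplex_seg) (auto simp: path_def path_image_def)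
  have "singular_chain 1 ?R c"
    unfolding c_def using s1 s2 ab by (intro singular_chain_diff) (auto simp: singular_chain_of)
  moreover have "chain_boundary 1 c = 0"
    unfolding c_def chain_boundary_diff chain_boundary_seg using A(3,4) ab by simp
  ultimately have "singular_relcycle 1 ?R {} c"
    by (simp add: singular_cycle)
  then have "singular_relboundary 1 ?R {} c"
    using contractible_cycle_is_boundary contractible_region[OF ngon] by (metis contractible_space_top_of_set)
  then have "singular_relboundary 1 (double P) {} (chain_map 1 (sheet_map P s) c)"
    by (rule singular_relboundary_chain_map[OF _ continuous_map_sheet]) simp
  then show ?thesis
    by (simp only: homologous_rel_def base_chain_def c_def chain_map_diff chain_map_of simplex_map_seg)
qed

text \<open>For \<open>z\<close> on an edge the ends over \<open>z\<close> cancel, and what remains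
  leads from \<open>p\<close> in one sheet to \<open>p\<close> in the other. The remaining ends
  depend on \<open>p\<close> alone and disappear in alternating sums of even length.\<close>

definition sheet_difference :: "complex \<Rightarrow> (complex \<times> bool) set chain" where
  "sheet_difference z = base_chain False z - base_chain True z"

text \<open>A segment along the edge is the same path in both sheets, so its contribution cancels in
  the difference. Hence any point of the edge may represent it.\<close>

lemma sheet_difference_edge:
  assumes i: "i < n" and z: "z \<in> edge P i - set P" "z' \<in> edge P i - set P"
  shows "homologous (sheet_difference z) (sheet_difference z')"
proof -
  let ?\<gamma> = "linepath z z'"
  have "convex (edge P i - set P)"
    using edge_minus_vertices[OF ngon i] by simp
  then have E: "?\<gamma> ` {0..1} \<subseteq> edge P i - set P"
    using z convex_contains_segment unfolding path_image_def[symmetric] by (metis path_image_linepath)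
  then have R: "?\<gamma> ` {0..1} \<subseteq> region P - set P"
    using edge_in_region[OF ngon i] by blast
  have B: "?\<gamma> ` {0..1} \<subseteq> boundary P"
    using E edge_subset_boundary[of i P] i ngon_length[OF ngon] by auto
  have eq: "seg (\<lambda>t. sheet_map P False (?\<gamma> t)) 0 1 = seg (\<lambda>t. sheet_map P True (?\<gamma> t)) 0 1"
    using B by (intro seg_cong sheet_map_boundary) auto
  have h: "homologous (frag_of (seg (\<lambda>t. sheet_map P s (?\<gamma> t)) 0 1)) (base_chain s z' - base_chain s z)" for s
    using path_in_sheet[OF continuous_on_linepath R] by (simp add: linepath_0' linepath_1')
  have "homologous (base_chain False z' - base_chain False z) (base_chain True z' - base_chain True z)"
    using h[of False] h[of True] unfolding eq by (meson homologous_rel_sym homologous_rel_trans)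
  then have "singular_relboundary 1 (double P) {}
      (- (base_chain False z' - base_chain False z - (base_chain True z' - base_chain True z)))"
    unfolding homologous_rel_def singular_relboundary_minus .
  then show ?thesis
    unfolding homologous_rel_def sheet_difference_def by (simp add: algebra_simps)
qed

text \<open>The exponents on the two sheets are opposite, so each contributes half of the change of
  \<open>bump\<close> and subtraction adds the halves. The term at \<open>p\<close> remains since
  \<open>p\<close> need not lie on an edge.\<close>

lemma winding_sheet_difference:
  assumes i: "i < n" and z: "z \<in> region P - set P"
  shows "chain_winding (circle_map n P i) (sheet_difference z) = of_real (bump n P i z - bump n P i p)"
proof -
  have w: "simplex_winding (circle_map n P i) (seg (\<lambda>t. sheet_map P s (A z t)) 0 1) =
      of_real ((if s then - 1 else 1) * (bump n P i z - bump n P i p) / 2)" for s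
  proof -
    define q where "q = (\<lambda>t. \<i> * of_real ((if s then - pi else pi) * bump n P i (A z t)))"
    have "continuous_on {0..1} (\<lambda>t. bump n P i (A z t))"
      using continuous_on_compose2[OF continuous_on_bump[OF ngon i]] A(1,2)[OF z]
      by (auto simp: path_def path_image_def)
    then have q: "path q"
      unfolding path_def q_def by (intro continuous_intros)
    have "simplex_winding (circle_map n P i) (seg (\<lambda>t. sheet_map P s (A z t)) 0 1) =
        (q 1 - q 0) / (2 * of_real pi * \<i>)"
    proof (rule simplex_winding_exp[OF q])
      fix t :: real assume t: "t \<in> {0..1}"
      then have "seg (\<lambda>t. sheet_map P s (A z t)) 0 1 (edge_coords t) = sheet_map P s (A z t)"
        using edge_coords_in[of t] by (simp add: seg_def edge_coords_def)
      moreover have "A z t \<in> region P - set P"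
        using A(2)[OF z] t by (simp add: path_image_def image_subset_iff)
      ultimately show "circle_map n P i (seg (\<lambda>t. sheet_map P s (A z t)) 0 1 (edge_coords t)) = exp (q t)"
        using circle_map_glue_class[OF ngon i] by (simp add: sheet_map_def q_def)
    qed
    also have "\<dots> = of_real ((if s then - 1 else 1) * (bump n P i z - bump n P i p) / 2)"
      by (simp add: q_def A(3,4)[OF z] field_simps)
    finally show ?thesis .
  qed
  show ?thesis
    unfolding sheet_difference_def base_chain_def chain_winding_diff chain_winding_of w
    by (simp add: field_simps)
qed

definition edge_class :: "nat \<Rightarrow> (complex \<times> bool) set chain" where
  "edge_class i = sheet_difference (edge_point P i (1 / 2))"

lemma midpoint_on_edge:
  assumes "i < n"
  shows "edge_point P i (1 / 2) \<in> edge P i - set P"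
proof -
  have "edge_point P i (1 / 2) \<noteq> edge_point P i 0" "edge_point P i (1 / 2) \<noteq> edge_point P i 1"
    using edge_dir_neq_0[OF ngon assms] by (auto simp: edge_point_eq)
  moreover have "edge_point P i 0 = P ! i" "edge_point P i 1 = P ! (Suc i mod n)"
    by (auto simp: edge_point_eq edge_dir_def ngon_length[OF ngon])
  ultimately show ?thesis
    using edge_vertices[OF ngon assms] edgeI[of "1 / 2" P i] by auto
qed

end

locale base_paths_trajectory = base_paths +
  fixes f
  assumes traj: "trajectory P f"
begin

abbreviation parity :: "real \<Rightarrow> bool" where
  "parity t \<equiv> odd (length (itinerary P f t))"

text \<open>The class predicted for the lift up to time \<open>t\<close>. For a closed path with an
  even number of strikes the first two terms cancel at time 1.\<close>

definition lift_chain :: "real \<Rightarrow> (complex \<times> bool) set chain" where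
  "lift_chain t = base_chain (parity t) (f t) - base_chain False (f 0) + alternating_sum edge_class (itinerary P f t)"

text \<open>Continuity is part of the statement because joining two pieces of the lift presupposes
  it, and it spreads along time in the same way.\<close>

definition lift_known :: "real \<Rightarrow> bool" where
  "lift_known t \<longleftrightarrow> continuous_map (top_of_set {0..t}) (double P) (lift_path P f) \<and>
     homologous (frag_of (seg (lift_path P f) 0 t)) (lift_chain t)"

lemma lift_path_sheet: "lift_path P f t = sheet_map P (parity t) (f t)"
  by (simp add: lift_path_def sheet_map_def)

lemma continuous_map_sheet_trajectory:
  "continuous_map (top_of_set S) (double P) (\<lambda>t. sheet_map P s (f t))"
proof -
  have "continuous_map (top_of_set S) (top_of_set (region P - set P)) f"
    using continuous_on_trajectory[OF ngon traj] avoid_vertices[OF ngon traj] by auto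
  from continuous_map_compose[OF this continuous_map_sheet] show ?thesis
    by (simp add: o_def)
qed

text \<open>Over \<open>{x..y}\<close> the lift stays in one closed sheet, where its class is known.
  An equivalence is needed, not just a step forward, because local constancy compares a time with
  its neighbours on both sides.\<close>

lemma lift_known_step:
  assumes xy: "0 \<le> x" "x \<le> y" and s: "\<And>t. t \<in> {x..y} \<Longrightarrow> lift_path P f t = sheet_map P s (f t)"
    and chain: "homologous (lift_chain y) (lift_chain x + (base_chain s (f y) - base_chain s (f x)))"
  shows "lift_known x \<longleftrightarrow> lift_known y"
proof -
  have "continuous_map (top_of_set {x..y}) (double P) (lift_path P f)"
    by (rule continuous_map_eq[OF continuous_map_sheet_trajectory[of "{x..y}" s]]) (simp add: s)
  then have cont: "continuous_map (top_of_set {0..x}) (double P) (lift_path P f) \<longleftrightarrow>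
      continuous_map (top_of_set {0..y}) (double P) (lift_path P f)"
    using continuous_map_paste_Icc[of 0 x "double P" "lift_path P f" y] xy
      continuous_map_from_subtopology_mono[of euclidean "{0..y}" "double P" "lift_path P f" "{0..x}"] by auto
  have "homologous (frag_of (seg (lift_path P f) x y)) (base_chain s (f y) - base_chain s (f x))"
  proof -
    have "seg (lift_path P f) x y = seg (\<lambda>t. sheet_map P s (f t)) x y"
      using s xy(2) by (rule seg_cong)
    moreover have "f ` {x..y} \<subseteq> region P - set P"
      using avoid_vertices[OF ngon traj] by blast
    ultimately show ?thesis
      using path_in_sheet[OF continuous_on_trajectory[OF ngon traj] _ xy(2)] by simp
  qed
  moreover have "homologous (frag_of (seg (lift_path P f) 0 y))
      (frag_of (seg (lift_path P f) 0 x) + frag_of (seg (lift_path P f) x y))"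
    if "continuous_map (top_of_set {0..y}) (double P) (lift_path P f)"
    by (rule seg_join[OF that xy])
  ultimately have joined: "homologous (frag_of (seg (lift_path P f) 0 y))
      (frag_of (seg (lift_path P f) 0 x) + (base_chain s (f y) - base_chain s (f x)))"
    if "continuous_map (top_of_set {0..y}) (double P) (lift_path P f)"
    by (rule homologous_rel_trans[OF homologous_rel_add[OF homologous_rel_refl] _]) (use that in blast)+
  have h: "homologous (frag_of (seg (lift_path P f) 0 y) - frag_of (seg (lift_path P f) 0 x))
      (lift_chain y - lift_chain x)"
    if "continuous_map (top_of_set {0..y}) (double P) (lift_path P f)"
  proof -
    let ?D = "base_chain s (f y) - base_chain s (f x)"
    have 1: "homologous (frag_of (seg (lift_path P f) 0 y) - frag_of (seg (lift_path P f) 0 x)) ?D"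
      using homologous_rel_diff[OF joined[OF that] homologous_rel_refl, of "frag_of (seg (lift_path P f) 0 x)"]
      unfolding add_diff_cancel_left' .
    have 2: "homologous (lift_chain y - lift_chain x) ?D"
      using homologous_rel_diff[OF chain homologous_rel_refl, of "lift_chain x"] unfolding add_diff_cancel_left' .
    show ?thesis
      by (rule homologous_rel_trans[OF homologous_rel_sym[THEN iffD1, OF 2] 1])
  qed
  show ?thesis
  proof (cases "continuous_map (top_of_set {0..y}) (double P) (lift_path P f)")
    case True
    have "homologous (frag_of (seg (lift_path P f) 0 y)) (lift_chain y)" if "homologous (frag_of (seg (lift_path P f) 0 x)) (lift_chain x)"
      using homologous_rel_add[OF h[OF True] that] by simp
    moreover have "homologous (frag_of (seg (lift_path P f) 0 x)) (lift_chain x)" if "homologous (frag_of (seg (lift_path P f) 0 y)) (lift_chain y)"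
      using homologous_rel_diff[OF that h[OF True]] by simp
    ultimately show ?thesis
      unfolding lift_known_def using True cont by blast
  next
    case False
    then show ?thesis
      using cont by (simp add: lift_known_def)
  qed
qed

text \<open>Changing the sheet of the last path alters the chain by a
  \<open>sheet_difference\<close>, up to sign, and the new letter of the itinerary makes up for it;
  the parity of the earlier strikes gives both the same sign.\<close>

lemma lift_chain_edge:
  assumes i: "i < n" and z: "z \<in> edge P i - set P"
  shows "homologous (base_chain (odd (length (es @ [i]))) z + alternating_sum edge_class (es @ [i]))
     (base_chain (odd (length es)) z + alternating_sum edge_class es)"
proof -
  have "homologous (edge_class i) (sheet_difference z)"
    unfolding edge_class_def by (rule sheet_difference_edge[OF i midpoint_on_edge[OF i] z])
  then have r: "singular_relboundary 1 (double P) {} (edge_class i - (base_chain False z - base_chain True z))"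
    by (simp add: homologous_rel_def sheet_difference_def)
  then have "singular_relboundary 1 (double P) {} (- (edge_class i - (base_chain False z - base_chain True z)))"
    unfolding singular_relboundary_minus .
  with r show ?thesis
    unfolding homologous_rel_def by (cases "even (length es)") (simp_all add: alternating_sum_append algebra_simps)
qed

lemma lift_known_locally_constant:
  assumes t: "t \<in> {0..1}"
  shows "\<exists>e>0. \<forall>s\<in>{0..1}. \<bar>s - t\<bar> < e \<longrightarrow> lift_known s = lift_known t"
proof -
  obtain e1 where e1: "e1 > 0" "\<And>s. t \<le> s \<Longrightarrow> s < t + e1 \<Longrightarrow> itinerary P f s = itinerary P f t"
    using itinerary_right[OF ngon traj] by metis
  have right: "lift_known s = lift_known t" if s: "t \<le> s" "s < t + e1" for s
  proof (rule lift_known_step[symmetric, where s = "parity t"])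
    show "lift_path P f r = sheet_map P (parity t) (f r)" if "r \<in> {t..s}" for r
      using e1(2)[of r] that s by (simp add: lift_path_sheet)
    have "lift_chain s = lift_chain t + (base_chain (parity t) (f s) - base_chain (parity t) (f t))"
      using e1(2)[OF s] by (simp add: lift_chain_def)
    then show "homologous (lift_chain s) (lift_chain t + (base_chain (parity t) (f s) - base_chain (parity t) (f t)))"
      by simp
  qed (use t s in auto)
  show ?thesis
  proof (cases "t = 0")
    case True
    show ?thesis
    proof (intro exI conjI ballI impI)
      fix s :: real assume "s \<in> {0..1}" "\<bar>s - t\<bar> < e1"
      then show "lift_known s = lift_known t"
        using True by (intro right) auto
    qed (rule e1(1))
  next
    case False
    then have t0: "t > 0"
      using t by auto
    obtain e2 es where e2: "e2 > 0" "e2 \<le> t" "\<And>s. t - e2 < s \<Longrightarrow> s < t \<Longrightarrow> itinerary P f s = es"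
      "f t \<notin> boundary P \<Longrightarrow> itinerary P f t = es"
      "\<And>i. i < n \<Longrightarrow> f t \<in> edge P i \<Longrightarrow> itinerary P f t = es @ [i]"
      using itinerary_left[OF ngon traj t0] by metis
    let ?p = "odd (length es)"
    \<comment> \<open>At a strike both sheets give the same point, so the lift may be regarded as
      still lying in the old sheet at time \<open>t\<close>. This closes the interval on the left of
      \<open>t\<close>.\<close>
    have lt: "lift_path P f t = sheet_map P ?p (f t)"
    proof (cases "f t \<in> boundary P")
      case True
      then show ?thesis
        unfolding lift_path_sheet by (rule sheet_map_boundary)
    next
      case False
      then show ?thesis
        using e2(4) by (simp add: lift_path_sheet)
    qed
    have ct: "homologous (base_chain (parity t) (f t) + alternating_sum edge_class (itinerary P f t))
        (base_chain ?p (f t) + alternating_sum edge_class es)"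
    proof (cases "f t \<in> boundary P")
      case True
      then obtain i where i: "i < n" "f t \<in> edge P i"
        using boundary_edge[OF ngon traj] by blast
      show ?thesis
        unfolding e2(5)[OF i] by (rule lift_chain_edge[OF i(1)]) (use i avoid_vertices[OF ngon traj] in auto)
    next
      case False
      then show ?thesis
        using e2(4) by simp
    qed
    have left: "lift_known s = lift_known t" if s: "t - e2 < s" "s < t" for s
    proof (rule lift_known_step[where s = ?p])
      show "lift_path P f r = sheet_map P ?p (f r)" if "r \<in> {s..t}" for r
        using e2(3)[of r] lt that s by (cases "r = t") (auto simp: lift_path_sheet)
      have "homologous (base_chain (parity t) (f t) + alternating_sum edge_class (itinerary P f t) - base_chain False (f 0))
         (base_chain ?p (f t) + alternating_sum edge_class es - base_chain False (f 0))"
        by (rule homologous_rel_diff[OF ct homologous_rel_refl])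
      then show "homologous (lift_chain t) (lift_chain s + (base_chain ?p (f t) - base_chain ?p (f s)))"
        using e2(3)[OF s] by (simp add: lift_chain_def algebra_simps)
    qed (use s e2(2) in auto)
    show ?thesis
    proof (intro exI conjI ballI impI)
      fix s :: real assume "s \<in> {0..1}" "\<bar>s - t\<bar> < min e1 e2"
      then show "lift_known s = lift_known t"
        by (cases "s < t") (rule left right; simp)+
    qed (use e1(1) e2(1) in simp)
  qed
qed

lemma lift_known_1: "lift_known 1"
proof -
  have s: "lift_path P f t = sheet_map P False (f t)" if "t \<in> {0..0}" for t
    using that by (simp add: lift_path_sheet itinerary_0[OF ngon traj])
  have "continuous_map (top_of_set {0..0}) (double P) (lift_path P f)"
    by (rule continuous_map_eq[OF continuous_map_sheet_trajectory[of "{0..0}" False]]) (simp add: s)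
  moreover have "homologous (frag_of (seg (lift_path P f) 0 0)) (base_chain False (f 0) - base_chain False (f 0))"
  proof -
    have "seg (lift_path P f) 0 0 = seg (\<lambda>t. sheet_map P False (f t)) 0 0"
      using s order_refl by (rule seg_cong)
    moreover have "f ` {0..0} \<subseteq> region P - set P"
      using avoid_vertices[OF ngon traj] by blast
    ultimately show ?thesis
      using path_in_sheet[OF continuous_on_trajectory[OF ngon traj] _ order_refl, of 0 False] by simp
  qed
  ultimately have "lift_known 0"
    by (simp add: lift_known_def lift_chain_def itinerary_0[OF ngon traj])
  then show ?thesis
    using locally_constant_real[of "{0..1}" lift_known 0 1] lift_known_locally_constant by auto
qed

lemma null_homologous_iff_signed_count:
  assumes even: "even (length (itinerary P f 1))" and closed: "f 0 = f 1"
  shows "null_homologous (double P) (lift_path P f) \<longleftrightarrow> (\<forall>i<n. signed_count i (itinerary P f 1) = 0)"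
proof -
  let ?es = "itinerary P f 1"
  have h: "homologous (frag_of (seg (lift_path P f) 0 1)) (alternating_sum edge_class ?es)"
    using lift_known_1 even closed by (simp add: lift_known_def lift_chain_def)
  show ?thesis
  proof
    assume "null_homologous (double P) (lift_path P f)"
    then have "homologous (frag_of (seg (lift_path P f) 0 1)) 0"
      by (simp add: null_homologous_iff)
    then have h0: "homologous (alternating_sum edge_class ?es) 0"
      by (rule homologous_rel_trans[OF _ homologous_rel_sym[THEN iffD1, OF h]])
    show "\<forall>i<n. signed_count i ?es = 0"
    proof (intro allI impI)
      fix i assume i: "i < n"
      let ?w = "chain_winding (circle_map n P i)" and ?b = "bump n P i p"
      have "?w (alternating_sum edge_class ?es) = ?w 0"
        using chain_winding_homologous[OF continuous_map_circle[OF ngon i] circle_map_nonzero[OF ngon] h0] .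
      \<comment> \<open>Every letter contributes its indicator minus the constant \<open>?b\<close>;
        in the alternating sum the constants cancel in pairs, and one is left over for odd
        length.\<close>
      moreover have "?w (alternating_sum edge_class es) =
          of_int (signed_count i es) - (if odd (length es) then of_real ?b else 0)" if "set es \<subseteq> {..<n}" for es
        using that
      proof (induction es)
        case (Cons e es)
        then have e: "e < n"
          by simp
        have "edge_point P e (1 / 2) \<in> region P - set P"
          using midpoint_on_edge[OF e] edge_in_region[OF ngon e] by blast
        then have "?w (edge_class e) = of_real ((if e = i then 1 else 0) - ?b)"
          using winding_sheet_difference[OF i] bump_edge[OF ngon i e] midpoint_on_edge[OF e]
          by (simp add: edge_class_def)
        then show ?case
          using Cons by (simp add: chain_winding_diff)
      qed simp
      ultimately have "of_int (signed_count i ?es) = (0 :: complex)"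
        using set_itinerary[OF ngon traj] even by simp
      then show "signed_count i ?es = 0"
        by simp
    qed
  next
    assume "\<forall>i<n. signed_count i ?es = 0"
    moreover have "alternating_sum edge_class ?es = (\<Sum>i<n. frag_cmul (signed_count i ?es) (edge_class i))"
      by (rule alternating_sum_expand) (simp_all add: frag_cmul_diff_distrib set_itinerary[OF ngon traj])
    ultimately have "alternating_sum edge_class ?es = 0"
      by simp
    then show "null_homologous (double P) (lift_path P f)"
      using h by (simp add: null_homologous_iff)
  qed
qed

end

lemma null_homologous_iff_balanced:
  assumes ngon: "ngon n P" and traj: "trajectory P f"
    and "even (length (itinerary P f 1))" "f 0 = f 1"
  shows "null_homologous (double P) (lift_path P f) \<longleftrightarrow> (\<forall>i<n. signed_count i (itinerary P f 1) = 0)"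
proof -
  have p: "f 0 \<in> region P - set P"
    using avoid_vertices[OF ngon traj] by blast
  obtain A where "\<And>z. z \<in> region P - set P \<Longrightarrow> path (A z)"
    "\<And>z. z \<in> region P - set P \<Longrightarrow> path_image (A z) \<subseteq> region P - set P"
    "\<And>z. z \<in> region P - set P \<Longrightarrow> A z 0 = f 0" "\<And>z. z \<in> region P - set P \<Longrightarrow> A z 1 = z"
    using basepoint_paths[OF ngon p] by metis
  then interpret base_paths_trajectory n P "f 0" A f
    using ngon p traj by unfold_locales
  show ?thesis
    using null_homologous_iff_signed_count assms(3,4) .
qed

subsection \<open>The holonomy of the unfolding\<close>

definition edge_angle :: "complex list \<Rightarrow> nat \<Rightarrow> real" where
  "edge_angle P i = Arg (edge_dir P i)"

lemma divide_cnj_Arg: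
  assumes "z \<noteq> 0"
  shows "z / cnj z = cis (2 * Arg z)"
proof -
  have z: "z = of_real (norm z) * cis (Arg z)"
    using rcis_cmod_Arg[of z] by (simp add: rcis_def)
  have "z / cnj z = (of_real (norm z) * cis (Arg z)) / (of_real (norm z) * cis (- Arg z))"
    by (subst (1 2) z) (simp add: cis_cnj)
  also have "\<dots> = cis (Arg z) / cis (- Arg z)"
    using assms by simp
  also have "\<dots> = cis (2 * Arg z)"
    by (simp add: cis_divide)
  finally show ?thesis .
qed

text \<open>Reflection in a direction \<theta> is conjugation followed by the rotation through 2
  \<theta>, and conjugation reverses the rotations accumulated so far; hence the alternating
  signs.\<close>

lemma develop_dir_angle:
  assumes "\<And>e. e \<in> set es \<Longrightarrow> edge_dir P e \<noteq> 0"
  shows "develop_dir P es u = cis (2 * alternating_sum (edge_angle P) es) * (if even (length es) then u else cnj u)"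
  using assms
proof (induction es)
  case (Cons e es)
  have "develop_dir P (e # es) u = cis (2 * edge_angle P e) * cnj (develop_dir P es u)"
    using divide_cnj_Arg[of "edge_dir P e"] Cons.prems by (simp add: reflect_dir_eq edge_angle_def)
  also have "\<dots> = cis (2 * edge_angle P e) * cis (- (2 * alternating_sum (edge_angle P) es)) *
      (if even (length (e # es)) then u else cnj u)"
    using Cons by (simp add: cis_cnj)
  also have "cis (2 * edge_angle P e) * cis (- (2 * alternating_sum (edge_angle P) es)) =
      cis (2 * alternating_sum (edge_angle P) (e # es))"
    by (simp add: cis_mult right_diff_distrib)
  finally show ?case .
qed simp

lemma is_translation_develop_iff:
  assumes "\<And>e. e \<in> set es \<Longrightarrow> edge_dir P e \<noteq> 0"
  shows "is_translation (develop P es) \<longleftrightarrow>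
    even (length es) \<and> cis (2 * alternating_sum (edge_angle P) es) = 1"
proof -
  have dev: "develop P es z = develop P es 0 + develop_dir P es z" for z
    using develop_add[of P es 0 z] by simp
  have "is_translation (develop P es) \<longleftrightarrow> (\<forall>z. develop_dir P es z = z)"
  proof
    assume "is_translation (develop P es)"
    then obtain \<tau> where \<tau>: "\<And>z. develop P es z = z + \<tau>"
      by (auto simp: is_translation_def)
    show "\<forall>z. develop_dir P es z = z"
      using dev \<tau>[of 0] \<tau> by (metis add.commute add_left_cancel add_0)
  next
    assume "\<forall>z. develop_dir P es z = z"
    then show "is_translation (develop P es)"
      unfolding is_translation_def using dev by (metis add.commute)
  qed
  also have "\<dots> \<longleftrightarrow> even (length es) \<and> cis (2 * alternating_sum (edge_angle P) es) = 1"
  proof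
    assume a: "\<forall>z. develop_dir P es z = z"
    \<comment> \<open>The image of 1 determines the rotation; the image of \<i> then separates the
      identity from conjugation.\<close>
    have 1: "cis (2 * alternating_sum (edge_angle P) es) = 1"
      using a[rule_format, of 1] develop_dir_angle[OF assms, where u = 1] by (simp split: if_splits)
    moreover have "even (length es)"
      using a[rule_format, of \<i>] develop_dir_angle[OF assms, where u = \<i>] 1
      by (auto simp: complex_eq_iff split: if_splits)
    ultimately show "even (length es) \<and> cis (2 * alternating_sum (edge_angle P) es) = 1"
      by blast
  qed (use develop_dir_angle[OF assms] in auto)
  finally show ?thesis .
qed

text \<open>Only doubled angles modulo full turns matter. This permits replacing \<open>Arg\<close>
  of a perturbed edge by an angle that varies continuously across the branch cut.\<close>

lemma cis_alternating_sum_cong: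
  assumes "\<And>e. e \<in> set es \<Longrightarrow> cis (2 * g e) = cis (2 * h e)"
  shows "cis (2 * alternating_sum g es) = cis (2 * alternating_sum h es)"
  using assms
proof (induction es)
  case (Cons e es)
  have "cis (2 * alternating_sum k (e # es)) = cis (2 * k e) / cis (2 * alternating_sum k es)" for k
    by (simp add: cis_divide right_diff_distrib)
  then show ?case
    using Cons by simp
qed simp

lemma alternating_sum_add:
  "alternating_sum (\<lambda>e. g e + h e) es = alternating_sum g es + alternating_sum h es"
  by (induction es) auto

lemma alternating_sum_real:
  assumes "set es \<subseteq> {..<n}"
  shows "alternating_sum g es = (\<Sum>i<n. of_int (signed_count i es) * (g i :: real))"
  by (rule alternating_sum_expand[of "\<lambda>k x. of_int k * x", OF _ _ assms]) (simp_all add: left_diff_distrib)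

lemma sum_signed_count:
  assumes "set es \<subseteq> {..<n}" "even (length es)"
  shows "(\<Sum>i<n. signed_count i es) = 0"
proof -
  have "alternating_sum (\<lambda>_. 1 :: int) es = (\<Sum>i<n. signed_count i es * 1)"
    by (rule alternating_sum_expand[of "(*)", OF _ _ assms(1)]) (simp_all add: left_diff_distrib)
  moreover have "alternating_sum (\<lambda>_. 1 :: int) es' = (if even (length es') then 0 else 1)" for es'
    by (induction es') auto
  ultimately show ?thesis
    using assms(2) by simp
qed

subsection \<open>Changing the starting point\<close>

lemma strike_times_split:
  assumes ngon: "ngon n P" and traj: "trajectory P f" and "0 \<le> a" "0 \<le> b"
  shows "strike_times P f (a + b) = strike_times P f a @ map (\<lambda>t. a + t) (strike_times P (\<lambda>t. f (a + t)) b)"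
proof -
  define A where "A = {s \<in> {0<..a}. f s \<in> boundary P}"
  define B where "B = {s \<in> {0<..b}. f (a + s) \<in> boundary P}"
  define C where "C = {s \<in> {0<..a + b}. f s \<in> boundary P}"
  have fin: "finite A" "finite B" "finite C"
    unfolding A_def B_def C_def
    using finite_strikes_Ioc[OF ngon traj] finite_strikes_Ioc[OF ngon trajectory_shift[OF traj]] by auto
  have C: "C = A \<union> (\<lambda>t. a + t) ` B"
  proof (intro equalityI subsetI)
    fix x assume x: "x \<in> C"
    show "x \<in> A \<union> (\<lambda>t. a + t) ` B"
    proof (cases "x \<le> a")
      case True
      then show ?thesis
        using x by (auto simp: A_def C_def)
    next
      case False
      then have "x - a \<in> B" "x = a + (x - a)"
        using x by (auto simp: B_def C_def)
      then show ?thesis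
        by blast
    qed
  next
    fix x assume "x \<in> A \<union> (\<lambda>t. a + t) ` B"
    then show "x \<in> C"
      using assms(3,4) by (auto simp: A_def B_def C_def)
  qed
  have sB: "sorted (map (\<lambda>t. a + t) (sorted_list_of_set B))" "distinct (map (\<lambda>t. a + t) (sorted_list_of_set B))"
    using sorted_sorted_list_of_set[of B] by (auto simp: sorted_map distinct_map intro: sorted_wrt_mono_rel)
  have lt: "x < y" if "x \<in> A" "y \<in> (\<lambda>t. a + t) ` B" for x y
    using that by (auto simp: A_def B_def)
  have "sorted (sorted_list_of_set A @ map (\<lambda>t. a + t) (sorted_list_of_set B))"
    using sB(1) fin lt by (auto simp: sorted_append intro!: less_imp_le)
  moreover have "distinct (sorted_list_of_set A @ map (\<lambda>t. a + t) (sorted_list_of_set B))"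
    using sB(2) fin lt by (fastforce simp: distinct_append)
  moreover have "set (sorted_list_of_set C) = set (sorted_list_of_set A @ map (\<lambda>t. a + t) (sorted_list_of_set B))"
    unfolding set_append set_map set_sorted_list_of_set[OF fin(1)] set_sorted_list_of_set[OF fin(2)]
      set_sorted_list_of_set[OF fin(3)] by (rule C)
  ultimately have "sorted_list_of_set C = sorted_list_of_set A @ map (\<lambda>t. a + t) (sorted_list_of_set B)"
    using sorted_distinct_set_unique[of "sorted_list_of_set C"]
      sorted_sorted_list_of_set[of C] distinct_sorted_list_of_set[of C] by blast
  then show ?thesis
    by (simp add: strike_times_def A_def B_def C_def)
qed

lemma itinerary_split:
  assumes "ngon n P" "trajectory P f" "0 \<le> a" "0 \<le> b"
  shows "itinerary P f (a + b) = itinerary P f a @ itinerary P (\<lambda>t. f (a + t)) b"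
  unfolding itinerary_def strike_times_split[OF assms] by simp

text \<open>By periodicity only the fractional part of \<open>s\<close> matters. Cutting one period
  there and exchanging the pieces gives the shifted itinerary.\<close>

lemma itinerary_rotation:
  assumes ngon: "ngon n P" and traj: "trajectory P f" and per: "\<And>t. f (t + 1) = f t"
  obtains A B where "itinerary P f 1 = A @ B" "itinerary P (\<lambda>t. f (s + t)) 1 = B @ A"
proof -
  have per_nat: "f (t + real k) = f t" for t k
  proof (induction k)
    case (Suc k)
    have "f (t + real (Suc k)) = f ((t + real k) + 1)"
      by (simp add: algebra_simps)
    then show ?case
      using Suc per by metis
  qed simp
  have int: "f (t + real_of_int k) = f t" for t k
  proof (cases "k \<ge> 0")
    case True
    then show ?thesis
      using per_nat[of t "nat k"] by simp
  next
    case False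
    then show ?thesis
      using per_nat[of "t + real_of_int k" "nat (- k)"] by simp
  qed
  define x where "x = frac s"
  have x: "0 \<le> x" "x \<le> 1"
    by (auto simp: x_def frac_lt_1 less_imp_le)
  have fs: "(\<lambda>t. f (s + t)) = (\<lambda>t. f (x + t))"
  proof
    fix t
    have "s + t = (x + t) + real_of_int \<lfloor>s\<rfloor>"
      by (simp add: x_def frac_def)
    then show "f (s + t) = f (x + t)"
      using int by metis
  qed
  have "itinerary P f (x + (1 - x)) = itinerary P f x @ itinerary P (\<lambda>t. f (x + t)) (1 - x)"
    by (rule itinerary_split[OF ngon traj]) (use x in auto)
  moreover have "itinerary P (\<lambda>t. f (x + t)) ((1 - x) + x) =
      itinerary P (\<lambda>t. f (x + t)) (1 - x) @ itinerary P (\<lambda>t. f (x + ((1 - x) + t))) x"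
    by (rule itinerary_split[OF ngon trajectory_shift[OF traj]]) (use x in auto)
  moreover have "(\<lambda>t. f (x + ((1 - x) + t))) = f"
    using per by (auto simp: add.commute)
  ultimately show ?thesis
    using that fs by simp
qed

text \<open>\<open>A\<close> and \<open>B\<close> have the same parity: if it is even nothing
  changes, if it is odd every letter changes its sign.\<close>

lemma alternating_sum_rotation:
  assumes "even (length (A @ B))"
  shows "alternating_sum g (B @ A) = alternating_sum g (A @ B) \<or> alternating_sum g (B @ A) = - alternating_sum g (A @ B)"
  using assms by (auto simp: alternating_sum_append)

subsection \<open>Nearby polygons\<close>

text \<open>Closeness of labelled polygons as a filter, so that continuity and openness can be
  handled by limits and \<open>eventually\<close>; the \<epsilon> of stability is recovered at the
  end by \<open>eventually_near\<close>.\<close>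

definition near :: "complex list \<Rightarrow> complex list filter" where
  "near P = (INF \<epsilon>\<in>{0<..}. principal {Q. length Q = length P \<and> (\<forall>i<length P. dist (P ! i) (Q ! i) < \<epsilon>)})"

lemma eventually_near:
  "eventually A (near P) \<longleftrightarrow>
     (\<exists>\<epsilon>>0. \<forall>Q. length Q = length P \<and> (\<forall>i<length P. dist (P ! i) (Q ! i) < \<epsilon>) \<longrightarrow> A Q)"
proof -
  have "eventually A (near P) \<longleftrightarrow> (\<exists>\<epsilon>\<in>{0<..}. eventually A
     (principal {Q. length Q = length P \<and> (\<forall>i<length P. dist (P ! i) (Q ! i) < \<epsilon>)}))"
    unfolding near_def
  proof (rule eventually_INF_base)
    fix a b :: real assume "a \<in> {0<..}" "b \<in> {0<..}"
    then show "\<exists>x\<in>{0<..}. principal {Q. length Q = length P \<and> (\<forall>i<length P. dist (P ! i) (Q ! i) < x)}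
        \<le> inf (principal {Q. length Q = length P \<and> (\<forall>i<length P. dist (P ! i) (Q ! i) < a)})
          (principal {Q. length Q = length P \<and> (\<forall>i<length P. dist (P ! i) (Q ! i) < b)})"
      by (intro bexI[of _ "min a b"]) auto
  qed auto
  then show ?thesis
    by (auto simp: eventually_principal)
qed

lemma eventually_near_length: "\<forall>\<^sub>F Q in near P. length Q = length P"
  unfolding eventually_near by (intro exI[of _ 1]) simp

lemma tendsto_near_nth:
  assumes "i < length P"
  shows "((\<lambda>Q. Q ! i) \<longlongrightarrow> P ! i) (near P)"
proof (rule tendstoI)
  fix e :: real assume "e > 0"
  then show "\<forall>\<^sub>F Q in near P. dist (Q ! i) (P ! i) < e"
    unfolding eventually_near using assms by (intro exI[of _ e]) (auto simp: dist_commute)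
qed

lemma tendsto_near_edge_dir:
  assumes "i < length P"
  shows "((\<lambda>Q. edge_dir Q i) \<longlongrightarrow> edge_dir P i) (near P)"
proof -
  have "Suc i mod length P < length P"
    by (rule mod_less_divisor) (use assms in linarith)
  then have "((\<lambda>Q. Q ! (Suc i mod length P) - Q ! i) \<longlongrightarrow> edge_dir P i) (near P)"
    unfolding edge_dir_def using assms by (intro tendsto_intros tendsto_near_nth)
  then show ?thesis
    by (rule Lim_transform_eventually)
      (use eventually_near_length[of P] in \<open>auto elim!: eventually_mono simp: edge_dir_def\<close>)
qed

text \<open>Disjoint compact segments have a positive gap. If the four ends move by less than half
  of it, so do all points of the segments with given parameters.\<close>

lemma eventually_disjoint_segments:
  fixes a b c d :: "'b \<Rightarrow> complex"
  assumes lim: "(a \<longlongrightarrow> a0) F" "(b \<longlongrightarrow> b0) F" "(c \<longlongrightarrow> c0) F" "(d \<longlongrightarrow> d0) F"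
    and disj: "closed_segment a0 b0 \<inter> closed_segment c0 d0 = {}"
  shows "\<forall>\<^sub>F x in F. closed_segment (a x) (b x) \<inter> closed_segment (c x) (d x) = {}"
proof -
  obtain \<delta> where \<delta>: "\<delta> > 0" "\<And>x y. x \<in> closed_segment a0 b0 \<Longrightarrow> y \<in> closed_segment c0 d0 \<Longrightarrow> \<delta> \<le> dist x y"
    using separate_compact_closed[of "closed_segment a0 b0" "closed_segment c0 d0"] disj
    by (auto simp: compact_imp_closed)
  have near: "dist ((1 - u) *\<^sub>R p + u *\<^sub>R q) ((1 - u) *\<^sub>R p0 + u *\<^sub>R q0) < \<delta> / 2"
    if "dist p p0 < \<delta> / 2" "dist q q0 < \<delta> / 2" "0 \<le> u" "u \<le> 1" for p q p0 q0 :: complex and u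
  proof -
    have "(1 - u) *\<^sub>R p + u *\<^sub>R q - ((1 - u) *\<^sub>R p0 + u *\<^sub>R q0) = (1 - u) *\<^sub>R (p - p0) + u *\<^sub>R (q - q0)"
      by (simp add: algebra_simps)
    also have "norm \<dots> \<le> (1 - u) * norm (p - p0) + u * norm (q - q0)"
      using that norm_triangle_ineq[of "(1 - u) *\<^sub>R (p - p0)" "u *\<^sub>R (q - q0)"] by simp
    also have "\<dots> < \<delta> / 2"
      using that by (intro convex_bound_lt) (auto simp: dist_norm)
    finally show ?thesis
      by (simp add: dist_norm)
  qed
  have "\<forall>\<^sub>F x in F. dist (a x) a0 < \<delta> / 2 \<and> dist (b x) b0 < \<delta> / 2 \<and> dist (c x) c0 < \<delta> / 2 \<and> dist (d x) d0 < \<delta> / 2"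
    using \<delta>(1) by (intro eventually_conj tendstoD lim) auto
  then show ?thesis
  proof (rule eventually_mono)
    fix x assume x: "dist (a x) a0 < \<delta> / 2 \<and> dist (b x) b0 < \<delta> / 2 \<and> dist (c x) c0 < \<delta> / 2 \<and> dist (d x) d0 < \<delta> / 2"
    show "closed_segment (a x) (b x) \<inter> closed_segment (c x) (d x) = {}"
    proof (rule ccontr)
      assume "\<not> ?thesis"
      then obtain z where zz: "z \<in> closed_segment (a x) (b x)" "z \<in> closed_segment (c x) (d x)"
        by blast
      obtain u where u: "0 \<le> u" "u \<le> 1" "z = (1 - u) *\<^sub>R a x + u *\<^sub>R b x"
        using zz(1) by (auto simp: closed_segment_def)
      obtain v where v: "0 \<le> v" "v \<le> 1" "z = (1 - v) *\<^sub>R c x + v *\<^sub>R d x"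
        using zz(2) by (auto simp: closed_segment_def)
      note z = u(3) v(3) and uv = u(1,2) v(1,2)
      let ?y = "(1 - u) *\<^sub>R a0 + u *\<^sub>R b0" and ?w = "(1 - v) *\<^sub>R c0 + v *\<^sub>R d0"
      have "dist z ?y < \<delta> / 2" "dist z ?w < \<delta> / 2"
        using near[of "a x" a0 "b x" b0 u, folded z(1)] near[of "c x" c0 "d x" d0 v, folded z(2)] x uv by auto
      then have "dist ?y ?w < \<delta>"
        using dist_triangle_half_r by blast
      moreover have "?y \<in> closed_segment a0 b0" "?w \<in> closed_segment c0 d0"
        using uv by (auto simp: closed_segment_def)
      ultimately show False
        using \<delta>(2) by fastforce
    qed
  qed
qed

text \<open>Segments issuing from \<open>b\<close> overlap beyond \<open>b\<close> exactly when they
  point in the same direction. The complement of the nonnegative reals is open, so this form of the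
  condition survives small perturbations.\<close>

lemma segments_meet_at_vertex:
  fixes a b c :: complex
  assumes "a \<noteq> b" "c \<noteq> b"
  shows "closed_segment a b \<inter> closed_segment b c = {b} \<longleftrightarrow> (a - b) * cnj (c - b) \<notin> \<real>\<^sub>\<ge>\<^sub>0"
proof
  assume L: "closed_segment a b \<inter> closed_segment b c = {b}"
  show "(a - b) * cnj (c - b) \<notin> \<real>\<^sub>\<ge>\<^sub>0"
  proof
    assume "(a - b) * cnj (c - b) \<in> \<real>\<^sub>\<ge>\<^sub>0"
    then obtain r where r: "(a - b) * cnj (c - b) = of_real r" "r \<ge> 0"
      by (auto elim: nonneg_Reals_cases)
    have "r \<noteq> 0"
      using r(1) assms by auto
    then have "r > 0"
      using r(2) by simp
    define k where "k = r / norm (c - b) ^ 2"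
    have k: "k > 0"
      using \<open>r > 0\<close> assms by (simp add: k_def)
    have 1: "(a - b) * (cnj (c - b) * (c - b)) = of_real r * (c - b)"
      unfolding mult.assoc[symmetric] r(1) ..
    have 2: "cnj (c - b) * (c - b) = of_real (norm (c - b) ^ 2)"
      by (metis complex_norm_square mult.commute)
    have "(a - b) * of_real (norm (c - b) ^ 2) = of_real r * (c - b)"
      using 1 unfolding 2 .
    then have ab: "a - b = of_real k * (c - b)"
      using assms by (simp add: k_def field_simps)
    \<comment> \<open>A second common point: the fraction \<open>min k 1\<close> of the way to
      \<open>c\<close>, which is the fraction \<open>min k 1 / k\<close>, at most 1, of the way to
      \<open>a\<close>.\<close>
    define z where "z = b + of_real (min k 1) * (c - b)"
    have "z = (1 - min k 1) *\<^sub>R b + min k 1 *\<^sub>R c"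
      by (simp add: z_def scaleR_conv_of_real algebra_simps)
    then have zc: "z \<in> closed_segment b c"
      using k by (auto simp: closed_segment_def intro!: exI[of _ "min k 1"])
    define q where "q = min k 1 / k"
    have zq: "z = b + of_real q * (a - b)"
      unfolding z_def ab q_def using k by simp
    have "z = (1 - (1 - q)) *\<^sub>R a + (1 - q) *\<^sub>R b"
      by (simp add: zq scaleR_conv_of_real algebra_simps)
    moreover have "0 \<le> 1 - q" "1 - q \<le> 1"
      using k by (auto simp: q_def)
    ultimately have "z \<in> closed_segment a b"
      unfolding closed_segment_def by blast
    then have "z = b"
      using L zc by blast
    then show False
      using k assms by (auto simp: z_def min_def split: if_splits)
  qed
next
  assume R: "(a - b) * cnj (c - b) \<notin> \<real>\<^sub>\<ge>\<^sub>0"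
  have "z = b" if z: "z \<in> closed_segment a b" "z \<in> closed_segment b c" for z
  proof (rule ccontr)
    assume zb: "z \<noteq> b"
    obtain u where u: "0 \<le> u" "u \<le> 1" "z = (1 - u) *\<^sub>R a + u *\<^sub>R b"
      using z(1) by (auto simp: closed_segment_def)
    obtain v where v: "0 \<le> v" "v \<le> 1" "z = (1 - v) *\<^sub>R b + v *\<^sub>R c"
      using z(2) by (auto simp: closed_segment_def)
    note uv = u(1,2) v(1,2) u(3) v(3)
    have 1: "z - b = of_real (1 - u) * (a - b)"
      unfolding uv(5) by (simp add: scaleR_conv_of_real algebra_simps)
    have 2: "z - b = of_real v * (c - b)"
      unfolding uv(6) by (simp add: scaleR_conv_of_real algebra_simps)
    have u1: "1 - u > 0"
      using 1 zb uv(2) by (cases "u = 1") auto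
    have "a - b = of_real (v / (1 - u)) * (c - b)"
      using 1 2 u1 by (simp add: field_simps)
    then have "(a - b) * cnj (c - b) = of_real (v / (1 - u) * norm (c - b) ^ 2)"
      by (metis complex_norm_square mult.assoc of_real_mult)
    then show False
      using R u1 uv(3) by (metis divide_nonneg_pos mult_nonneg_nonneg nonneg_Reals_of_real_iff zero_le_power2)
  qed
  then show "closed_segment a b \<inter> closed_segment b c = {b}"
    by auto
qed

lemma cis_eq_1_small:
  assumes "cis x = 1" "\<bar>x\<bar> < 2 * pi"
  shows "x = 0"
proof -
  have "cos x = 1"
    using assms(1) by (metis cis.sel(1) one_complex.sel(1))
  then obtain k :: int where k: "x = real_of_int k * 2 * pi"
    using cos_one_2pi_int by blast
  then have "\<bar>real_of_int k\<bar> * (2 * pi) < 1 * (2 * pi)"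
    using assms(2) by (simp add: abs_mult)
  then have "\<bar>real_of_int k\<bar> < 1"
    by (rule mult_right_less_imp_less) simp
  then show ?thesis
    using k by simp
qed

lemma mod_add_2_neq:
  fixes i n :: nat
  assumes "i < n" "3 \<le> n"
  shows "Suc (Suc i mod n) mod n \<noteq> i"
  using assms by (auto simp: mod_Suc split: if_splits)

lemma adjacent_edges:
  assumes ngon: "ngon n P" and i: "i < n" "j = Suc i mod n"
  shows "(P ! i - P ! j) * cnj (P ! (Suc j mod n) - P ! j) \<notin> \<real>\<^sub>\<ge>\<^sub>0"
proof -
  have j: "j < n" "i \<noteq> j" "Suc j mod n < n" "Suc j mod n \<noteq> i" "Suc j mod n \<noteq> j"
    using i ngon_ge_3[OF ngon] mod_add_2_neq[of i n] Suc_mod_neq[OF ngon] by auto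
  then have ne: "P ! i \<noteq> P ! j" "P ! (Suc j mod n) \<noteq> P ! j" "P ! (Suc j mod n) \<noteq> P ! i"
    using nth_neq[OF ngon] i by auto
  have "edge P i \<inter> edge P j = {P ! j}"
    using edge_inter[OF ngon, of i j] i j ne by auto
  then show ?thesis
    using segments_meet_at_vertex[OF ne(1,2)] i by (simp add: edge_eq_segment ngon_length[OF ngon])
qed

text \<open>Simplicity is an open condition, although adjacent edges are not disjoint: for these the
  angle condition at the common vertex persists, for all other pairs the positive gap does.\<close>

lemma eventually_near_ngon:
  assumes ngon: "ngon n P"
  shows "\<forall>\<^sub>F Q in near P. ngon n Q"
proof -
  let ?C = "\<lambda>Q i j. edge Q i \<inter> edge Q j = {Q ! i, Q ! (Suc i mod n)} \<inter> {Q ! j, Q ! (Suc j mod n)}"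
  note lenP = ngon_length[OF ngon] and n3 = ngon_ge_3[OF ngon]
  have suc: "Suc i mod n < n" for i
    using n3 by simp
  have lenQ: "\<forall>\<^sub>F Q in near P. length Q = n"
    using eventually_near_length[of P] lenP by simp
  have ne: "\<forall>\<^sub>F Q in near P. Q ! i \<noteq> Q ! j" if "i < n" "j < n" "i \<noteq> j" for i j
  proof -
    have "((\<lambda>Q. Q ! i - Q ! j) \<longlongrightarrow> P ! i - P ! j) (near P)"
      using that lenP by (intro tendsto_intros tendsto_near_nth) auto
    moreover have "P ! i - P ! j \<noteq> 0"
      using nth_neq[OF ngon that] by simp
    ultimately have "\<forall>\<^sub>F Q in near P. Q ! i - Q ! j \<noteq> 0"
      by (rule tendsto_imp_eventually_ne)
    then show ?thesis
      by (rule eventually_mono) simp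
  qed
  have adj: "\<forall>\<^sub>F Q in near P. ?C Q i j" if i: "i < n" and j: "j = Suc i mod n" for i j
  proof -
    have j': "j < n" "i \<noteq> j" "Suc j mod n \<noteq> i" "Suc j mod n \<noteq> j"
      using i j n3 mod_add_2_neq[of i n] Suc_mod_neq[OF ngon] by auto
    have "((\<lambda>Q. (Q ! i - Q ! j) * cnj (Q ! (Suc j mod n) - Q ! j)) \<longlongrightarrow>
        (P ! i - P ! j) * cnj (P ! (Suc j mod n) - P ! j)) (near P)"
      using i j' lenP suc by (intro tendsto_intros tendsto_near_nth) auto
    moreover have "open (- (\<real>\<^sub>\<ge>\<^sub>0 :: complex set))"
      by (simp add: open_Compl)
    ultimately have "\<forall>\<^sub>F Q in near P. (Q ! i - Q ! j) * cnj (Q ! (Suc j mod n) - Q ! j) \<in> - \<real>\<^sub>\<ge>\<^sub>0"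
      using adjacent_edges[OF ngon i j] by (intro topological_tendstoD) auto
    moreover have "\<forall>\<^sub>F Q in near P. Q ! i \<noteq> Q ! j" "\<forall>\<^sub>F Q in near P. Q ! (Suc j mod n) \<noteq> Q ! j"
      "\<forall>\<^sub>F Q in near P. Q ! (Suc j mod n) \<noteq> Q ! i"
      using i j' suc by (auto intro!: ne)
    ultimately show ?thesis
      using lenQ
    proof eventually_elim
      case (elim Q)
      have "edge Q i \<inter> edge Q j = {Q ! j}"
        using segments_meet_at_vertex[OF elim(2,3)] elim(1,5) j by (simp add: edge_eq_segment)
      then show ?case
        using elim(2-4) j by auto
    qed
  qed
  have C: "\<forall>\<^sub>F Q in near P. ?C Q i j" if ij: "i < n" "j < n" "i \<noteq> j" for i j
  proof -
    consider "j = Suc i mod n" | "i = Suc j mod n" | "j \<noteq> Suc i mod n" "i \<noteq> Suc j mod n"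
      by blast
    then show ?thesis
    proof cases
      case 1
      then show ?thesis
        using adj ij by blast
    next
      case 2
      then have "\<forall>\<^sub>F Q in near P. ?C Q j i"
        using adj ij by blast
      then show ?thesis
        by (rule eventually_mono) (simp add: Int_commute)
    next
      case 3
      have "Suc i mod n \<noteq> Suc j mod n"
        using ij by (auto simp: mod_Suc split: if_splits)
      then have "edge P i \<inter> edge P j = {}"
        using edge_inter[OF ngon ij] nth_neq[OF ngon] ij suc 3 by auto
      then have "\<forall>\<^sub>F Q in near P. closed_segment (Q ! i) (Q ! (Suc i mod n)) \<inter>
          closed_segment (Q ! j) (Q ! (Suc j mod n)) = {}"
        using eventually_disjoint_segments[OF tendsto_near_nth[of i P] tendsto_near_nth[of "Suc i mod n" P]
            tendsto_near_nth[of j P] tendsto_near_nth[of "Suc j mod n" P]] ij suc lenP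
        by (simp add: edge_eq_segment)
      then show ?thesis
        using lenQ
      proof eventually_elim
        case (elim Q)
        then have "edge Q i \<inter> edge Q j = {}"
          by (simp add: edge_eq_segment)
        moreover have "{Q ! i, Q ! (Suc i mod n)} \<subseteq> edge Q i" "{Q ! j, Q ! (Suc j mod n)} \<subseteq> edge Q j"
          using edge_ends[of Q] elim(2) by auto
        ultimately show ?case
          by blast
      qed
    qed
  qed
  have "\<forall>\<^sub>F Q in near P. \<forall>x\<in>{..<n} \<times> {..<n}. fst x \<noteq> snd x \<longrightarrow> Q ! fst x \<noteq> Q ! snd x \<and> ?C Q (fst x) (snd x)"
  proof (rule eventually_ball_finite, simp, intro ballI)
    fix x assume x: "x \<in> {..<n} \<times> {..<n}"
    show "\<forall>\<^sub>F Q in near P. fst x \<noteq> snd x \<longrightarrow> Q ! fst x \<noteq> Q ! snd x \<and> ?C Q (fst x) (snd x)"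
    proof (cases "fst x = snd x")
      case False
      have "\<forall>\<^sub>F Q in near P. Q ! fst x \<noteq> Q ! snd x \<and> ?C Q (fst x) (snd x)"
        using x False by (intro eventually_conj ne C) auto
      then show ?thesis
        by (rule eventually_mono) blast
    qed simp
  qed
  then show ?thesis
    using lenQ
  proof eventually_elim
    case (elim Q)
    then show ?case
      using n3 by (auto simp: ngon_def distinct_conv_nth)
  qed
qed

section \<open>Variation of a single vertex\<close>

definition move_vertex :: "complex list \<Rightarrow> nat \<Rightarrow> complex \<Rightarrow> complex list" where
  "move_vertex P k \<delta> = P[k := P ! k + \<delta>]"

lemma filterlim_move_vertex: "filterlim (move_vertex P k) (near P) (nhds 0)"
  unfolding filterlim_iff
proof (intro allI impI)
  fix A assume "eventually A (near P)"
  then obtain \<epsilon> where \<epsilon>: "\<epsilon> > 0" "\<And>Q. length Q = length P \<Longrightarrow> \<forall>i<length P. dist (P ! i) (Q ! i) < \<epsilon> \<Longrightarrow> A Q"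
    unfolding eventually_near by blast
  have "A (move_vertex P k \<delta>)" if \<delta>: "dist \<delta> 0 < \<epsilon>" for \<delta>
  proof (rule \<epsilon>(2), simp add: move_vertex_def, intro allI impI)
    fix i assume "i < length P"
    then show "dist (P ! i) (move_vertex P k \<delta> ! i) < \<epsilon>"
      using \<delta> \<epsilon>(1) by (cases "i = k") (simp_all add: move_vertex_def dist_norm)
  qed
  then show "\<forall>\<^sub>F \<delta> in nhds 0. A (move_vertex P k \<delta>)"
    unfolding eventually_nhds_metric using \<epsilon>(1) by blast
qed

context
  fixes n P j k
  assumes ngon: "ngon n P" and j: "j < n" and k: "k = Suc j mod n"
begin

lemma successor_index: "k < n" "j \<noteq> k" "Suc k mod n \<noteq> k"
proof -
  show "k < n"
    unfolding k by (rule mod_less_divisor) (use j in linarith)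
  then show "Suc k mod n \<noteq> k"
    by (rule Suc_mod_neq[OF ngon])
  show "j \<noteq> k"
    using Suc_mod_neq[OF ngon j] k by simp
qed

lemma edge_dir_move_vertex:
  assumes "i < n"
  shows "edge_dir (move_vertex P k \<delta>) i =
    (if i = j then edge_dir P j + \<delta> else if i = k then edge_dir P k - \<delta> else edge_dir P i)"
proof -
  have "Suc i mod n = k \<longleftrightarrow> i = j"
    using j k assms by (auto simp: mod_Suc split: if_splits)
  moreover have "Suc i mod n < n"
    using j by simp
  ultimately show ?thesis
    using successor_index assms by (auto simp: edge_dir_def move_vertex_def ngon_length[OF ngon] nth_list_update)
qed

text \<open>Only the two edges at the moved vertex turn. Twice the total change of angle is a
  multiple of a full turn and tends to 0, so it is exactly 0 for small displacements.\<close>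

lemma angle_variation:
  assumes es: "set es \<subseteq> {..<n}" and ev: "\<forall>\<^sub>F Q in near P. cis (2 * alternating_sum (edge_angle Q) es) = 1"
  shows "\<forall>\<^sub>F \<delta> in nhds 0. of_int (signed_count j es) * Arg (1 + \<delta> / edge_dir P j) +
     of_int (signed_count k es) * Arg (1 - \<delta> / edge_dir P k) = 0"
proof -
  let ?dj = "edge_dir P j" and ?dk = "edge_dir P k"
  let ?S = "\<lambda>\<delta>. of_int (signed_count j es) * Arg (1 + \<delta> / ?dj) + of_int (signed_count k es) * Arg (1 - \<delta> / ?dk)"
  have d: "edge_dir P i \<noteq> 0" if "i < n" for i
    using edge_dir_neq_0[OF ngon that] .
  have P1: "cis (2 * alternating_sum (edge_angle P) es) = 1"
    using ev unfolding eventually_near by auto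
  have ne: "\<forall>\<^sub>F \<delta> in nhds 0. ?dj + \<delta> \<noteq> 0" "\<forall>\<^sub>F \<delta> in nhds 0. ?dk - \<delta> \<noteq> 0"
  proof -
    have lim: "((\<lambda>\<delta>. ?dj + \<delta>) \<longlongrightarrow> ?dj + 0) (nhds 0)" "((\<lambda>\<delta>. ?dk - \<delta>) \<longlongrightarrow> ?dk - 0) (nhds 0)"
      by (intro tendsto_intros filterlim_ident)+
    show "\<forall>\<^sub>F \<delta> in nhds 0. ?dj + \<delta> \<noteq> 0"
      by (rule tendsto_imp_eventually_ne[OF lim(1)]) (simp add: d[OF j])
    show "\<forall>\<^sub>F \<delta> in nhds 0. ?dk - \<delta> \<noteq> 0"
      by (rule tendsto_imp_eventually_ne[OF lim(2)]) (simp add: d[OF successor_index(1)])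
  qed
  have "(?S \<longlongrightarrow> of_int (signed_count j es) * Arg (1 + 0 / ?dj) + of_int (signed_count k es) * Arg (1 - 0 / ?dk)) (nhds 0)"
    using d[OF j] d[OF successor_index(1)]
    by (intro tendsto_intros filterlim_ident isCont_tendsto_compose[of _ Arg] continuous_at_Arg) auto
  then have "((\<lambda>\<delta>. \<bar>2 * ?S \<delta>\<bar>) \<longlongrightarrow> \<bar>2 * 0\<bar>) (nhds 0)"
    by (intro tendsto_intros) (simp add: Arg_eq_0)
  then have "\<forall>\<^sub>F \<delta> in nhds 0. \<bar>2 * ?S \<delta>\<bar> < 2 * pi"
    by (rule order_tendstoD) simp
  moreover have "\<forall>\<^sub>F \<delta> in nhds 0. cis (2 * alternating_sum (edge_angle (move_vertex P k \<delta>)) es) = 1"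
    using filterlim_move_vertex ev unfolding filterlim_iff by blast
  ultimately show ?thesis
    using ne
  proof eventually_elim
    case (elim \<delta>)
    let ?Q = "move_vertex P k \<delta>"
    \<comment> \<open>The change of direction is taken from the quotient, which is near 1, because
      \<open>Arg\<close> of the edge itself may jump.\<close>
    define \<psi> where "\<psi> = (\<lambda>i. Arg (edge_dir ?Q i / edge_dir P i))"
    have "cis (2 * edge_angle ?Q i) = cis (2 * (edge_angle P i + \<psi> i))" if i: "i < n" for i
    proof -
      have dQ: "edge_dir ?Q i \<noteq> 0"
        using edge_dir_move_vertex[OF i] elim(3,4) d[OF i] by auto
      have "cis (2 * edge_angle ?Q i) = edge_dir ?Q i / cnj (edge_dir ?Q i)"
        unfolding edge_angle_def using divide_cnj_Arg[OF dQ] by simp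
      also have "\<dots> = (edge_dir P i / cnj (edge_dir P i)) *
          ((edge_dir ?Q i / edge_dir P i) / cnj (edge_dir ?Q i / edge_dir P i))"
        using d[OF i] by simp
      also have "\<dots> = cis (2 * edge_angle P i) * cis (2 * \<psi> i)"
        using divide_cnj_Arg[OF d[OF i]] divide_cnj_Arg[of "edge_dir ?Q i / edge_dir P i"] dQ d[OF i]
        by (simp add: edge_angle_def \<psi>_def)
      also have "\<dots> = cis (2 * (edge_angle P i + \<psi> i))"
        by (simp add: cis_mult distrib_left)
      finally show ?thesis .
    qed
    then have "cis (2 * alternating_sum (edge_angle ?Q) es) =
        cis (2 * alternating_sum (\<lambda>i. edge_angle P i + \<psi> i) es)"
      using es by (intro cis_alternating_sum_cong) auto
    also have "\<dots> = cis (2 * alternating_sum (edge_angle P) es) * cis (2 * alternating_sum \<psi> es)"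
      by (simp add: alternating_sum_add cis_mult distrib_left)
    finally have c1: "cis (2 * alternating_sum \<psi> es) = 1"
      using elim(2) P1 by simp
    have "alternating_sum \<psi> es = (\<Sum>i<n. of_int (signed_count i es) * \<psi> i)"
      by (rule alternating_sum_real[OF es])
    also have "\<dots> = (\<Sum>i\<in>{j, k}. of_int (signed_count i es) * \<psi> i)"
      using j successor_index d by (intro sum.mono_neutral_right) (auto simp: \<psi>_def edge_dir_move_vertex Arg_eq_0)
    also have "\<dots> = ?S \<delta>"
      using j successor_index d[OF j] d[OF successor_index(1)] by (simp add: \<psi>_def edge_dir_move_vertex add_divide_distrib diff_divide_distrib)
    finally show ?case
      using cis_eq_1_small[of "2 * ?S \<delta>"] c1 elim(1) by simp
  qed
qed

text \<open>A displacement along edge \<open>k\<close> leaves the direction of \<open>k\<close>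
  alone, so a nonzero count at \<open>j\<close> forces the edges to be parallel. A perpendicular
  displacement then turns them in opposite senses, and the total can vanish only if the counts have
  equal sign.\<close>

lemma signed_count_same_sign:
  assumes es: "set es \<subseteq> {..<n}" and ev: "\<forall>\<^sub>F Q in near P. cis (2 * alternating_sum (edge_angle Q) es) = 1"
    and cj: "signed_count j es \<noteq> 0"
  shows "sgn (signed_count k es) = sgn (signed_count j es)"
proof -
  let ?dj = "edge_dir P j" and ?dk = "edge_dir P k"
  define \<zeta> where "\<zeta> = ?dk / ?dj"
  have d: "?dj \<noteq> 0" "?dk \<noteq> 0"
    using edge_dir_neq_0[OF ngon] j successor_index by auto
  have along: "\<exists>s::real. 0 < s \<and> s < 1 \<and>
      of_int (signed_count j es) * Arg (1 + of_real s * v / ?dj) +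
      of_int (signed_count k es) * Arg (1 - of_real s * v / ?dk) = 0" for v
  proof -
    have "((\<lambda>s. of_real s * v) \<longlongrightarrow> of_real 0 * v) (at_right (0::real))"
      by (intro tendsto_intros)
    then have "filterlim (\<lambda>s. of_real s * v) (nhds 0) (at_right (0::real))"
      by simp
    then have "\<forall>\<^sub>F s in at_right (0::real). of_int (signed_count j es) * Arg (1 + of_real s * v / ?dj) +
      of_int (signed_count k es) * Arg (1 - of_real s * v / ?dk) = 0"
      using angle_variation[OF es ev] unfolding filterlim_iff by blast
    moreover have "\<forall>\<^sub>F s in at_right (0::real). 0 < s \<and> s < 1"
      unfolding eventually_at_right_field by (intro exI[of _ 1]) auto
    ultimately have "\<forall>\<^sub>F s in at_right (0::real). 0 < s \<and> s < 1 \<and>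
       of_int (signed_count j es) * Arg (1 + of_real s * v / ?dj) +
       of_int (signed_count k es) * Arg (1 - of_real s * v / ?dk) = 0"
      by eventually_elim auto
    then show ?thesis
      by (rule eventually_happens'[rotated]) simp
  qed
  obtain s where s: "0 < s" "s < 1" "of_int (signed_count j es) * Arg (1 + of_real s * ?dk / ?dj) +
      of_int (signed_count k es) * Arg (1 - of_real s * ?dk / ?dk) = 0"
    using along[of ?dk] by blast
  have "Arg (1 - of_real s * ?dk / ?dk) = 0"
    using s(1,2) d by (simp add: Arg_eq_0)
  then have "Arg (1 + of_real s * \<zeta>) = 0"
    using s(3) cj by (simp add: \<zeta>_def)
  then have im: "Im \<zeta> = 0"
    using s(1) by (auto simp: Arg_eq_0 complex_is_Real_iff)
  \<comment> \<open>Adjacent edges do not fold back onto each other; this excludes a negative ratio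
    \<zeta>.\<close>
  have "(- ?dj) * cnj ?dk \<notin> \<real>\<^sub>\<ge>\<^sub>0"
    using adjacent_edges[OF ngon j k] k by (simp add: edge_dir_def ngon_length[OF ngon])
  moreover have "(- ?dj) * cnj ?dk = of_real (- Re \<zeta> * norm ?dj ^ 2)"
  proof -
    have "?dk = of_real (Re \<zeta>) * ?dj"
      using d im by (simp add: \<zeta>_def complex_is_Real_iff[symmetric])
    then have "(- ?dj) * cnj ?dk = - of_real (Re \<zeta>) * (?dj * cnj ?dj)"
      by simp
    also have "?dj * cnj ?dj = of_real (norm ?dj ^ 2)"
      by (metis complex_norm_square)
    finally show ?thesis
      by simp
  qed
  ultimately have "\<not> 0 \<le> - Re \<zeta> * norm ?dj ^ 2"
    by (metis nonneg_Reals_of_real_iff)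
  then have re: "Re \<zeta> > 0"
    by (smt (verit) mult_nonneg_nonneg zero_le_power2)
  \<comment> \<open>The displacement at right angles to both edges: edge \<open>j\<close> turns to
    the left since \<open>Re \<zeta>\<close> is positive, edge \<open>k\<close> to the
    right.\<close>
  obtain t where t: "0 < t" "t < 1" "of_int (signed_count j es) * Arg (1 + of_real t * (\<i> * ?dk) / ?dj) +
      of_int (signed_count k es) * Arg (1 - of_real t * (\<i> * ?dk) / ?dk) = 0"
    using along[of "\<i> * ?dk"] by blast
  define x where "x = Arg (1 + of_real t * (\<i> * ?dk) / ?dj)"
  define y where "y = Arg (1 - of_real t * (\<i> * ?dk) / ?dk)"
  have "1 + of_real t * (\<i> * ?dk) / ?dj = 1 + of_real t * \<i> * \<zeta>"
    by (simp add: \<zeta>_def)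
  then have x: "x > 0"
    using t(1) re unfolding x_def Arg_pos_iff by simp
  have "1 - of_real t * (\<i> * ?dk) / ?dk = 1 - of_real t * \<i>"
    using d by simp
  then have y: "y < 0"
    using t(1) unfolding y_def Arg_neg_iff by simp
  have eq: "of_int (signed_count j es) * x = of_int (signed_count k es) * (- y)"
    using t(3) by (simp add: x_def y_def)
  show ?thesis
  proof (cases "signed_count j es > 0")
    case True
    then have "0 < of_int (signed_count k es) * (- y)"
      unfolding eq[symmetric] using True x by simp
    then have "signed_count k es > 0"
      using y by (simp add: mult_less_0_iff)
    then show ?thesis
      using True by simp
  next
    case False
    then have "of_int (signed_count j es) * x < 0"
      using x cj by (simp add: mult_less_0_iff)
    then have "of_int (signed_count k es) * (- y) < 0"
      by (simp add: eq)
    then have "signed_count k es < 0"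
      using y by (simp add: zero_less_mult_iff)
    then show ?thesis
      using False cj by simp
  qed
qed

end

lemma balanced_if_near:
  assumes ngon: "ngon n P" and es: "set es \<subseteq> {..<n}" "even (length es)"
    and ev: "\<forall>\<^sub>F Q in near P. cis (2 * alternating_sum (edge_angle Q) es) = 1"
  shows "\<forall>i<n. signed_count i es = 0"
proof (rule ccontr)
  assume "\<not> ?thesis"
  then obtain i where i: "i < n" "signed_count i es \<noteq> 0"
    by blast
  have sg: "sgn (signed_count ((i + m) mod n) es) = sgn (signed_count i es)" for m
  proof (induction m)
    case 0
    then show ?case
      using i by simp
  next
    case (Suc m)
    have "(i + m) mod n < n"
      using i by simp
    moreover have "signed_count ((i + m) mod n) es \<noteq> 0"
      using Suc i by (metis sgn_0_0)
    ultimately have "sgn (signed_count (Suc ((i + m) mod n) mod n) es) = sgn (signed_count ((i + m) mod n) es)"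
      using signed_count_same_sign[OF ngon _ refl es(1) ev] by blast
    then show ?case
      using Suc by (simp add: mod_Suc_eq)
  qed
  have all: "sgn (signed_count l es) = sgn (signed_count i es)" if "l < n" for l
    using sg[of "n - i + l"] that i by simp
  \<comment> \<open>Multiplying by the common sign makes every summand positive, against the
    vanishing total.\<close>
  have "(\<Sum>l<n. sgn (signed_count i es) * signed_count l es) = 0"
    using sum_signed_count[OF es] by (simp flip: sum_distrib_left)
  moreover have "sgn (signed_count i es) * signed_count l es > 0" if "l < n" for l
    using all[OF that] i(2) by (metis abs_sgn mult.commute sgn_0_0 zero_less_abs_iff)
  then have "(\<Sum>l<n. sgn (signed_count i es) * signed_count l es) > 0"
    using i by (intro sum_pos) auto
  ultimately show False
    by simp
qed

text \<open>Transfer to a nearby polygon yields a translation for some rotation of the itinerary.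
  Rotating changes the alternating angle sum at most by a sign, and \<open>cis x = 1\<close> is
  insensitive to that.\<close>

lemma stable_imp_balanced:
  assumes ngon: "ngon n P" and f: "periodic_trajectory P f" and st: "stable_trajectory P f"
  shows "\<forall>i<n. signed_count i (itinerary P f 1) = 0"
proof -
  let ?es = "itinerary P f 1"
  have traj: "trajectory P f" and tr: "is_translation (develop P ?es)"
    using f by (auto simp: periodic_trajectory_def)
  have es: "set ?es \<subseteq> {..<n}"
    using set_itinerary[OF ngon traj] .
  have trans: "is_translation (develop Q es) \<longleftrightarrow> even (length es) \<and> cis (2 * alternating_sum (edge_angle Q) es) = 1"
    if "ngon n Q" "set es \<subseteq> {..<n}" for Q es
    using that edge_dir_neq_0[OF that(1)] by (intro is_translation_develop_iff) auto
  have ev: "even (length ?es)"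
    using trans[OF ngon es] tr by blast
  obtain \<epsilon> where \<epsilon>: "\<epsilon> > 0" "\<And>Q. ngon n Q \<Longrightarrow> \<forall>i<n. dist (P ! i) (Q ! i) < \<epsilon> \<Longrightarrow> \<exists>g. transfer_to P f Q g"
    using st unfolding stable_trajectory_def ngon_length[OF ngon] by blast
  have near: "cis (2 * alternating_sum (edge_angle Q) ?es) = 1"
    if Q: "ngon n Q" "\<forall>i<n. dist (P ! i) (Q ! i) < \<epsilon>" for Q
  proof -
    obtain g s where "transfer_based P (\<lambda>t. f (s + t)) Q g"
      using \<epsilon>(2)[OF Q] by (auto simp: transfer_to_def)
    then have t: "is_translation (develop Q (itinerary P (\<lambda>t. f (s + t)) 1))"
      by (auto simp: transfer_based_def Let_def)
    obtain A B where AB: "?es = A @ B" "itinerary P (\<lambda>t. f (s + t)) 1 = B @ A"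
      using itinerary_rotation[OF ngon traj periodic_trajectory_period[OF ngon f]] by metis
    have "cis (2 * alternating_sum (edge_angle Q) (B @ A)) = 1"
      using trans[OF Q(1) set_itinerary[OF ngon trajectory_shift[OF traj, of s], where t = 1]] t unfolding AB by blast
    moreover have "alternating_sum (edge_angle Q) (B @ A) = alternating_sum (edge_angle Q) ?es \<or>
        alternating_sum (edge_angle Q) (B @ A) = - alternating_sum (edge_angle Q) ?es"
      using alternating_sum_rotation[of A B "edge_angle Q"] ev AB by simp
    ultimately show ?thesis
      by (auto simp: cis_cnj[symmetric] complex_eq_iff)
  qed
  have "\<forall>\<^sub>F Q in near P. \<forall>i<n. dist (P ! i) (Q ! i) < \<epsilon>"
    unfolding eventually_near using \<epsilon>(1) ngon_length[OF ngon] by auto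
  then have "\<forall>\<^sub>F Q in near P. cis (2 * alternating_sum (edge_angle Q) ?es) = 1"
    using eventually_near_ngon[OF ngon] by eventually_elim (use near in blast)
  then show ?thesis
    by (rule balanced_if_near[OF ngon es ev])
qed

subsection \<open>Persistence of the trajectory\<close>

lemma develop_rev_develop:
  assumes "\<And>e. e \<in> set es \<Longrightarrow> edge_dir P e \<noteq> 0"
  shows "develop P (rev es) (develop P es z) = z"
  using assms by (induction es arbitrary: z) (auto simp: develop_append reflect_involution)

lemma develop_develop_rev:
  assumes "\<And>e. e \<in> set es \<Longrightarrow> edge_dir P e \<noteq> 0"
  shows "develop P es (develop P (rev es) z) = z"
  using develop_rev_develop[of "rev es" P z] assms by simp

lemma develop_dir_eq_0:
  assumes "\<And>e. e \<in> set es \<Longrightarrow> edge_dir P e \<noteq> 0"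
  shows "develop_dir P es u = 0 \<longleftrightarrow> u = 0"
  using assms by (induction es) auto

text \<open>The line \<open>a + t * v\<close> in the unfolding, folded back from copy
  \<open>k\<close> to \<open>Q\<close> itself. The inverse of the unfolding map is obtained by
  reversing the word, as reflections are involutions.\<close>

definition chord :: "complex list \<Rightarrow> nat list \<Rightarrow> complex \<Rightarrow> complex \<Rightarrow> nat \<Rightarrow> real \<Rightarrow> complex" where
  "chord Q es a v k t = develop Q (rev (take k es)) (a + of_real t * v)"

definition chord_dir :: "complex list \<Rightarrow> nat list \<Rightarrow> complex \<Rightarrow> nat \<Rightarrow> complex" where
  "chord_dir Q es v k = develop_dir Q (rev (take k es)) v"

lemma chord_affine: "chord Q es a v k (t + h) = chord Q es a v k t + of_real h * chord_dir Q es v k"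
proof -
  have "a + of_real (t + h) * v = (a + of_real t * v) + of_real h * v"
    by (simp add: algebra_simps)
  then show ?thesis
    unfolding chord_def chord_dir_def by (simp only: develop_add develop_dir_of_real)
qed

lemma chord_affine': "chord Q es a v k s = chord Q es a v k t + of_real (s - t) * chord_dir Q es v k"
  using chord_affine[of Q es a v k t "s - t"] by simp

lemma chord_Suc: "k < length es \<Longrightarrow> chord Q es a v (Suc k) t = reflect Q (es ! k) (chord Q es a v k t)"
  by (simp add: chord_def take_Suc_conv_app_nth)

lemma chord_dir_Suc: "k < length es \<Longrightarrow> chord_dir Q es v (Suc k) = reflect_dir Q (es ! k) (chord_dir Q es v k)"
  by (simp add: chord_dir_def take_Suc_conv_app_nth)

text \<open>Data under which a straight line in the unfolding folds up to a periodic trajectory: the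
  chord \<open>k\<close> runs inside \<open>Q\<close> from time \<open>\<tau> k\<close> until it
  hits the prescribed edge at \<open>\<tau> (Suc k)\<close>, and the whole word acts as the
  translation along the line.\<close>

locale closed_chords =
  fixes n Q es a v and \<tau> :: "nat \<Rightarrow> real"
  assumes ngon: "ngon n Q" and es: "es \<noteq> []" "set es \<subseteq> {..<n}" and v: "v \<noteq> 0"
    and \<tau>: "\<tau> 0 = 0" "\<tau> (length es) = 1" "\<And>k. k < length es \<Longrightarrow> \<tau> k < \<tau> (Suc k)"
    and chord_inside: "\<And>k t. k < length es \<Longrightarrow> \<tau> k < t \<Longrightarrow> t < \<tau> (Suc k) \<Longrightarrow>
       chord Q es a v k t \<in> inside (boundary Q)"
    and chord_end: "\<And>k. k < length es \<Longrightarrow> chord Q es a v k (\<tau> (Suc k)) \<in> edge Q (es ! k)"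
      "\<And>k. k < length es \<Longrightarrow> chord Q es a v k (\<tau> (Suc k)) \<notin> set Q"
    and translation: "\<And>z. develop Q es z = z + v"
begin

abbreviation m where "m \<equiv> length es"

text \<open>The number of joints passed by time \<open>x\<close>, which is the index of the current
  chord. At a joint the later chord is taken, in agreement with right continuity of
  itineraries.\<close>

definition piece :: "real \<Rightarrow> nat" where
  "piece x = card {k \<in> {1..m}. \<tau> k \<le> x}"

definition bounce :: "real \<Rightarrow> complex" where
  "bounce t = chord Q es a v (piece (frac t)) (frac t)"

lemma m_pos: "0 < m"
  using es(1) by simp

lemma edge_dir_es: "e \<in> set es \<Longrightarrow> edge_dir Q e \<noteq> 0"
  using es(2) edge_dir_neq_0[OF ngon] by auto

lemma edge_dir_nth: "k < m \<Longrightarrow> edge_dir Q (es ! k) \<noteq> 0"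
  by (simp add: edge_dir_es)

lemma edge_index: "k < m \<Longrightarrow> es ! k < n"
  using es(2) nth_mem by blast

lemma \<tau>_less: "i < j \<Longrightarrow> j \<le> m \<Longrightarrow> \<tau> i < \<tau> j"
proof (induction j)
  case (Suc j)
  then show ?case
    using \<tau>(3)[of j] by (cases "i = j") auto
qed simp

lemma \<tau>_le: "i \<le> j \<Longrightarrow> j \<le> m \<Longrightarrow> \<tau> i \<le> \<tau> j"
  using \<tau>_less[of i j] by (cases "i = j") auto

lemma piece_eq:
  assumes "k < m" "\<tau> k \<le> x" "x < \<tau> (Suc k)"
  shows "piece x = k"
proof -
  have "{l \<in> {1..m}. \<tau> l \<le> x} = {1..k}"
  proof (intro equalityI subsetI)
    fix l assume l: "l \<in> {l \<in> {1..m}. \<tau> l \<le> x}"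
    have "\<not> Suc k \<le> l"
      using \<tau>_le[of "Suc k" l] l assms(3) by auto
    then show "l \<in> {1..k}"
      using l by auto
  next
    fix l assume l: "l \<in> {1..k}"
    then show "l \<in> {l \<in> {1..m}. \<tau> l \<le> x}"
      using \<tau>_le[of l k] assms by auto
  qed
  then show ?thesis
    by (simp add: piece_def)
qed

lemma find_piece:
  assumes "0 \<le> x" "x < 1"
  obtains k where "k < m" "\<tau> k \<le> x" "x < \<tau> (Suc k)"
proof -
  define k where "k = (GREATEST k. k \<le> m \<and> \<tau> k \<le> x)"
  have k: "k \<le> m \<and> \<tau> k \<le> x"
    unfolding k_def by (rule GreatestI_nat[of _ 0 m]) (use \<tau>(1) assms in auto)
  have "k < m"
    using k \<tau>(2) assms by (cases "k = m") auto
  moreover have "x < \<tau> (Suc k)"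
  proof (rule ccontr)
    assume "\<not> ?thesis"
    then have "Suc k \<le> k"
      unfolding k_def using \<open>k < m\<close>[unfolded k_def] by (intro Greatest_le_nat[of _ _ m]) auto
    then show False
      by simp
  qed
  ultimately show ?thesis
    using that k by blast
qed

lemma chord_joint: "k < m \<Longrightarrow> chord Q es a v (Suc k) (\<tau> (Suc k)) = chord Q es a v k (\<tau> (Suc k))"
  using chord_end(1)[of k] edge_dir_nth[of k] by (simp add: chord_Suc reflect_edge)

lemma chord_0: "chord Q es a v 0 t = a + of_real t * v"
  by (simp add: chord_def)

text \<open>The word unfolds to the translation by \<open>v\<close>, so folding the line back after
  a full period gives the first chord again, one unit of time later. This closes the
  trajectory.\<close>

lemma chord_m: "chord Q es a v m t = chord Q es a v 0 (t - 1)"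
proof -
  have "a + of_real t * v = develop Q es (a + of_real (t - 1) * v)"
    by (simp add: translation algebra_simps)
  then show ?thesis
    using develop_rev_develop[OF edge_dir_es] by (simp add: chord_def)
qed

lemma chord_dir_m: "chord_dir Q es v m = v"
proof -
  have "chord Q es a v m 1 = chord Q es a v m 0 + of_real 1 * chord_dir Q es v m"
    using chord_affine[of Q es a v m 0 1] by simp
  then show ?thesis
    by (simp add: chord_m chord_0)
qed

lemma chord_last: "chord Q es a v (m - 1) 1 = a"
proof -
  have "chord Q es a v m 1 = chord Q es a v (m - 1) 1"
    using chord_joint[of "m - 1"] m_pos \<tau>(2) by simp
  then show ?thesis
    by (simp add: chord_m chord_0)
qed

lemma bounce_eq:
  assumes "k < m" "\<tau> k \<le> frac t" "frac t < \<tau> (Suc k)"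
  shows "bounce t = chord Q es a v k (frac t)"
  using piece_eq[OF assms] by (simp add: bounce_def)

lemma bounce_right:
  assumes k: "k < m" "\<tau> k \<le> frac t" "frac t < \<tau> (Suc k)"
  shows "affine_right bounce t (chord_dir Q es v k)"
proof (rule affine_rightI[of "\<tau> (Suc k) - frac t"])
  fix s assume s: "t \<le> s" "s < t + (\<tau> (Suc k) - frac t)"
  have "\<tau> (Suc k) \<le> 1"
    using \<tau>_le[of "Suc k" m] k(1) \<tau>(2) by simp
  then have "0 \<le> frac t + (s - t)" "frac t + (s - t) < 1"
    using s frac_ge_0[of t] by linarith+
  moreover have "s - (frac t + (s - t)) \<in> \<int>"
    by (simp add: frac_def)
  ultimately have fs: "frac s = frac t + (s - t)"
    by (simp add: frac_unique_iff)
  have "bounce s = chord Q es a v k (frac t + (s - t))"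
    using bounce_eq[of k s] fs s k by simp
  then show "bounce s = bounce t + of_real (s - t) * chord_dir Q es v k"
    using bounce_eq[OF k] chord_affine by simp
qed (use k in simp)

lemma bounce_left:
  assumes k: "k < m" "\<tau> k < x" "x \<le> \<tau> (Suc k)" and t: "t = of_int z + x"
    and bt: "bounce t = chord Q es a v k x"
  shows "affine_left bounce t (chord_dir Q es v k)"
proof (rule affine_leftI[of "x - \<tau> k"])
  fix s assume s: "t - (x - \<tau> k) < s" "s \<le> t"
  have \<tau>1: "\<tau> (Suc k) \<le> 1" "0 \<le> \<tau> k"
    using \<tau>_le[of "Suc k" m] \<tau>_le[of 0 k] k(1) \<tau>(1,2) by simp_all
  show "bounce s = bounce t + of_real (s - t) * chord_dir Q es v k"
  proof (cases "s = t")
    case False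
    have fs: "frac s = x + (s - t)"
      using s False t \<tau>1 k by (intro frac_unique_iff[THEN iffD2]) auto
    have "bounce s = chord Q es a v k (x + (s - t))"
      using bounce_eq[of k s] fs s False k by simp
    then show ?thesis
      using bt chord_affine by simp
  qed simp
qed (use k in simp)

lemma bounce_cases:
  obtains (interior) k where "k < m" "bounce t \<in> inside (boundary Q)"
      "affine_left bounce t (chord_dir Q es v k)" "affine_right bounce t (chord_dir Q es v k)"
  | (joint) k where "k < m" "bounce t = chord Q es a v k (\<tau> (Suc k))"
      "affine_left bounce t (chord_dir Q es v k)" "affine_right bounce t (chord_dir Q es v (Suc k))"
proof -
  have fr: "t = of_int \<lfloor>t\<rfloor> + frac t"
    by (simp add: frac_def)
  obtain k where k: "k < m" "\<tau> k \<le> frac t" "frac t < \<tau> (Suc k)"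
    using find_piece[of "frac t"] frac_lt_1[of t] by auto
  note right = bounce_right[OF k]
  consider "\<tau> k < frac t" | "frac t = \<tau> k" "0 < k" | "frac t = \<tau> k" "k = 0"
    using k(2) by linarith
  then show ?thesis
  proof cases
    case 1
    have "affine_left bounce t (chord_dir Q es v k)"
      by (rule bounce_left[OF k(1) 1 _ fr]) (use k bounce_eq[OF k] in auto)
    moreover have "bounce t \<in> inside (boundary Q)"
      using chord_inside[OF k(1) 1 k(3)] bounce_eq[OF k] by simp
    ultimately show ?thesis
      using interior k(1) right by blast
  next
    case 2
    define l where "l = k - 1"
    have l: "k = Suc l" "l < m"
      using 2 k by (auto simp: l_def)
    have b: "bounce t = chord Q es a v l (\<tau> (Suc l))"
      using bounce_eq[OF k] chord_joint[OF l(2)] 2 l by simp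
    have "affine_left bounce t (chord_dir Q es v l)"
      by (rule bounce_left[OF l(2) _ _ fr]) (use \<tau>(3)[OF l(2)] 2 l b in auto)
    then show ?thesis
      using joint[OF l(2) b] right l by simp
  next
    \<comment> \<open>An integer time: the motion leaves along chord 0 and arrives along the last
      chord of the preceding period, at parameter 1 rather than 0.\<close>
    case 3
    define l where "l = m - 1"
    have l: "m = Suc l" "l < m"
      using m_pos by (auto simp: l_def)
    have b: "bounce t = chord Q es a v l (\<tau> (Suc l))"
      using bounce_eq[OF k] 3 \<tau>(1,2) chord_last l by (simp add: chord_0)
    have "affine_left bounce t (chord_dir Q es v l)"
    proof (rule bounce_left[OF l(2)])
      show "t = of_int (\<lfloor>t\<rfloor> - 1) + \<tau> (Suc l)"
        using fr 3 \<tau>(1,2) l by simp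
    qed (use \<tau>(3)[OF l(2)] b in auto)
    moreover have "chord_dir Q es v (Suc l) = chord_dir Q es v k"
      using chord_dir_m l 3 by (simp add: chord_dir_def)
    ultimately show ?thesis
      using joint[OF l(2) b] right by simp
  qed
qed

lemma chord_dir_neq_0: "chord_dir Q es v k \<noteq> 0"
proof -
  have "develop_dir Q (rev (take k es)) v = 0 \<longleftrightarrow> v = 0"
    by (rule develop_dir_eq_0) (use edge_dir_es in_set_takeD in fastforce)
  then show ?thesis
    using v by (simp add: chord_dir_def)
qed

lemma trajectory_bounce: "trajectory Q bounce"
  unfolding trajectory_iff
proof
  fix t
  show "bounce t \<in> region Q \<and> bounce t \<notin> set Q \<and> (\<exists>u w. u \<noteq> 0 \<and> affine_left bounce t u \<and>
      affine_right bounce t w \<and> (bounce t \<notin> boundary Q \<longrightarrow> w = u) \<and>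
      (\<forall>i<length Q. bounce t \<in> edge Q i \<longrightarrow> w = reflect_dir Q i u))"
  proof (cases rule: bounce_cases[of t])
    case (interior k)
    have nb: "bounce t \<notin> boundary Q"
      using interior(2) by (rule not_inside_self)
    then have "\<forall>i<length Q. bounce t \<notin> edge Q i" "bounce t \<notin> set Q"
      using set_subset_boundary[OF ngon] edge_subset_boundary[of _ Q] by blast+
    moreover have "bounce t \<in> region Q"
      using interior(2) by (simp add: region_def)
    ultimately show ?thesis
      using interior(3,4) chord_dir_neq_0[of k] by blast
  next
    case (joint k)
    have e: "bounce t \<in> edge Q (es ! k)" "bounce t \<notin> set Q"
      using chord_end joint by auto
    then have b: "bounce t \<in> boundary Q"
      using edge_subset_boundary[of "es ! k" Q] edge_index[OF joint(1)] ngon_length[OF ngon] by auto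
    have "chord_dir Q es v (Suc k) = reflect_dir Q i (chord_dir Q es v k)"
      if "i < length Q" "bounce t \<in> edge Q i" for i
      using unique_edge[OF ngon e(2) that(2) e(1)] that(1) edge_index[OF joint(1)] chord_dir_Suc[OF joint(1)]
      by (simp add: ngon_length[OF ngon])
    moreover have "bounce t \<in> region Q"
      using b by (simp add: region_def)
    ultimately show ?thesis
      using joint(3,4) chord_dir_neq_0[of k] e(2) b by blast
  qed
qed

lemma bounce_on_unit:
  assumes "k < m" "\<tau> k \<le> t" "t < \<tau> (Suc k)"
  shows "bounce t = chord Q es a v k t"
proof -
  have "\<tau> (Suc k) \<le> 1" "0 \<le> \<tau> k"
    using \<tau>_le[of "Suc k" m] \<tau>_le[of 0 k] assms(1) \<tau>(1,2) by simp_all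
  then have "frac t = t"
    using assms by (simp add: frac_eq)
  then show ?thesis
    using bounce_eq[of k t] assms by simp
qed

lemma bounce_joint:
  assumes "k < m"
  shows "bounce (\<tau> (Suc k)) = chord Q es a v k (\<tau> (Suc k))"
proof (cases "Suc k = m")
  case True
  have "bounce 1 = chord Q es a v 0 0"
    using bounce_eq[of 0 1] \<tau>(1) \<tau>(3)[of 0] m_pos by simp
  moreover have "k = m - 1"
    using True by simp
  ultimately show ?thesis
    using chord_last True \<tau>(2) by (simp add: chord_0)
next
  case False
  then have "Suc k < m"
    using assms by simp
  then show ?thesis
    using bounce_on_unit[of "Suc k" "\<tau> (Suc k)"] \<tau>(3)[of "Suc k"] chord_joint[OF assms] by simp
qed

lemma itinerary_\<tau>: "k \<le> m \<Longrightarrow> itinerary Q bounce (\<tau> k) = take k es"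
proof (induction k)
  case 0
  then show ?case
    using itinerary_0[OF ngon trajectory_bounce] \<tau>(1) by simp
next
  case (Suc k)
  then have k: "k < m"
    by simp
  have "itinerary Q bounce (\<tau> (Suc k)) = itinerary Q bounce (\<tau> k) @ [es ! k]"
  proof (rule itinerary_snoc[OF ngon trajectory_bounce])
    show "0 \<le> \<tau> k" "\<tau> k < \<tau> (Suc k)" "es ! k < n" "bounce (\<tau> (Suc k)) \<in> edge Q (es ! k)"
      using \<tau>_le[of 0 k] \<tau>(1) \<tau>(3)[OF k] k edge_index[OF k] chord_end(1)[OF k] bounce_joint[OF k] by simp_all
    show "bounce s \<notin> boundary Q" if "\<tau> k < s" "s < \<tau> (Suc k)" for s
      using bounce_on_unit[OF k, of s] chord_inside[OF k that] that not_inside_self by simp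
  qed
  then show ?case
    using Suc k by (simp add: take_Suc_conv_app_nth)
qed

lemma itinerary_1: "itinerary Q bounce 1 = es"
  using itinerary_\<tau>[of m] \<tau>(2) by simp

lemma itinerary_between:
  assumes k: "k < m" and t: "\<tau> k \<le> t" "t < \<tau> (Suc k)"
  shows "itinerary Q bounce t = take k es"
proof -
  have "itinerary Q bounce t = itinerary Q bounce (\<tau> k)"
  proof (rule itinerary_const[OF ngon trajectory_bounce t(1)])
    show "bounce s \<notin> boundary Q" if "\<tau> k < s" "s \<le> t" for s
      using bounce_on_unit[OF k, of s] chord_inside[OF k, of s] that t not_inside_self by simp
  qed
  then show ?thesis
    using itinerary_\<tau>[of k] k by simp
qed

lemma unfolded_bounce:
  assumes "t \<in> {0..1}"
  shows "unfolded_path Q bounce t = a + of_real t * v"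
    and "unfolded_path Q bounce t \<in> unfolding_region Q es"
proof -
  have reg: "bounce t \<in> region Q"
    using trajectory_bounce by (simp add: trajectory_iff)
  have "\<exists>k\<le>m. itinerary Q bounce t = take k es \<and> unfolded_path Q bounce t = a + of_real t * v"
  proof (cases "t = 1")
    case True
    have "bounce 1 = a"
      using bounce_joint[of "m - 1"] m_pos \<tau>(2) chord_last by simp
    then have "itinerary Q bounce t = take m es \<and> unfolded_path Q bounce t = a + of_real t * v"
      using True by (simp add: unfolded_path_def itinerary_1 translation)
    then show ?thesis
      by blast
  next
    case False
    then obtain k where k: "k < m" "\<tau> k \<le> t" "t < \<tau> (Suc k)"
      using find_piece[of t] assms by auto
    have "unfolded_path Q bounce t = a + of_real t * v"
      unfolding unfolded_path_def itinerary_between[OF k] bounce_on_unit[OF k] chord_def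
      by (rule develop_develop_rev) (use edge_dir_es in_set_takeD in fastforce)
    then show ?thesis
      using itinerary_between[OF k] k(1) by (intro exI[of _ k]) simp
  qed
  then obtain k where k: "k \<le> m" "itinerary Q bounce t = take k es" "unfolded_path Q bounce t = a + of_real t * v"
    by blast
  then show "unfolded_path Q bounce t = a + of_real t * v"
    by simp
  show "unfolded_path Q bounce t \<in> unfolding_region Q es"
    unfolding unfolding_region_def unfolded_path_def k(2) using k(1) reg by blast
qed

lemma periodic_trajectory_bounce: "periodic_trajectory Q bounce"
proof -
  have z: "\<tau> 0 \<le> frac 0" "frac 0 < \<tau> (Suc 0)" "\<tau> 0 \<le> frac 1" "frac 1 < \<tau> (Suc 0)"
    using \<tau>(1) \<tau>(3)[OF m_pos] by simp_all
  have "affine_right bounce 0 (chord_dir Q es v 0)" "affine_right bounce 1 (chord_dir Q es v 0)"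
    using bounce_right[OF m_pos z(1,2)] bounce_right[OF m_pos z(3,4)] by simp_all
  moreover have "bounce 0 = bounce 1"
    by (simp add: bounce_def)
  moreover have "is_translation (develop Q (itinerary Q bounce 1))"
    using translation by (auto simp: itinerary_1 is_translation_def)
  ultimately show ?thesis
    unfolding periodic_trajectory_def
    using trajectory_bounce affine_right_has_vector_derivative by blast
qed

end

section \<open>Continuous dependence on the polygon\<close>

lemma dist_edge_point:
  assumes "dist (P ! i) (Q ! i) < \<epsilon>" "dist (P ! (Suc i mod length P)) (Q ! (Suc i mod length Q)) < \<epsilon>" "r \<in> {0..1}"
  shows "dist (edge_point P i r) (edge_point Q i r) < \<epsilon>"
proof -
  let ?x = "P ! i - Q ! i" and ?y = "P ! (Suc i mod length P) - Q ! (Suc i mod length Q)"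
  have "edge_point P i r - edge_point Q i r = (1 - r) *\<^sub>R ?x + r *\<^sub>R ?y"
    by (simp add: edge_point_def linepath_def algebra_simps)
  also have "norm \<dots> \<le> (1 - r) * norm ?x + r * norm ?y"
    using norm_triangle_ineq[of "(1 - r) *\<^sub>R ?x" "r *\<^sub>R ?y"] assms(3) by simp
  also have "\<dots> < \<epsilon>"
    using assms by (intro convex_bound_lt) (auto simp: dist_norm)
  finally show ?thesis
    by (simp add: dist_norm)
qed

text \<open>Both boundaries carry the same parametrization over the labelled edges, so closeness of
  the vertices gives uniform closeness of the curves.\<close>

lemma dist_polygon_path:
  assumes P: "ngon n P" and Q: "ngon n Q" and d: "\<forall>i<n. dist (P ! i) (Q ! i) < \<epsilon>" and t: "t \<in> {0..1}"
  shows "dist (polygon_path n P t) (polygon_path n Q t) < \<epsilon>"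
proof (cases "t = 1")
  case True
  then show ?thesis
    using d ngon_ge_3[OF P] by (simp add: polygon_path_ends[OF P] polygon_path_ends[OF Q])
next
  case False
  then obtain j where j: "j < n" "real n * t \<in> {real j..<real (Suc j)}"
    using unit_interval_piece[OF P, of t] t by auto
  have "Suc j mod n < n"
    using j by simp
  then have "dist (edge_point P j (real n * t - real j)) (edge_point Q j (real n * t - real j)) < \<epsilon>"
    using d j by (intro dist_edge_point) (auto simp: ngon_length[OF P] ngon_length[OF Q])
  then show ?thesis
    using polygon_path_eq[OF P j(1), of t] polygon_path_eq[OF Q j(1), of t] j(2) by simp
qed

lemma eventually_near_dist:
  "\<epsilon> > 0 \<Longrightarrow> \<forall>\<^sub>F Q in near P. \<forall>i<length P. dist (P ! i) (Q ! i) < \<epsilon>"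
  unfolding eventually_near by auto

text \<open>A nearby boundary curve has the same nonzero winding number about \<open>z0\<close>, so
  \<open>z0\<close> is inside \<open>Q\<close> too; \<open>z Q\<close> lies in a ball about
  \<open>z0\<close> that the new boundary does not meet.\<close>

lemma eventually_near_inside:
  assumes P: "ngon n P" and z0: "z0 \<in> inside (boundary P)" and z: "(z \<longlongrightarrow> z0) (near P)"
  shows "\<forall>\<^sub>F Q in near P. z Q \<in> inside (boundary Q)"
proof -
  have "open (- boundary P)" "z0 \<in> - boundary P"
    using closed_boundary not_inside_self[OF z0] by (auto simp: open_Compl)
  then obtain \<rho> where \<rho>: "\<rho> > 0" "ball z0 \<rho> \<subseteq> - boundary P"
    by (meson open_contains_ball)
  have far: "\<rho> \<le> dist z0 x" if "x \<in> boundary P" for x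
    using \<rho>(2) that by (force simp: subset_iff)
  have "\<forall>\<^sub>F Q in near P. \<forall>i<n. dist (P ! i) (Q ! i) < \<rho> / 2"
    using eventually_near_dist[of "\<rho> / 2" P] \<rho>(1) by (simp add: ngon_length[OF P])
  moreover have "\<forall>\<^sub>F Q in near P. dist (z Q) z0 < \<rho> / 2"
    using tendstoD[OF z, of "\<rho> / 2"] \<rho>(1) by simp
  ultimately show ?thesis
    using eventually_near_ngon[OF P]
  proof eventually_elim
    case (elim Q)
    note Q = elim(3)
    let ?p = "polygon_path n P" and ?q = "polygon_path n Q"
    have pq: "dist (?p t) (?q t) < \<rho> / 2" if "t \<in> {0..1}" for t
      using dist_polygon_path[OF P Q elim(1) that] .
    have pz: "\<rho> \<le> dist z0 (?p t)" if "t \<in> {0..1}" for t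
    proof -
      have "?p t \<in> boundary P"
        using path_image_polygon_path[OF P] that unfolding path_image_def by blast
      then show ?thesis
        by (rule far)
    qed
    have qz: "\<rho> / 2 < dist z0 x" if x: "x \<in> boundary Q" for x
    proof -
      obtain t where t: "t \<in> {0..1}" "x = ?q t"
        using x path_image_polygon_path[OF Q] unfolding path_image_def by blast
      show ?thesis
        using pq[OF t(1)] pz[OF t(1)] dist_triangle[of z0 "?p t" "?q t"] t(2) by (simp add: dist_commute)
    qed
    have "winding_number ?q z0 = winding_number ?p z0"
    proof (rule winding_number_nearby_loops_eq)
      fix t :: real assume t: "t \<in> {0..1}"
      show "norm (?q t - ?p t) < norm (?p t - z0)"
        using pq[OF t] pz[OF t] \<rho>(1) by (simp add: dist_norm norm_minus_commute)
    qed (simp_all add: path_polygon_path[OF P] path_polygon_path[OF Q] loop_polygon_path[OF P] loop_polygon_path[OF Q])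
    moreover have "winding_number ?p z0 \<noteq> 0"
      by (rule simple_closed_path_winding_number_inside[OF simple_path_polygon_path[OF P]])
        (use z0 path_image_polygon_path[OF P] in simp_all)
    ultimately have "z0 \<notin> outside (boundary Q)"
      using winding_number_zero_in_outside[OF path_polygon_path[OF Q] loop_polygon_path[OF Q]]
        path_image_polygon_path[OF Q] by auto
    moreover have "z0 \<notin> boundary Q"
      using qz[of z0] \<rho>(1) by auto
    ultimately have z0Q: "z0 \<in> inside (boundary Q)"
      using inside_Un_outside[of "boundary Q"] by blast
    have "ball z0 (\<rho> / 2) \<inter> boundary Q = {}"
      using qz by fastforce
    moreover have "z0 \<in> ball z0 (\<rho> / 2)" "z Q \<in> ball z0 (\<rho> / 2)"
      using \<rho>(1) elim(2) by (auto simp: dist_commute)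
    ultimately show "z Q \<in> inside (boundary Q)"
      using connected_inside[OF Q connected_ball _ _ z0Q] by blast
  qed
qed

lemma tendsto_near_edge_point:
  assumes "i < length P"
  shows "((\<lambda>Q. edge_point Q i r) \<longlongrightarrow> edge_point P i r) (near P)"
  unfolding edge_point_eq using assms
  by (intro tendsto_intros tendsto_near_nth tendsto_near_edge_dir)

lemma tendsto_near_reflect_dir:
  assumes "i < length P" "edge_dir P i \<noteq> 0" "(u \<longlongrightarrow> u0) (near P)"
  shows "((\<lambda>Q. reflect_dir Q i (u Q)) \<longlongrightarrow> reflect_dir P i u0) (near P)"
  unfolding reflect_dir_eq using assms
  by (intro tendsto_intros tendsto_near_edge_dir) auto

lemma tendsto_near_reflect:
  assumes "i < length P" "edge_dir P i \<noteq> 0" "(u \<longlongrightarrow> u0) (near P)"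
  shows "((\<lambda>Q. reflect Q i (u Q)) \<longlongrightarrow> reflect P i u0) (near P)"
  unfolding reflect_def using assms
  by (intro tendsto_intros tendsto_near_reflect_dir tendsto_near_nth) auto

lemma tendsto_near_develop:
  assumes "\<And>e. e \<in> set es \<Longrightarrow> e < length P \<and> edge_dir P e \<noteq> 0" "(u \<longlongrightarrow> u0) (near P)"
  shows "((\<lambda>Q. develop Q es (u Q)) \<longlongrightarrow> develop P es u0) (near P)"
    and "((\<lambda>Q. develop_dir Q es (u Q)) \<longlongrightarrow> develop_dir P es u0) (near P)"
  using assms by (induction es) (auto intro: tendsto_near_reflect tendsto_near_reflect_dir)

lemma tendsto_near_side:
  assumes "i < length P" "(u \<longlongrightarrow> u0) (near P)"
  shows "((\<lambda>Q. side Q i (u Q)) \<longlongrightarrow> side P i u0) (near P)"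
  unfolding side_def using assms
  by (intro tendsto_intros tendsto_near_nth tendsto_near_edge_dir) auto

lemma side_chord:
  "side P i (chord P es a v k t) = side P i (chord P es a v k s) + (t - s) * Im (chord_dir P es v k * cnj (edge_dir P i))"
proof -
  have "side P i (chord P es a v k t) = side P i (chord P es a v k s + of_real (t - s) * chord_dir P es v k)"
    by (simp only: chord_affine'[symmetric])
  then show ?thesis
    by (simp add: side_add mult.assoc)
qed

lemma chord_segment:
  assumes "z \<in> closed_segment (chord P es a v k s) (chord P es a v k t)" "s \<le> t"
  obtains x where "x \<in> {s..t}" "z = chord P es a v k x"
proof -
  obtain u where u: "0 \<le> u" "u \<le> 1" "z = (1 - u) *\<^sub>R chord P es a v k s + u *\<^sub>R chord P es a v k t"
    using assms(1) by (auto simp: closed_segment_def)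
  have "chord P es a v k t = chord P es a v k s + of_real (t - s) * chord_dir P es v k"
    by (rule chord_affine')
  then have "z = chord P es a v k s + of_real (u * (t - s)) * chord_dir P es v k"
    unfolding u(3) by (simp only:) (simp add: scaleR_conv_of_real algebra_simps)
  also have "\<dots> = chord P es a v k (s + u * (t - s))"
    by (rule chord_affine[symmetric])
  finally have "z = chord P es a v k (s + u * (t - s))" .
  moreover have "0 \<le> u * (t - s)" "u * (t - s) \<le> t - s"
    using u mult_left_le_one_le[of "t - s" u] assms(2) by auto
  then have "s + u * (t - s) \<in> {s..t}"
    by auto
  ultimately show ?thesis
    using that by blast
qed

lemma closed_segment_chord:
  assumes "x \<in> {s..t}"
  shows "chord P es a v k x \<in> closed_segment (chord P es a v k s) (chord P es a v k t)"
proof (cases "s = t")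
  case False
  then have st: "s < t"
    using assms by auto
  define u where "u = (x - s) / (t - s)"
  have u: "0 \<le> u" "u \<le> 1" "u * (t - s) = x - s"
    using assms st by (auto simp: u_def)
  have 1: "chord P es a v k t = chord P es a v k s + of_real (t - s) * chord_dir P es v k"
    by (rule chord_affine')
  have "chord P es a v k x = chord P es a v k s + of_real (u * (t - s)) * chord_dir P es v k"
    unfolding u(3) by (rule chord_affine')
  then have "chord P es a v k x = (1 - u) *\<^sub>R chord P es a v k s + u *\<^sub>R chord P es a v k t"
    unfolding 1 by (simp only:) (simp add: scaleR_conv_of_real algebra_simps)
  then show ?thesis
    using u(1,2) unfolding closed_segment_def by blast
qed (use assms in auto)

section \<open>The given trajectory as a sequence of chords\<close>

locale closed_billiard =
  fixes n P f
  assumes ngon: "ngon n P" and traj: "trajectory P f" and per: "\<And>t. f (t + 1) = f t"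
    and start: "f 0 \<in> boundary P"
begin

definition es where "es = itinerary P f 1"

abbreviation m where "m \<equiv> length es"

text \<open>Strikes are collected on \<open>{0<..1}\<close>, which omits the one at time 0; it is
  added as number 0, so indices shift by one and strike \<open>m\<close> is the same point one
  period later.\<close>

definition strike :: "nat \<Rightarrow> real" where
  "strike k = (if k = 0 then 0 else strike_times P f 1 ! (k - 1))"

lemma length_strikes: "length (strike_times P f 1) = m"
  by (simp add: es_def itinerary_def)

lemma set_strikes: "set (strike_times P f 1) = {s \<in> {0<..1}. f s \<in> boundary P}"
  unfolding strike_times_def using finite_strikes_Ioc[OF ngon traj] by (rule set_sorted_list_of_set)

lemma strikes_less: "i < j \<Longrightarrow> j < m \<Longrightarrow> strike_times P f 1 ! i < strike_times P f 1 ! j"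
  using sorted_wrt_nth_less[OF strict_sorted_list_of_set[of "{s \<in> {0<..1}. f s \<in> boundary P}"], of i j] length_strikes
  by (simp add: strike_times_def)

lemma one_strike: "1 \<in> set (strike_times P f 1)"
  unfolding set_strikes using per[of 0] start by simp

lemma m_pos: "0 < m"
  using one_strike length_strikes by (metis length_pos_if_in_set)

lemma strike_0: "strike 0 = 0" and strike_Suc: "strike (Suc k) = strike_times P f 1 ! k"
  by (simp_all add: strike_def)

lemma strike_in:
  assumes "k < m"
  shows "0 < strike (Suc k)" "strike (Suc k) \<le> 1" "f (strike (Suc k)) \<in> boundary P"
  using nth_mem[of k "strike_times P f 1"] assms unfolding length_strikes set_strikes strike_Suc by auto

lemma strike_m: "strike m = 1"
proof -
  obtain j where j: "j < m" "strike_times P f 1 ! j = 1"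
    using one_strike length_strikes by (metis in_set_conv_nth)
  obtain l where l: "m = Suc l"
    using m_pos by (cases m) auto
  have "1 \<le> strike m"
    using strikes_less[of j l] j l by (cases "j = l") (auto simp: strike_Suc)
  moreover have "strike m \<le> 1"
    using strike_in(2)[of l] l by simp
  ultimately show ?thesis
    by simp
qed

lemma strike_less: "k < m \<Longrightarrow> strike k < strike (Suc k)"
  using strikes_less[of "k - 1" k] strike_in(1)[of k] by (cases k) (auto simp: strike_0 strike_Suc)

lemma strike_nonneg: "k \<le> m \<Longrightarrow> 0 \<le> strike k"
  using strike_in(1)[of "k - 1"] by (cases k) (auto simp: strike_0)

lemma between_strikes:
  assumes k: "k < m" and t: "strike k < t" "t < strike (Suc k)"
  shows "f t \<notin> boundary P"
proof
  assume "f t \<in> boundary P"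
  then have "t \<in> set (strike_times P f 1)"
    unfolding set_strikes using strike_nonneg[of k] strike_in(2)[OF k] k t by auto
  then obtain j where j: "j < m" "strike_times P f 1 ! j = t"
    using length_strikes by (metis in_set_conv_nth)
  show False
  proof (cases "j < k")
    case True
    then obtain l where l: "k = Suc l"
      by (cases k) auto
    then have "strike_times P f 1 ! j \<le> strike_times P f 1 ! l"
      using strikes_less[of j l] True k by (cases "j = l") auto
    then show False
      using t(1) j(2) l by (simp add: strike_Suc)
  next
    case False
    then have "strike_times P f 1 ! k \<le> strike_times P f 1 ! j"
      using strikes_less[of k j] j(1) by (cases "j = k") auto
    then show False
      using t(2) j(2) by (simp add: strike_Suc)
  qed
qed

lemma strike_edge:
  assumes k: "k < m"
  shows "es ! k < n" "f (strike (Suc k)) \<in> edge P (es ! k)"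
proof -
  obtain i where i: "i < n" "f (strike (Suc k)) \<in> edge P i"
    using boundary_edge[OF ngon traj strike_in(3)[OF k]] by blast
  have e: "es = map (\<lambda>s. THE i. i < length P \<and> f s \<in> edge P i) (strike_times P f 1)"
    by (simp add: es_def itinerary_def)
  have "k < length (strike_times P f 1)"
    using k length_strikes by simp
  then have "es ! k = (THE i. i < length P \<and> f (strike (Suc k)) \<in> edge P i)"
    unfolding strike_Suc by (subst e) (rule nth_map)
  then have "es ! k = i"
    using struck_edge[OF ngon traj i] by simp
  then show "es ! k < n" "f (strike (Suc k)) \<in> edge P (es ! k)"
    using i by auto
qed

lemma set_es: "set es \<subseteq> {..<n}"
  using strike_edge(1) by (auto simp: in_set_conv_nth)

lemma edge_dir_es: "e \<in> set es \<Longrightarrow> edge_dir P e \<noteq> 0"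
  using set_es edge_dir_neq_0[OF ngon] by auto

lemma itinerary_strike: "k \<le> m \<Longrightarrow> itinerary P f (strike k) = take k es"
proof (induction k)
  case 0
  then show ?case
    using itinerary_0[OF ngon traj] by (simp add: strike_0)
next
  case (Suc k)
  then have k: "k < m"
    by simp
  have "itinerary P f (strike (Suc k)) = itinerary P f (strike k) @ [es ! k]"
    using strike_nonneg[of k] strike_less[OF k] strike_edge[OF k] between_strikes[OF k] k
    by (intro itinerary_snoc[OF ngon traj]) auto
  then show ?case
    using Suc k by (simp add: take_Suc_conv_app_nth)
qed

definition speed :: complex where
  "speed = (SOME w. affine_right f 0 w)"

lemma affine_right_speed: "affine_right f 0 speed"
proof -
  obtain w where "affine_right f 0 w"
    using local_motion[OF ngon traj, of 0] by metis
  then show ?thesis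
    unfolding speed_def by (rule someI)
qed

lemma speed_neq_0: "speed \<noteq> 0"
  using outgoing_neq_0[OF ngon traj affine_right_speed] .

lemma unfolded: "0 \<le> t \<Longrightarrow> unfolded_path P f t = f 0 + of_real t * speed"
  using unfolded_straight[OF ngon traj affine_right_speed] .

abbreviation arc :: "nat \<Rightarrow> real \<Rightarrow> complex" where
  "arc \<equiv> chord P es (f 0) speed"

lemma trajectory_from_itinerary:
  assumes "0 \<le> t" "itinerary P f t = take k es"
  shows "f t = arc k t"
proof -
  have "develop P (take k es) (f t) = f 0 + of_real t * speed"
    using unfolded[OF assms(1)] assms(2) by (simp add: unfolded_path_def)
  moreover have "develop P (rev (take k es)) (develop P (take k es) (f t)) = f t"
    by (rule develop_rev_develop) (use edge_dir_es in_set_takeD in fastforce)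
  ultimately show ?thesis
    by (simp add: chord_def)
qed

lemma trajectory_arc:
  assumes k: "k < m" and t: "strike k \<le> t" "t \<le> strike (Suc k)"
  shows "f t = arc k t"
proof (cases "t = strike (Suc k)")
  case True
  \<comment> \<open>At the end of the chord the itinerary already contains the next letter; undoing
    its reflection, which fixes the point struck, returns to chord \<open>k\<close>.\<close>
  have "f t = arc (Suc k) t"
    using trajectory_from_itinerary[of t "Suc k"] itinerary_strike[of "Suc k"] strike_in(1)[OF k] k True by simp
  then have "f t = reflect P (es ! k) (arc k t)"
    using chord_Suc[OF k] by simp
  moreover have "reflect P (es ! k) (f t) = f t"
    using reflect_edge[OF edge_dir_es strike_edge(2)[OF k]] k True by simp
  ultimately show ?thesis
    using reflect_involution[OF edge_dir_es] k by (metis nth_mem)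
next
  case False
  have "itinerary P f t = itinerary P f (strike k)"
    using t False by (intro itinerary_const[OF ngon traj] between_strikes[OF k]) auto
  then show ?thesis
    using trajectory_from_itinerary[of t k] itinerary_strike[of k] strike_nonneg[of k] k t by simp
qed

lemma arc_right:
  assumes k: "k < m"
  shows "affine_right f (strike k) (chord_dir P es speed k)"
proof (rule affine_rightI[of "strike (Suc k) - strike k"])
  fix s assume s: "strike k \<le> s" "s < strike k + (strike (Suc k) - strike k)"
  have "f s = arc k s" "f (strike k) = arc k (strike k)"
    using trajectory_arc[OF k] s strike_less[OF k] by auto
  then show "f s = f (strike k) + of_real (s - strike k) * chord_dir P es speed k"
    by (simp only:) (rule chord_affine')
qed (use strike_less[OF k] in simp)

lemma arc_left:
  assumes k: "k < m"
  shows "affine_left f (strike (Suc k)) (chord_dir P es speed k)"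
proof (rule affine_leftI[of "strike (Suc k) - strike k"])
  fix s assume s: "strike (Suc k) - (strike (Suc k) - strike k) < s" "s \<le> strike (Suc k)"
  have "f s = arc k s" "f (strike (Suc k)) = arc k (strike (Suc k))"
    using trajectory_arc[OF k] s strike_less[OF k] by auto
  then show "f s = f (strike (Suc k)) + of_real (s - strike (Suc k)) * chord_dir P es speed k"
    by (simp only:) (rule chord_affine')
qed (use strike_less[OF k] in simp)

text \<open>The edge that chord \<open>k\<close> leaves; chord 0 leaves the edge struck last,
  because the strike at time 1 is the starting point.\<close>

definition from_edge :: "nat \<Rightarrow> nat" where
  "from_edge k = es ! (if k = 0 then m - 1 else k - 1)"

lemma from_edge:
  assumes k: "k < m"
  shows "from_edge k < n" "f (strike k) \<in> edge P (from_edge k)"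
proof -
  have "from_edge k < n \<and> f (strike k) \<in> edge P (from_edge k)"
  proof (cases k)
    case 0
    have "f (strike k) = f (strike (Suc (m - 1)))"
      using 0 m_pos strike_m per[of 0] by (simp add: strike_0)
    then show ?thesis
      using strike_edge[of "m - 1"] m_pos 0 by (simp add: from_edge_def)
  next
    case (Suc l)
    then show ?thesis
      using strike_edge[of l] k by (simp add: from_edge_def)
  qed
  then show "from_edge k < n" "f (strike k) \<in> edge P (from_edge k)"
    by auto
qed

lemma transverse_from: "k < m \<Longrightarrow> Im (chord_dir P es speed k * cnj (edge_dir P (from_edge k))) \<noteq> 0"
  using no_grazing[OF ngon traj from_edge arc_right] by blast

text \<open>Grazing was excluded for outgoing velocities; a reflection only reverses the normal
  component, so the incoming velocity is transverse as well.\<close>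

lemma transverse_to:
  assumes k: "k < m"
  shows "Im (chord_dir P es speed k * cnj (edge_dir P (es ! k))) \<noteq> 0"
proof -
  obtain u w where u: "affine_left f (strike (Suc k)) u" "affine_right f (strike (Suc k)) w" "w = reflect_dir P (es ! k) u"
    using local_motion[OF ngon traj, of "strike (Suc k)"] strike_edge[OF k] by metis
  have "u = chord_dir P es speed k"
    using affine_left_unique[OF u(1) arc_left[OF k]] .
  moreover have "Im (w * cnj (edge_dir P (es ! k))) \<noteq> 0"
    using no_grazing[OF ngon traj strike_edge[OF k] u(2)] .
  ultimately show ?thesis
    using Im_reflect_dir[OF edge_dir_es, of "es ! k" u] u(3) k by simp
qed

lemma arc_inside:
  assumes k: "k < m" and t: "strike k < t" "t < strike (Suc k)"
  shows "arc k t \<in> inside (boundary P)"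
  using between_strikes[OF assms] trajectory_arc[OF k, of t] t avoid_vertices(1)[OF ngon traj, of t]
  by (simp add: region_def)

text \<open>Along the chord the boundary is met only at the two ends, and there the edge is unique
  since vertices are avoided.\<close>

lemma arc_avoids_edge:
  assumes k: "k < m" and j: "j < n" "j \<noteq> es ! k" "j \<noteq> from_edge k"
  shows "closed_segment (arc k (strike k)) (arc k (strike (Suc k))) \<inter> edge P j = {}"
proof (rule ccontr)
  assume "\<not> ?thesis"
  then obtain z where z: "z \<in> closed_segment (arc k (strike k)) (arc k (strike (Suc k)))" "z \<in> edge P j"
    by blast
  obtain t where t: "t \<in> {strike k..strike (Suc k)}" "z = arc k t"
    using chord_segment[OF z(1) less_imp_le[OF strike_less[OF k]]] by blast
  have ft: "f t \<in> edge P j"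
    using trajectory_arc[OF k, of t] t z(2) by simp
  have "f t \<in> boundary P"
    using ft edge_subset_boundary[of j P] j(1) ngon_length[OF ngon] by auto
  then have "t = strike k \<or> t = strike (Suc k)"
    using between_strikes[OF k, of t] t(1) by force
  then show False
    using unique_edge[OF ngon avoid_vertices(2)[OF ngon traj] ft _ j(1)] from_edge[OF k] strike_edge[OF k] j(2,3)
    by metis
qed

end

section \<open>Transfer to a nearby polygon\<close>

locale closed_billiard_base = closed_billiard +
  fixes r
  assumes r: "r \<in> {0..1}" "f 0 = edge_point P (from_edge 0) r"
    and even: "even (length es)" and balanced: "\<And>i. i < n \<Longrightarrow> signed_count i es = 0"
begin

definition start_point :: "complex list \<Rightarrow> complex" where
  "start_point Q = edge_point Q (from_edge 0) r"

definition displacement :: "complex list \<Rightarrow> complex" where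
  "displacement Q = develop Q es (start_point Q) - start_point Q"

abbreviation chord_of :: "complex list \<Rightarrow> nat \<Rightarrow> real \<Rightarrow> complex" where
  "chord_of Q \<equiv> chord Q es (start_point Q) (displacement Q)"

abbreviation dir_of :: "complex list \<Rightarrow> nat \<Rightarrow> complex" where
  "dir_of Q \<equiv> chord_dir Q es (displacement Q)"

text \<open>The slope of \<open>side\<close> along chord \<open>k\<close> with respect to the edge
  it should hit; it is nonzero exactly when chord and edge are transverse.\<close>

definition rate :: "complex list \<Rightarrow> nat \<Rightarrow> real" where
  "rate Q k = Im (dir_of Q k * cnj (edge_dir Q (es ! k)))"

text \<open>
  For \<open>k > 0\<close>, the parameter at which the line containing the preceding chord meets the line of the
  edge on which that chord should end: the zero of an affine function.
\<close>

definition time :: "complex list \<Rightarrow> nat \<Rightarrow> real" where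
  "time Q k = (if k = 0 then 0 else - side Q (es ! (k - 1)) (chord_of Q (k - 1) 0) / rate Q (k - 1))"

lemma from_edge_0: "from_edge 0 < n" "from_edge 0 = es ! (m - 1)"
  using from_edge(1)[of 0] m_pos by (auto simp: from_edge_def)

lemma start_point_P: "start_point P = f 0"
  by (simp add: start_point_def r(2))

lemma displacement_P: "displacement P = speed"
proof -
  have "unfolded_path P f 1 = develop P es (f 1)"
    by (simp add: unfolded_path_def es_def)
  moreover have "f 1 = f 0"
    using per[of 0] by simp
  ultimately have "develop P es (f 0) = f 0 + speed"
    using unfolded[of 1] by simp
  then show ?thesis
    by (simp add: displacement_def start_point_P)
qed

text \<open>With all counts zero the alternating angle sum vanishes identically in the angles, so
  the word acts as a translation for every \<open>n\<close>-gon.\<close>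

lemma translation:
  assumes Q: "ngon n Q"
  shows "develop Q es z = z + displacement Q" "is_translation (develop Q es)"
proof -
  have "alternating_sum (edge_angle Q) es = 0"
    using alternating_sum_real[OF set_es] balanced by simp
  then show t: "is_translation (develop Q es)"
    using is_translation_develop_iff[of es Q] set_es edge_dir_neq_0[OF Q] even by auto
  then show "develop Q es z = z + displacement Q"
    by (auto simp: is_translation_def displacement_def)
qed

lemma es_nth_less: "k < m \<Longrightarrow> es ! k < n"
  using strike_edge(1) .

lemma tendsto_start_point: "(start_point \<longlongrightarrow> f 0) (near P)"
  unfolding start_point_def[abs_def] r(2)
  using from_edge_0(1) by (intro tendsto_near_edge_point) (simp add: ngon_length[OF ngon])

lemma es_valid: "e \<in> set es' \<Longrightarrow> set es' \<subseteq> set es \<Longrightarrow> e < length P \<and> edge_dir P e \<noteq> 0"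
  using set_es edge_dir_es ngon_length[OF ngon] by auto

lemma tendsto_displacement: "(displacement \<longlongrightarrow> speed) (near P)"
proof -
  have "(displacement \<longlongrightarrow> develop P es (f 0) - f 0) (near P)"
    unfolding displacement_def[abs_def]
    by (intro tendsto_diff tendsto_near_develop tendsto_start_point es_valid) auto
  then show ?thesis
    using displacement_P by (simp add: displacement_def start_point_P)
qed

lemma set_rev_take: "set (rev (take k es)) \<subseteq> set es"
  by (simp add: set_take_subset)

lemma tendsto_chord_of:
  assumes "(t \<longlongrightarrow> t0) (near P)"
  shows "((\<lambda>Q. chord_of Q k (t Q)) \<longlongrightarrow> arc k t0) (near P)"
  unfolding chord_def using assms es_valid[OF _ set_rev_take]
  by (intro tendsto_near_develop tendsto_intros tendsto_start_point tendsto_displacement) auto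

lemma tendsto_dir_of: "((\<lambda>Q. dir_of Q k) \<longlongrightarrow> chord_dir P es speed k) (near P)"
  unfolding chord_dir_def using es_valid[OF _ set_rev_take]
  by (intro tendsto_near_develop tendsto_displacement) auto

lemma tendsto_rate:
  assumes "k < m"
  shows "((\<lambda>Q. rate Q k) \<longlongrightarrow> Im (chord_dir P es speed k * cnj (edge_dir P (es ! k)))) (near P)"
  unfolding rate_def using es_nth_less[OF assms]
  by (intro tendsto_intros tendsto_dir_of tendsto_near_edge_dir) (simp add: ngon_length[OF ngon])

lemma tendsto_time:
  assumes "k \<le> m"
  shows "((\<lambda>Q. time Q k) \<longlongrightarrow> strike k) (near P)"
proof (cases k)
  case 0
  then show ?thesis
    by (simp add: time_def strike_0)
next
  case (Suc l)
  then have l: "l < m"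
    using assms by simp
  let ?c = "Im (chord_dir P es speed l * cnj (edge_dir P (es ! l)))"
  have "((\<lambda>Q. - side Q (es ! l) (chord_of Q l 0) / rate Q l) \<longlongrightarrow> - side P (es ! l) (arc l 0) / ?c) (near P)"
    using es_nth_less[OF l] transverse_to[OF l]
    by (intro tendsto_intros tendsto_near_side tendsto_chord_of tendsto_rate l) (simp_all add: ngon_length[OF ngon])
  \<comment> \<open>For \<open>P\<close> itself the zero of the affine function is the actual time
    of the strike.\<close>
  moreover have "- side P (es ! l) (arc l 0) / ?c = strike (Suc l)"
  proof -
    have "arc l (strike (Suc l)) \<in> edge P (es ! l)"
      using strike_edge(2)[OF l] trajectory_arc[OF l, of "strike (Suc l)"] strike_less[OF l] by simp
    then have "0 = side P (es ! l) (arc l 0) + (strike (Suc l) - 0) * ?c"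
      using side_chord[of P "es ! l" es "f 0" speed l "strike (Suc l)" 0] side_edge by simp
    then show ?thesis
      using transverse_to[OF l] by (simp add: field_simps)
  qed
  ultimately show ?thesis
    using Suc by (simp add: time_def)
qed

lemma side_at_time:
  assumes "rate Q k \<noteq> 0"
  shows "side Q (es ! k) (chord_of Q k t) = (t - time Q (Suc k)) * rate Q k"
proof -
  have s: "side Q (es ! k) (chord_of Q k t) = side Q (es ! k) (chord_of Q k 0) + t * rate Q k"
    using side_chord[of Q "es ! k" es "start_point Q" "displacement Q" k t 0] unfolding rate_def diff_zero .
  show ?thesis
    unfolding s time_def using assms by (simp add: left_diff_distrib distrib_right)
qed

lemma chord_of_m: "ngon n Q \<Longrightarrow> chord_of Q m t = chord_of Q 0 (t - 1)"
proof -
  assume Q: "ngon n Q"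
  have "start_point Q + of_real t * displacement Q = develop Q es (start_point Q + of_real (t - 1) * displacement Q)"
    unfolding translation(1)[OF Q] by (simp add: algebra_simps)
  moreover have "develop Q (rev es) (develop Q es z) = z" for z
    by (rule develop_rev_develop) (use set_es edge_dir_neq_0[OF Q] in auto)
  ultimately show ?thesis
    by (simp add: chord_def)
qed

text \<open>Conditions that hold for \<open>P\<close> and persist under small perturbations:
  transversality at both edges, the order of the times, an end in the interior of the target edge,
  no contact with third edges, and one point inside the polygon.\<close>

definition good_chord :: "complex list \<Rightarrow> nat \<Rightarrow> bool" where
  "good_chord Q k \<longleftrightarrow> rate Q k \<noteq> 0 \<and> Im (dir_of Q k * cnj (edge_dir Q (from_edge k))) \<noteq> 0 \<and>
     time Q k < time Q (Suc k) \<and>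
     Re ((chord_of Q k (time Q (Suc k)) - Q ! (es ! k)) / edge_dir Q (es ! k)) \<in> {0<..<1} \<and>
     (\<forall>j<n. j \<noteq> es ! k \<longrightarrow> j \<noteq> from_edge k \<longrightarrow>
        closed_segment (chord_of Q k (time Q k)) (chord_of Q k (time Q (Suc k))) \<inter> edge Q j = {}) \<and>
     chord_of Q k ((time Q k + time Q (Suc k)) / 2) \<in> inside (boundary Q)"

lemma eventually_good_chord:
  assumes k: "k < m"
  shows "\<forall>\<^sub>F Q in near P. good_chord Q k"
proof -
  let ?e = "es ! k"
  have t0: "((\<lambda>Q. time Q k) \<longlongrightarrow> strike k) (near P)" and t1: "((\<lambda>Q. time Q (Suc k)) \<longlongrightarrow> strike (Suc k)) (near P)"
    using k by (auto intro: tendsto_time)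
  have e: "?e < n" "edge_dir P ?e \<noteq> 0"
    using es_nth_less[OF k] edge_dir_neq_0[OF ngon] by auto
  have 1: "\<forall>\<^sub>F Q in near P. rate Q k \<noteq> 0"
    by (rule tendsto_imp_eventually_ne[OF tendsto_rate[OF k] transverse_to[OF k]])
  have "((\<lambda>Q. Im (dir_of Q k * cnj (edge_dir Q (from_edge k)))) \<longlongrightarrow>
      Im (chord_dir P es speed k * cnj (edge_dir P (from_edge k)))) (near P)"
    using from_edge(1)[OF k] by (intro tendsto_intros tendsto_dir_of tendsto_near_edge_dir) (simp add: ngon_length[OF ngon])
  then have 2: "\<forall>\<^sub>F Q in near P. Im (dir_of Q k * cnj (edge_dir Q (from_edge k))) \<noteq> 0"
    by (rule tendsto_imp_eventually_ne) (rule transverse_from[OF k])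
  have "((\<lambda>Q. time Q (Suc k) - time Q k) \<longlongrightarrow> strike (Suc k) - strike k) (near P)"
    by (intro tendsto_intros t0 t1)
  then have "\<forall>\<^sub>F Q in near P. 0 < time Q (Suc k) - time Q k"
    by (rule order_tendstoD) (use strike_less[OF k] in simp)
  then have 3: "\<forall>\<^sub>F Q in near P. time Q k < time Q (Suc k)"
    by (rule eventually_mono) simp
  let ?x = "(arc k (strike (Suc k)) - P ! ?e) / edge_dir P ?e"
  have lim: "((\<lambda>Q. Re ((chord_of Q k (time Q (Suc k)) - Q ! ?e) / edge_dir Q ?e)) \<longlongrightarrow> Re ?x) (near P)"
    using e by (intro tendsto_intros tendsto_chord_of t1 tendsto_near_nth tendsto_near_edge_dir) (auto simp: ngon_length[OF ngon])
  have arc_end: "arc k (strike (Suc k)) = f (strike (Suc k))"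
    using trajectory_arc[OF k, of "strike (Suc k)"] strike_less[OF k] by simp
  have x: "Re ?x \<in> {0<..<1}"
  proof -
    obtain q where q: "0 \<le> q" "q \<le> 1" "f (strike (Suc k)) = edge_point P ?e q"
      using edgeE[OF strike_edge(2)[OF k]] by blast
    have "edge_point P ?e 0 \<in> set P" "edge_point P ?e 1 \<in> set P"
      using vertex_in_set[OF ngon, of ?e] vertex_in_set[OF ngon, of "Suc ?e"] e
      by (auto simp: edge_point_eq edge_dir_def ngon_length[OF ngon])
    then have "q \<noteq> 0" "q \<noteq> 1"
      using avoid_vertices(2)[OF ngon traj, of "strike (Suc k)"] q(3) by metis+
    moreover have "?x = of_real q"
      using q(3) e by (simp add: arc_end edge_point_eq)
    ultimately show ?thesis
      using q by simp
  qed
  have 4: "\<forall>\<^sub>F Q in near P. Re ((chord_of Q k (time Q (Suc k)) - Q ! ?e) / edge_dir Q ?e) \<in> {0<..<1}"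
    by (rule topological_tendstoD[OF lim open_greaterThanLessThan x])
  have 5: "\<forall>\<^sub>F Q in near P. \<forall>j\<in>{..<n}. j \<noteq> ?e \<longrightarrow> j \<noteq> from_edge k \<longrightarrow>
      closed_segment (chord_of Q k (time Q k)) (chord_of Q k (time Q (Suc k))) \<inter> edge Q j = {}"
  proof (rule eventually_ball_finite, simp, intro ballI)
    fix j assume "j \<in> {..<n}"
    then have j: "j < n"
      by simp
    show "\<forall>\<^sub>F Q in near P. j \<noteq> ?e \<longrightarrow> j \<noteq> from_edge k \<longrightarrow>
      closed_segment (chord_of Q k (time Q k)) (chord_of Q k (time Q (Suc k))) \<inter> edge Q j = {}"
    proof (cases "j \<noteq> ?e \<and> j \<noteq> from_edge k")
      case True
      have sj: "Suc j mod n < n"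
        using j by simp
      have "closed_segment (arc k (strike k)) (arc k (strike (Suc k))) \<inter>
          closed_segment (P ! j) (P ! (Suc j mod n)) = {}"
        using arc_avoids_edge[OF k j] True by (simp add: edge_eq_segment ngon_length[OF ngon])
      then have "\<forall>\<^sub>F Q in near P. closed_segment (chord_of Q k (time Q k)) (chord_of Q k (time Q (Suc k))) \<inter>
          closed_segment (Q ! j) (Q ! (Suc j mod n)) = {}"
        using eventually_disjoint_segments[OF tendsto_chord_of[OF t0, of k] tendsto_chord_of[OF t1, of k]
            tendsto_near_nth[of j P] tendsto_near_nth[of "Suc j mod n" P]] j sj by (simp add: ngon_length[OF ngon])
      then show ?thesis
        using eventually_near_length[of P]
        by eventually_elim (simp add: edge_eq_segment ngon_length[OF ngon])
    qed auto
  qed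
  have lim_mid: "((\<lambda>Q. chord_of Q k ((time Q k + time Q (Suc k)) / 2)) \<longlongrightarrow> arc k ((strike k + strike (Suc k)) / 2)) (near P)"
    by (intro tendsto_chord_of tendsto_intros t0 t1) simp
  have "arc k ((strike k + strike (Suc k)) / 2) \<in> inside (boundary P)"
    using strike_less[OF k] by (intro arc_inside[OF k]) auto
  from eventually_near_inside[OF ngon this lim_mid]
  have 6: "\<forall>\<^sub>F Q in near P. chord_of Q k ((time Q k + time Q (Suc k)) / 2) \<in> inside (boundary Q)" .
  from 1 2 3 4 5 6 show ?thesis
    by eventually_elim (simp add: good_chord_def)
qed

text \<open>Transversality lets a chord meet the edges it joins only at its ends, and third edges
  are excluded, so the open chord misses the boundary. Being connected with its midpoint inside, it
  lies inside altogether.\<close>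

lemma closed_chords_if_good:
  assumes Q: "ngon n Q" and good: "\<And>k. k < m \<Longrightarrow> good_chord Q k" and disp: "displacement Q \<noteq> 0"
  shows "closed_chords n Q es (start_point Q) (displacement Q) (time Q)"
proof -
  have lenQ: "length Q = n"
    using ngon_length[OF Q] .
  note dQ = edge_dir_neq_0[OF Q es_nth_less]
  have end_side: "side Q (es ! k) (chord_of Q k (time Q (Suc k))) = 0" if "k < m" for k
    using side_at_time[of Q k] good[OF that] by (simp add: good_chord_def)
  have end_edge: "chord_of Q k (time Q (Suc k)) \<in> edge Q (es ! k)" if k: "k < m" for k
  proof -
    obtain q where q: "chord_of Q k (time Q (Suc k)) = edge_point Q (es ! k) q"
      using side_eq_0[OF end_side[OF k] dQ[OF k]] by blast
    have "(chord_of Q k (time Q (Suc k)) - Q ! (es ! k)) / edge_dir Q (es ! k) = of_real q"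
      using q dQ[OF k] by (simp add: edge_point_eq)
    then have "q \<in> {0..1}"
      using good[OF k] by (simp add: good_chord_def)
    then show ?thesis
      using edgeI q by simp
  qed
  have start_edge: "chord_of Q k (time Q k) \<in> edge Q (from_edge k)" if k: "k < m" for k
  proof (cases k)
    case 0
    then show ?thesis
      using edgeI[OF r(1)] by (simp add: chord_def time_def start_point_def)
  next
    case (Suc l)
    then have l: "l < m"
      using k by simp
    have "chord_of Q (Suc l) (time Q (Suc l)) = reflect Q (es ! l) (chord_of Q l (time Q (Suc l)))"
      by (rule chord_Suc[OF l])
    also have "\<dots> = chord_of Q l (time Q (Suc l))"
      by (rule reflect_edge[OF dQ[OF l] end_edge[OF l]])
    finally show ?thesis
      using end_edge[OF l] Suc by (simp add: from_edge_def)
  qed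
  have off_from: "chord_of Q k t \<notin> edge Q (from_edge k)" if k: "k < m" and t: "t \<noteq> time Q k" for k t
  proof
    assume "chord_of Q k t \<in> edge Q (from_edge k)"
    then have "(t - time Q k) * Im (dir_of Q k * cnj (edge_dir Q (from_edge k))) = 0"
      using side_chord[of Q "from_edge k" es "start_point Q" "displacement Q" k t "time Q k"]
        side_edge[OF start_edge[OF k]] side_edge[of "chord_of Q k t" Q "from_edge k"] by simp
    then show False
      using t good[OF k] by (simp add: good_chord_def)
  qed
  have off_to: "chord_of Q k t \<notin> edge Q (es ! k)" if k: "k < m" and t: "t \<noteq> time Q (Suc k)" for k t
  proof
    assume "chord_of Q k t \<in> edge Q (es ! k)"
    then have "(t - time Q (Suc k)) * rate Q k = 0"
      using side_at_time[of Q k t] good[OF k] side_edge by (simp add: good_chord_def)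
    then show False
      using t good[OF k] by (simp add: good_chord_def)
  qed
  have off_other: "chord_of Q k t \<notin> edge Q j"
    if k: "k < m" and t: "t \<in> {time Q k..time Q (Suc k)}" and j: "j < n" "j \<noteq> es ! k" "j \<noteq> from_edge k" for k t j
    using closed_segment_chord[OF t, of Q es "start_point Q" "displacement Q" k] good[OF k] j
    unfolding good_chord_def by blast
  have off_boundary: "chord_of Q k t \<notin> boundary Q" if k: "k < m" and t: "time Q k < t" "t < time Q (Suc k)" for k t
  proof -
    have "chord_of Q k t \<notin> edge Q j" if "j < n" for j
      using off_from[OF k, of t] off_to[OF k, of t] off_other[OF k _ that, of t] t by fastforce
    then show ?thesis
      by (auto simp: boundary_def lenQ)
  qed
  have inside: "chord_of Q k t \<in> inside (boundary Q)" if k: "k < m" and t: "time Q k < t" "t < time Q (Suc k)" for k t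
  proof -
    let ?S = "chord_of Q k ` {time Q k<..<time Q (Suc k)}"
    have "continuous_on {time Q k<..<time Q (Suc k)} (\<lambda>t. chord_of Q k 0 + of_real (t - 0) * dir_of Q k)"
      by (intro continuous_intros)
    then have "continuous_on {time Q k<..<time Q (Suc k)} (chord_of Q k)"
      by (simp only: chord_affine'[symmetric])
    then have "connected ?S"
      by (intro connected_continuous_image) simp_all
    moreover have "?S \<inter> boundary Q = {}"
      using off_boundary[OF k] by auto
    moreover have "chord_of Q k ((time Q k + time Q (Suc k)) / 2) \<in> ?S"
      using good[OF k] by (intro imageI) (simp add: good_chord_def)
    moreover have "chord_of Q k ((time Q k + time Q (Suc k)) / 2) \<in> inside (boundary Q)"
      using good[OF k] by (simp add: good_chord_def)
    ultimately have "?S \<subseteq> inside (boundary Q)"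
      by (rule connected_inside[OF Q])
    then show ?thesis
      using t by auto
  qed
  have not_vertex: "chord_of Q k (time Q (Suc k)) \<notin> set Q" if k: "k < m" for k
  proof -
    have lt: "time Q k < time Q (Suc k)"
      using good[OF k] by (simp add: good_chord_def)
    have "chord_of Q k (time Q (Suc k)) \<notin> edge Q j" if "j < n" "j \<noteq> es ! k" for j
      using off_from[OF k, of "time Q (Suc k)"] off_other[OF k _ that, of "time Q (Suc k)"] lt by fastforce
    then have "chord_of Q k (time Q (Suc k)) \<notin> other_edges n Q (es ! k)"
      by (auto simp: other_edges_def[OF Q])
    then show ?thesis
      using set_subset_other_edges[OF Q es_nth_less[OF k]] by blast
  qed
  \<comment> \<open>The translation brings the last chord back to the starting point at parameter 1.
    This point lies on the last edge, and by transversality the chord meets the line of that edge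
    only once.\<close>
  have time_m: "time Q m = 1"
  proof -
    obtain l where l: "m = Suc l" "l < m"
      using m_pos by (cases m) auto
    have "chord_of Q m 1 = start_point Q"
      using chord_of_m[OF Q, of 1] by (simp add: chord_def)
    then have eq: "reflect Q (es ! l) (chord_of Q l 1) = start_point Q"
      using chord_Suc[OF l(2), of Q "start_point Q" "displacement Q" 1] l(1) by simp
    have "start_point Q \<in> edge Q (es ! l)"
      using edgeI[OF r(1)] from_edge_0(2) l(1) by (simp add: start_point_def)
    then have "reflect Q (es ! l) (start_point Q) = start_point Q" "side Q (es ! l) (start_point Q) = 0"
      using reflect_edge[OF dQ[OF l(2)]] side_edge by auto
    then have "chord_of Q l 1 = start_point Q"
      using eq reflect_involution[OF dQ[OF l(2)]] by metis
    then have "(1 - time Q (Suc l)) * rate Q l = 0"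
      using side_at_time[of Q l 1] good[OF l(2)] \<open>side Q (es ! l) (start_point Q) = 0\<close>
      by (simp add: good_chord_def)
    then show ?thesis
      using good[OF l(2)] l(1) by (simp add: good_chord_def)
  qed
  show ?thesis
  proof unfold_locales
    show "ngon n Q" by (rule Q)
    show "es \<noteq> []" using m_pos by auto
    show "set es \<subseteq> {..<n}" by (rule set_es)
    show "displacement Q \<noteq> 0" by (rule disp)
    show "time Q 0 = 0" by (simp add: time_def)
    show "time Q m = 1" by (rule time_m)
    show "time Q k < time Q (Suc k)" if "k < m" for k
      using good[OF that] by (simp add: good_chord_def)
    show "chord_of Q k t \<in> inside (boundary Q)" if "k < m" "time Q k < t" "t < time Q (Suc k)" for k t
      using inside[OF that] .
    show "chord_of Q k (time Q (Suc k)) \<in> edge Q (es ! k)" if "k < m" for k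
      using end_edge[OF that] .
    show "chord_of Q k (time Q (Suc k)) \<notin> set Q" if "k < m" for k
      using not_vertex[OF that] .
    show "develop Q es z = z + displacement Q" for z
      by (rule translation(1)[OF Q])
  qed
qed

lemma eventually_transfer:
  "\<forall>\<^sub>F Q in near P. \<exists>g. transfer_based P f Q g \<and> periodic_trajectory Q g"
proof -
  have "\<forall>\<^sub>F Q in near P. \<forall>k\<in>{..<m}. good_chord Q k"
    by (rule eventually_ball_finite) (simp_all add: eventually_good_chord)
  moreover have "\<forall>\<^sub>F Q in near P. displacement Q \<noteq> 0"
    by (rule tendsto_imp_eventually_ne[OF tendsto_displacement speed_neq_0])
  ultimately show ?thesis
    using eventually_near_ngon[OF ngon]
  proof eventually_elim
    case (elim Q)
    interpret c: closed_chords n Q es "start_point Q" "displacement Q" "time Q"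
      using closed_chords_if_good[OF elim(3) _ elim(2)] elim(1) by blast
    \<comment> \<open>The rotation and rescaling carrying the displacement of the trajectory on
      \<open>P\<close> to the one prescribed by \<open>Q\<close>.\<close>
    let ?k = "displacement Q / speed"
    have F: "unfolded_path P f t - unfolded_path P f 0 = of_real t * speed" if "0 \<le> t" for t
      using unfolded[OF that] unfolded[of 0] by simp
    have line: "start_point Q + ?k * (unfolded_path P f t - unfolded_path P f 0) = start_point Q + of_real t * displacement Q"
      if "t \<in> {0..1}" for t
      using F[of t] that speed_neq_0 by simp
    have "?k * (unfolded_path P f 1 - unfolded_path P f 0) = develop Q es (start_point Q) - start_point Q"
      using F[of 1] speed_neq_0 by (simp add: displacement_def)
    moreover have "\<forall>t\<in>{0..1}. start_point Q + ?k * (unfolded_path P f t - unfolded_path P f 0) \<in> unfolding_region Q es"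
    proof
      fix t :: real assume t: "t \<in> {0..1}"
      show "start_point Q + ?k * (unfolded_path P f t - unfolded_path P f 0) \<in> unfolding_region Q es"
        unfolding line[OF t] c.unfolded_bounce(1)[OF t, symmetric] by (rule c.unfolded_bounce(2)[OF t])
    qed
    moreover have "\<forall>t\<in>{0..1}. unfolded_path Q c.bounce t = start_point Q + ?k * (unfolded_path P f t - unfolded_path P f 0)"
    proof
      fix t :: real assume t: "t \<in> {0..1}"
      show "unfolded_path Q c.bounce t = start_point Q + ?k * (unfolded_path P f t - unfolded_path P f 0)"
        unfolding line[OF t] by (rule c.unfolded_bounce(1)[OF t])
    qed
    ultimately have "transfer_based P f Q c.bounce"
      unfolding transfer_based_def Let_def es_def[symmetric] start_point_def[symmetric]
      using from_edge_0(1) ngon_length[OF ngon] r translation(2)[OF elim(3)] c.itinerary_1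
      by (intro exI[of _ "from_edge 0"] conjI bexI[of _ r] exI[of _ ?k] exI[of _ "start_point Q"])
        (simp_all add: start_point_def[symmetric])
    then show ?case
      using c.periodic_trajectory_bounce by blast
  qed
qed

end

text \<open>Without strikes the path would be straight with nonzero velocity and could not return
  after one period.\<close>

lemma periodic_strikes:
  assumes ngon: "ngon n P" and f: "periodic_trajectory P f"
  obtains s where "f s \<in> boundary P"
proof -
  have traj: "trajectory P f" "f 0 = f 1"
    using f by (auto simp: periodic_trajectory_def)
  obtain w where w: "affine_right f 0 w"
    using local_motion[OF ngon traj(1), of 0] by metis
  have "\<exists>s. f s \<in> boundary P"
  proof (rule ccontr)
    assume "\<not> ?thesis"
    then have "itinerary P f 1 = []"
      using itinerary_const[OF ngon traj(1), of 0 1] itinerary_0[OF ngon traj(1)] by simp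
    then have "f 1 = f 0 + w"
      using unfolded_straight[OF ngon traj(1) w, of 1] by (simp add: unfolded_path_def)
    then show False
      using traj(2) outgoing_neq_0[OF ngon traj(1) w] by simp
  qed
  then show ?thesis
    using that by blast
qed

text \<open>Transfer needs a starting point on an edge, so time is shifted to a strike. The shift
  rotates the itinerary, which changes signed counts at most by a sign and keeps them zero.\<close>

lemma balanced_imp_stable:
  assumes ngon: "ngon n P" and f: "periodic_trajectory P f"
    and even: "even (length (itinerary P f 1))" and bal: "\<forall>i<n. signed_count i (itinerary P f 1) = 0"
  shows "stable_trajectory P f"
proof -
  have traj: "trajectory P f"
    using f by (auto simp: periodic_trajectory_def)
  note per = periodic_trajectory_period[OF ngon f]
  obtain s where s: "f s \<in> boundary P"
    using periodic_strikes[OF ngon f] by blast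
  obtain A B where A: "itinerary P f 1 = A @ B" and B: "itinerary P (\<lambda>t. f (s + t)) 1 = B @ A"
    by (rule itinerary_rotation[OF ngon traj per])
  interpret closed_billiard n P "\<lambda>t. f (s + t)"
  proof unfold_locales
    show "ngon n P" by (rule ngon)
    show "trajectory P (\<lambda>t. f (s + t))" by (rule trajectory_shift[OF traj])
    show "f (s + (t + 1)) = f (s + t)" for t
      using per[of "s + t"] by (simp only: add.assoc)
    show "f (s + 0) \<in> boundary P" using s by simp
  qed
  have AB: "itinerary P f 1 = A @ B" "es = B @ A"
    using A B unfolding es_def by blast+
  have "f (s + 0) \<in> edge P (from_edge 0)"
    using from_edge(2)[OF m_pos] by (simp add: strike_0)
  then obtain r where r: "0 \<le> r" "r \<le> 1" "f (s + 0) = edge_point P (from_edge 0) r"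
    by (rule edgeE)
  interpret closed_billiard_base n P "\<lambda>t. f (s + t)" r
  proof unfold_locales
    show "even (length es)"
      using even AB by simp
    show "signed_count i es = 0" if "i < n" for i
    proof -
      have "signed_count i (B @ A) = signed_count i (A @ B) \<or> signed_count i (B @ A) = - signed_count i (A @ B)"
        unfolding signed_count_def by (rule alternating_sum_rotation) (use even AB in simp)
      then show ?thesis
        using bal that AB by auto
    qed
  qed (use r in auto)
  obtain \<epsilon> where \<epsilon>: "\<epsilon> > 0" "\<And>Q. length Q = length P \<Longrightarrow> \<forall>i<length P. dist (P ! i) (Q ! i) < \<epsilon> \<Longrightarrow>
     \<exists>g. transfer_based P (\<lambda>t. f (s + t)) Q g \<and> periodic_trajectory Q g"
    using eventually_transfer unfolding eventually_near by blast
  have "\<exists>g. transfer_to P f Q g \<and> periodic_trajectory Q g"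
    if "ngon (length P) Q" "\<forall>i<length P. dist (P ! i) (Q ! i) < \<epsilon>" for Q
    using \<epsilon>(2)[of Q] that s unfolding transfer_to_def ngon_def by blast
  then show ?thesis
    unfolding stable_trajectory_def using \<epsilon>(1) by blast
qed

theorem lemma2p1:
  fixes P :: "complex list" and n :: nat and f :: "real \<Rightarrow> complex"
  assumes "ngon n P"
    and "periodic_trajectory P f"
  shows "stable_trajectory P f \<longleftrightarrow> null_homologous (double P) (lift_path P f)"
proof -
  let ?es = "itinerary P f 1"
  have traj: "trajectory P f" "f 0 = f 1" and tr: "is_translation (develop P ?es)"
    using assms(2) by (auto simp: periodic_trajectory_def)
  have "edge_dir P e \<noteq> 0" if e: "e \<in> set ?es" for e
    using edge_dir_neq_0[OF assms(1)] set_itinerary[OF assms(1) traj(1)] e by blast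
  \<comment> \<open>A translation preserves orientation, whereas an odd number of reflections
    reverses it.\<close>
  then have "even (length ?es)"
    using is_translation_develop_iff tr by blast
  then show ?thesis
    using stable_imp_balanced[OF assms] balanced_imp_stable[OF assms]
      null_homologous_iff_balanced[OF assms(1) traj(1) _ traj(2)] by blast
qed

end
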